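(* Let $d\ge 2$, let $K\subset\binom{\mathbb P}{d}$ be a finite squarefree strongly stable $d$-uniform hypergraph, let $M\subset\binom{\mathbb P+d-1}{d}$ be a finite strongly stable collection, with $F(K),F(M)$ their associated $d$-partite $d$-uniform hypergraphs, and let $F$ be any (finite) $d$-partite $d$-uniform Ferrers hypergraph. Let $k$ be a field. (i) For any of the ideals $I=I(F(K)),\,I(F(M)),\,I(F)$ inside $S:=k[\mathbf x^{(1)},\dots,\mathbf x^{(d)}]$, labelling each vertex $(i_1,\dots,i_d)$ of the complex of boxes (inside $F(K)$, $F(M)$, $F$ respectively) by the monomial $x^{(1)}_{i_1}\cdots x^{(d)}_{i_d}$ gives a minimal linear cellular $S$-resolution of $S/I$. Hence $\beta_{\sum_j|X_j|-d,\;X_1\sqcup\cdots\sqcup X_d}(I)=1$ for every box $X_1\times\cdots\times X_d$ inside $F(K)$, $F(M)$, $F$ respectively, and all other multigraded Betti numbers of $I$ vanish. (ii) The specialization map $\mathrm{sp}:k[\mathbf x^{(1)},\dots,\mathbf x^{(d)}]\to k[\mathbf x]$, $x^{(j)}_i\mapsto x_i$, sends the resolution for $I(F(K))$ or $I(F(M))$ to a minimal, linear, cellular resolution for $I(K)$ or $I(M)$. In other words, re-labelling each vertex $(i_1,\dots,i_d)$ of the complex of boxes for $F(K)$ or $F(M)$ by $x_{i_1}\cdots x_{i_d}$ yields a cellular $k[\mathbf x]$-resolution of $I(K)$ or $I(M)$, respectively. In particular, $I(F(K))$ and $I(K)$ have the same $\mathbb Z$-graded Betti numbers, and $I(F(M))$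 and $I(M)$ have the same $\mathbb Z$-graded Betti numbers. (iii) If $M=\mathrm{depol}(K)$, then the bijection $\mathrm{depol}:\binom{\mathbb P}{d}\to\binom{\mathbb P+d-1}{d}$ induces a cellular isomorphism between the complexes of boxes for $I(F(K))$ and $I(F(M))$, preserving the degrees of the monomials $m_P$ labelling faces. Consequently, $I(K),I(M),I(F(K)),I(F(M))$ all have the same $\mathbb Z$-graded Betti numbers in this situation.
   Context: $\mathbb P=\{1,2,\dots\}$; $\binom{\mathbb P}{d}$ is the set of $d$-subsets $\{i_1<\dots<i_d\}$ and $\binom{\mathbb P+d-1}{d}$ the set of $d$-element multisets, i.e. sequences $(i_1\le\dots\le i_d)$ in $\mathbb P$. The Gale partial order on either set is componentwise: $(i_1,\dots,i_d)\le(i_1',\dots,i_d')$ iff $i_j\le i_j'$ for all $j$ (entries listed increasingly). $K\subset\binom{\mathbb P}{d}$ is squarefree strongly stable, resp. $M\subset\binom{\mathbb P+d-1}{d}$ is strongly stable, if it is an order ideal (down-set) in the Gale order. $\mathrm{depol}(\{i_1<\dots<i_d\})=(i_1,i_2-1,\dots,i_d-(d-1))$. $I(K)$ (resp. $I(M)$) is the ideal of a polynomial ring $k[\mathbf x]=k[x_1,\dots,x_N]$ ($N$ large enough) generated by $x_{i_1}\cdots x_{i_d}$ for $(i_1,\dots,i_d)\in K$ (resp. $M$). A $d$-partite $d$-uniform hypergraph on a partitioned vertex set $X^{(1)}\sqcup\dots\sqcup X^{(d)}$ is identified with a subset of $X^{(1)}\times\cdots\times X^{(d)}$. With $X^{(j)}=\{1^{(j)},2^{(j)},\dots\}$,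 $F(K)=\{(i_1^{(1)},\dots,i_d^{(d)}):\{i_1<\dots<i_d\}\in K\}$ and $F(M)=\{(i_1^{(1)},\dots,i_d^{(d)}):(i_1\le\dots\le i_d)\in M\}$. A Ferrers hypergraph $F\subseteq X^{(1)}\times\cdots\times X^{(d)}$ is one for which there are linear orderings on the $X^{(j)}$ making $F$ an order ideal in the componentwise order. For such a hypergraph $H$ ($=F,F(K),F(M)$), $I(H)\subset k[\mathbf x^{(1)},\dots,\mathbf x^{(d)}]$ is generated by $x^{(1)}_{i_1}\cdots x^{(d)}_{i_d}$ for $(i_1,\dots,i_d)\in H$, where $\mathbf x^{(j)}$ is a finite set of variables indexed by the relevant vertices of $X^{(j)}$. A box inside $H$ is a subset of $H$ of the form $X_1\times\dots\times X_d$ with nonempty $X_j\subseteq X^{(j)}$. The complex of boxes inside $H$ is the polyhedral subcomplex of the product of simplices $2^{X^{(1)}}\times\cdots\times2^{X^{(d)}}$ whose faces are indexed by the boxes inside $H$ (the face of $X_1\times\cdots\times X_d$ is a product of simplices of dimension $\sum_j(|X_j|-1)$); equivalently the vertex-induced subcomplex on the vertices in $H$. Cellular resolutions: if the vertices of a polyhedral complex $\mathcal C$ are labelled by monomials of a polynomial ring $S$ generating a monomial ideal $I$, label each face $P$ by the lcm $m_P$ of its vertex labels. Let $\mathcal F(\mathcal C)$ be the complex of free $S$-modules with a basis element $e_P$ of multidegree $m_P$ in position $\dim P$ for each face $P$ (including the empty face, in position $-1$, with $m_\varnothing=1$), and differential $d(e_P)=\sum_Q \mathrm{sgn}(P,Q)\frac{m_P}{m_Q}e_Q$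 over codimension-one faces $Q$ of $P$, with $\mathrm{sgn}(P,Q)=\pm1$ the incidence signs from an orientation of the cells. One says the labelled $\mathcal C$ gives a cellular resolution of $S/I$ (or of $I$) if $\mathcal F(\mathcal C)$ is a resolution of $S/I$. "Linear" means $d$-linear: all minimal generators have degree $d$ and the higher syzygy maps are given by linear forms (so $\deg m_P=\dim P+d$ for nonempty $P$). $\beta_{i,\alpha}(I)=\dim_k\mathrm{Tor}_i(I,k)_\alpha$ for the fine multigrading; a set of variables $X_1\sqcup\cdots\sqcup X_d$ denotes the squarefree multidegree given by its indicator vector. $\mathbb Z$-graded Betti numbers are $\beta_{ij}(I)=\dim_k\mathrm{Tor}_i(I,k)_j$. *)

theory Defs
  imports
    Complex_Main
    "HOL-Library.Poly_Mapping"
    "HOL-Library.Function_Algebras"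
    "HOL-Library.Multiset"
    "HOL-Algebra.Ideal"
begin

section \<open>Polynomial rings and monomial ideals\<close>

text \<open>
  A monomial is identified with its exponent vector; these vectors are also the multidegrees of
  the fine grading. Multiplication of monomials is addition.
\<close>

type_synonym 'v mono = "'v \<Rightarrow>\<^sub>0 nat"
type_synonym ('v, 'k) mpoly = "'v mono \<Rightarrow>\<^sub>0 'k"

definition mono_deg :: "'v mono \<Rightarrow> nat" where
  "mono_deg m = (\<Sum>v\<in>Poly_Mapping.keys m. Poly_Mapping.lookup m v)"

text \<open>The polynomial ring over \<open>'k\<close> whose variables are the elements of \<open>V\<close>.\<close>

definition polys :: "'v set \<Rightarrow> ('v, 'k::field) mpoly set" where
  "polys V = {p. \<forall>m\<in>Poly_Mapping.keys p. Poly_Mapping.keys m \<subseteq> V}"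

definition poly_ring :: "'v set \<Rightarrow> ('v, 'k::field) mpoly ring" where
  "poly_ring V = \<lparr>carrier = polys V, mult = (*), one = 1, zero = 0, add = (+)\<rparr>"

definition monomial_ideal :: "'v set \<Rightarrow> 'v mono set \<Rightarrow> ('v, 'k::field) mpoly set" where
  "monomial_ideal V G = genideal (poly_ring V) ((\<lambda>m. Poly_Mapping.single m 1) ` G)"


section \<open>Graded complexes of finitely generated free modules\<close>

text \<open>
  A complex of based free modules, indexed by the homological degree. For
  \<open>b \<in> cx_basis C (Suc i)\<close> and \<open>c \<in> cx_basis C i\<close>, the entry \<open>cx_diff C i b c\<close> is the
  coefficient of \<open>c\<close> in the image of \<open>b\<close> under the differential from degree \<open>Suc i\<close> to \<open>i\<close>.
\<close>

record (overloaded) ('b, 'g, 'v, 'k) free_complex =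
  cx_basis :: "nat \<Rightarrow> 'b set"
  cx_deg :: "nat \<Rightarrow> 'b \<Rightarrow> 'g"
  cx_diff :: "nat \<Rightarrow> 'b \<Rightarrow> 'b \<Rightarrow> ('v mono \<Rightarrow>\<^sub>0 'k)"

definition cx_module ::
  "'v set \<Rightarrow> ('b, 'g, 'v, 'k::field) free_complex \<Rightarrow> nat \<Rightarrow> ('b \<Rightarrow> ('v, 'k) mpoly) set" where
  "cx_module V C i = {f. (\<forall>b. f b \<in> polys V) \<and> (\<forall>b. b \<notin> cx_basis C i \<longrightarrow> f b = 0)}"

definition cx_map ::
  "('b, 'g, 'v, 'k::field) free_complex \<Rightarrow> nat \<Rightarrow> ('b \<Rightarrow> ('v, 'k) mpoly) \<Rightarrow> 'b \<Rightarrow> ('v, 'k) mpoly"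
  where
  "cx_map C i f =
     (\<lambda>c. if c \<in> cx_basis C i then \<Sum>b\<in>cx_basis C (Suc i). f b * cx_diff C i b c else 0)"

text \<open>
  Gradings are given by an additive map \<open>w\<close> from monomials to degrees: \<open>id\<close> for the fine
  grading, \<^const>\<open>mono_deg\<close> for the standard grading.
\<close>

definition graded_complex ::
  "'v set \<Rightarrow> ('v mono \<Rightarrow> 'g::comm_monoid_add) \<Rightarrow> ('b, 'g, 'v, 'k::field) free_complex \<Rightarrow> bool" where
  "graded_complex V w C \<longleftrightarrow>
     (\<forall>i. finite (cx_basis C i)) \<and>
     (\<forall>i. \<forall>b\<in>cx_basis C (Suc i). \<forall>c\<in>cx_basis C i.
        cx_diff C i b c \<in> polys V \<and>
        (\<forall>m\<in>Poly_Mapping.keys (cx_diff C i b c). w m + cx_deg C i c = cx_deg C (Suc i) b))"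

definition exact_at :: "'v set \<Rightarrow> ('b, 'g, 'v, 'k::field) free_complex \<Rightarrow> nat \<Rightarrow> bool" where
  "exact_at V C i \<longleftrightarrow> i \<ge> 1 \<and>
     {f \<in> cx_module V C i. cx_map C (i - 1) f = (\<lambda>_. 0)} = cx_map C i ` cx_module V C (Suc i)"

text \<open>
  \<open>C\<close> is a multigraded free resolution of \<open>S/I\<close>, where \<open>S = polys V\<close>, whose module in
  homological degree \<open>0\<close> is \<open>S\<close> itself, with augmentation the projection from \<open>S\<close> to \<open>S/I\<close>.
\<close>

definition resolves_quotient ::
  "'v set \<Rightarrow> ('v, 'k::field) mpoly set \<Rightarrow> ('b, 'v mono, 'v, 'k) free_complex \<Rightarrow> bool" where
  "resolves_quotient V I C \<longleftrightarrow>
     graded_complex V id C \<and>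
     (\<exists>z. cx_basis C 0 = {z} \<and> cx_deg C 0 z = 0 \<and>
          (\<lambda>f. cx_map C 0 f z) ` cx_module V C 1 = I) \<and>
     (\<forall>i\<ge>1. exact_at V C i)"

text \<open>The differential maps into the homogeneous maximal ideal times the next module.\<close>

definition minimal_complex :: "('b, 'g, 'v, 'k::field) free_complex \<Rightarrow> bool" where
  "minimal_complex C \<longleftrightarrow>
     (\<forall>i. \<forall>b\<in>cx_basis C (Suc i). \<forall>c\<in>cx_basis C i. Poly_Mapping.lookup (cx_diff C i b c) 0 = 0)"

text \<open>
  \<open>d\<close>-linearity of a resolution of \<open>S/I\<close>: the generators of \<open>I\<close> (homological degree \<open>1\<close>) have
  degree \<open>d\<close>, and all maps other than the one onto \<open>I\<close> have linear forms as entries.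
\<close>

definition linear_complex :: "nat \<Rightarrow> ('b, 'v mono, 'v, 'k::field) free_complex \<Rightarrow> bool" where
  "linear_complex d C \<longleftrightarrow>
     (\<forall>i. \<forall>b\<in>cx_basis C (Suc i). mono_deg (cx_deg C (Suc i) b) = i + d) \<and>
     (\<forall>i\<ge>1. \<forall>b\<in>cx_basis C (Suc i). \<forall>c\<in>cx_basis C i.
        \<forall>m\<in>Poly_Mapping.keys (cx_diff C i b c). mono_deg m = 1)"


section \<open>Graded Betti numbers\<close>

text \<open>
  \<open>G\<close> with augmentation \<open>\<epsilon>\<close> is a graded free resolution of the ideal \<open>I\<close> (rather than of
  \<open>S/I\<close>) by free modules of finite rank.
\<close>

definition resolves_ideal ::
  "'v set \<Rightarrow> ('v mono \<Rightarrow> 'g::comm_monoid_add) \<Rightarrow> ('v, 'k::field) mpoly set \<Rightarrow>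
   ('b, 'g, 'v, 'k) free_complex \<Rightarrow> ('b \<Rightarrow> ('v, 'k) mpoly) \<Rightarrow> bool" where
  "resolves_ideal V w I G \<epsilon> \<longleftrightarrow>
     graded_complex V w G \<and>
     (\<forall>b\<in>cx_basis G 0. \<epsilon> b \<in> polys V \<and> (\<forall>m\<in>Poly_Mapping.keys (\<epsilon> b). w m = cx_deg G 0 b)) \<and>
     (\<lambda>f. \<Sum>b\<in>cx_basis G 0. f b * \<epsilon> b) ` cx_module V G 0 = I \<and>
     {f \<in> cx_module V G 0. (\<Sum>b\<in>cx_basis G 0. f b * \<epsilon> b) = 0} = cx_map G 0 ` cx_module V G 1 \<and>
     (\<forall>i\<ge>1. exact_at V G i)"

text \<open>
  The complex \<open>G \<otimes> k\<close>, where \<open>k = S/(all variables)\<close>: it has the same bases over \<open>k\<close>, and the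
  matrix entries are replaced by their constant coefficients. \<open>red_space G i \<alpha>\<close> is the degree
  \<open>\<alpha>\<close> part in homological degree \<open>i\<close>.
\<close>

definition red_space :: "('b, 'g, 'v, 'k::field) free_complex \<Rightarrow> nat \<Rightarrow> 'g \<Rightarrow> ('b \<Rightarrow> 'k) set" where
  "red_space G i \<alpha> = {v. \<forall>b. v b \<noteq> 0 \<longrightarrow> b \<in> cx_basis G i \<and> cx_deg G i b = \<alpha>}"

definition red_map ::
  "('b, 'g, 'v, 'k::field) free_complex \<Rightarrow> nat \<Rightarrow> ('b \<Rightarrow> 'k) \<Rightarrow> 'b \<Rightarrow> 'k" where
  "red_map G i v = (\<lambda>c. if c \<in> cx_basis G i
     then \<Sum>b\<in>cx_basis G (Suc i). v b * Poly_Mapping.lookup (cx_diff G i b c) 0 else 0)"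

definition red_cycles ::
  "('b, 'g, 'v, 'k::field) free_complex \<Rightarrow> nat \<Rightarrow> 'g \<Rightarrow> ('b \<Rightarrow> 'k) set" where
  "red_cycles G i \<alpha> = {v \<in> red_space G i \<alpha>. i = 0 \<or> red_map G (i - 1) v = (\<lambda>_. 0)}"

definition red_boundaries ::
  "('b, 'g, 'v, 'k::field) free_complex \<Rightarrow> nat \<Rightarrow> 'g \<Rightarrow> ('b \<Rightarrow> 'k) set" where
  "red_boundaries G i \<alpha> = red_map G i ` red_space G (Suc i) \<alpha>"

abbreviation kdim :: "('b \<Rightarrow> 'k::field) set \<Rightarrow> nat" where
  "kdim \<equiv> vector_space.dim (\<lambda>a v b. a * v b)"

text \<open>The dimension of the quotient of the cycles by the boundaries, both finite-dimensional.\<close>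

definition red_homology_dim :: "('b, 'g, 'v, 'k::field) free_complex \<Rightarrow> nat \<Rightarrow> 'g \<Rightarrow> nat" where
  "red_homology_dim G i \<alpha> = kdim (red_cycles G i \<alpha>) - kdim (red_boundaries G i \<alpha>)"

text \<open>
  The dimension of the degree \<open>\<alpha>\<close> part of \<open>Tor\<^sub>i(I, k)\<close>, computed from some graded free
  resolution of \<open>I\<close>. Since \<open>Tor\<close> does not depend on the resolution, the choice is
  immaterial; resolutions by free modules of finite rank exist because \<open>polys V\<close> is Noetherian
  for finite \<open>V\<close>.
\<close>

definition graded_betti ::
  "'v set \<Rightarrow> ('v mono \<Rightarrow> 'g::comm_monoid_add) \<Rightarrow> ('v, 'k::field) mpoly set \<Rightarrow> nat \<Rightarrow> 'g \<Rightarrow> nat" where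
  "graded_betti V w I i \<alpha> =
     red_homology_dim
       (SOME G :: (nat, 'g, 'v, 'k) free_complex. \<exists>\<epsilon>. resolves_ideal V w I G \<epsilon>) i \<alpha>"

definition fine_betti :: "'v set \<Rightarrow> ('v, 'k::field) mpoly set \<Rightarrow> nat \<Rightarrow> 'v mono \<Rightarrow> nat" where
  "fine_betti V = graded_betti V id"

definition Z_betti :: "'v set \<Rightarrow> ('v, 'k::field) mpoly set \<Rightarrow> nat \<Rightarrow> nat \<Rightarrow> nat" where
  "Z_betti V = graded_betti V mono_deg"


section \<open>Labelled cell complexes and cellular resolutions\<close>

text \<open>
  The combinatorial data of a polyhedral complex: each face is given by its set of vertices, so
  that the face relation is inclusion. The empty face \<open>{}\<close>, of dimension \<open>-1\<close>, is included.
\<close>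

record 'p cell_complex =
  cells :: "'p set set"
  cell_dim :: "'p set \<Rightarrow> int"

definition vertices :: "'p cell_complex \<Rightarrow> 'p set" where
  "vertices X = \<Union> (cells X)"

text \<open>
  The incidence functions of a polyhedral complex are exactly the systems of incidence signs
  that come from an orientation of its cells. (Two faces whose dimensions differ by \<open>2\<close> have
  exactly two faces strictly between them, whose contributions to the sum must cancel.)
\<close>

definition incidence_function :: "'p cell_complex \<Rightarrow> ('p set \<Rightarrow> 'p set \<Rightarrow> int) \<Rightarrow> bool" where
  "incidence_function X sg \<longleftrightarrow>
     (\<forall>P\<in>cells X. \<forall>Q\<in>cells X. Q \<subset> P \<and> cell_dim X P = cell_dim X Q + 1 \<longrightarrow> sg P Q \<in> {1, -1}) \<and>
     (\<forall>P\<in>cells X. cell_dim X P = 0 \<longrightarrow> sg P {} = 1) \<and>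
     (\<forall>P\<in>cells X. \<forall>R\<in>cells X. R \<subset> P \<and> cell_dim X P = cell_dim X R + 2 \<longrightarrow>
        (\<Sum>Q\<in>{Q \<in> cells X. R \<subset> Q \<and> Q \<subset> P}. sg P Q * sg Q R) = 0)"

text \<open>The least common multiple of the labels of the (finitely many) vertices of a face.\<close>

definition face_label :: "('p \<Rightarrow> 'v mono) \<Rightarrow> 'p set \<Rightarrow> 'v mono" where
  "face_label l P =
     Abs_poly_mapping (\<lambda>v. Max (insert 0 ((\<lambda>p. Poly_Mapping.lookup (l p) v) ` P)))"

text \<open>
  Homological degree \<open>i\<close> is spanned by the faces of dimension \<open>i - 1\<close>. The difference of
  exponent vectors is the quotient of the monomials.
\<close>

definition cellular_complex ::
  "'p cell_complex \<Rightarrow> ('p \<Rightarrow> 'v mono) \<Rightarrow> ('p set \<Rightarrow> 'p set \<Rightarrow> int) \<Rightarrow>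
   ('p set, 'v mono, 'v, 'k::field) free_complex" where
  "cellular_complex X l sg =
     \<lparr>cx_basis = (\<lambda>i. {P \<in> cells X. cell_dim X P = int i - 1}),
      cx_deg = (\<lambda>i P. if P \<in> cells X then face_label l P else 0),
      cx_diff = (\<lambda>i P Q. if P \<in> cells X \<and> Q \<in> cells X \<and> Q \<subset> P
        then Poly_Mapping.single (face_label l P - face_label l Q) (of_int (sg P Q)) else 0)\<rparr>"

text \<open>
  The requirement is imposed for all orientations; the first conjunct keeps it from being vacuous.
\<close>

definition minimal_linear_cellular_resolution ::
  "'v set \<Rightarrow> nat \<Rightarrow> 'p cell_complex \<Rightarrow> ('p \<Rightarrow> 'v mono) \<Rightarrow> ('v, 'k::field) mpoly set \<Rightarrow> bool" where
  "minimal_linear_cellular_resolution V d X l I \<longleftrightarrow>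
     (\<exists>sg. incidence_function X sg) \<and>
     (\<forall>sg. incidence_function X sg \<longrightarrow>
        (let C = (cellular_complex X l sg :: ('p set, 'v mono, 'v, 'k) free_complex)
         in resolves_quotient V I C \<and> minimal_complex C \<and> linear_complex d C))"

definition cellular_isomorphism ::
  "'p cell_complex \<Rightarrow> 'q cell_complex \<Rightarrow> ('p \<Rightarrow> 'q) \<Rightarrow> bool" where
  "cellular_isomorphism X Y \<phi> \<longleftrightarrow>
     bij_betw \<phi> (vertices X) (vertices Y) \<and>
     bij_betw ((`) \<phi>) (cells X) (cells Y) \<and>
     (\<forall>P\<in>cells X. cell_dim Y (\<phi> ` P) = cell_dim X P)"


section \<open>Partite hypergraphs and their complexes of boxes\<close>

text \<open>
  A \<open>d\<close>-partite \<open>d\<close>-uniform hypergraph is a set of lists of length \<open>d\<close>. Parts are numbered from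
  \<open>0\<close>; the vertex \<open>x\<close> of part \<open>j\<close>, and its variable, is \<open>(j, x)\<close>.
\<close>

definition hyperedge_vertices :: "'a list set \<Rightarrow> (nat \<times> 'a) set" where
  "hyperedge_vertices H = {(j, x ! j) | j x. x \<in> H \<and> j < length x}"

definition edge_monomial :: "'a list \<Rightarrow> (nat \<times> 'a) mono" where
  "edge_monomial x = (\<Sum>j<length x. Poly_Mapping.single (j, x ! j) 1)"

definition boxes :: "nat \<Rightarrow> 'a list set \<Rightarrow> 'a set list set" where
  "boxes d H = {Xs. length Xs = d \<and> (\<forall>X\<in>set Xs. X \<noteq> {}) \<and> listset Xs \<subseteq> H}"

definition box_complex :: "nat \<Rightarrow> 'a list set \<Rightarrow> 'a list cell_complex" where
  "box_complex d H =
     \<lparr>cells = insert {} (listset ` boxes d H),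
      cell_dim = (\<lambda>P. if P = {} then -1 else \<Sum>j<d. int (card ((\<lambda>x. x ! j) ` P)) - 1)\<rparr>"

text \<open>The indicator vector of the disjoint union of the factors of a box.\<close>

definition box_degree :: "'a set list \<Rightarrow> (nat \<times> 'a) mono" where
  "box_degree Xs = (\<Sum>j<length Xs. \<Sum>x\<in>Xs ! j. Poly_Mapping.single (j, x) 1)"

definition ferrers :: "nat \<Rightarrow> (nat \<Rightarrow> 'a set) \<Rightarrow> 'a list set \<Rightarrow> bool" where
  "ferrers d X F \<longleftrightarrow>
     F \<subseteq> listset (map X [0..<d]) \<and>
     (\<exists>R. (\<forall>j<d. linear_order_on (X j) (R j)) \<and>
          (\<forall>x\<in>F. \<forall>y\<in>listset (map X [0..<d]). (\<forall>j<d. (y ! j, x ! j) \<in> R j) \<longrightarrow> y \<in> F))"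


section \<open>Strongly stable collections\<close>

definition dsubsets :: "nat \<Rightarrow> nat set set" where
  "dsubsets d = {A. A \<subseteq> {1..} \<and> finite A \<and> card A = d}"

definition dmultisets :: "nat \<Rightarrow> nat multiset set" where
  "dmultisets d = {A. set_mset A \<subseteq> {1..} \<and> size A = d}"

abbreviation gale_le :: "nat list \<Rightarrow> nat list \<Rightarrow> bool" where
  "gale_le \<equiv> list_all2 (\<le>)"

definition squarefree_strongly_stable :: "nat \<Rightarrow> nat set set \<Rightarrow> bool" where
  "squarefree_strongly_stable d K \<longleftrightarrow>
     K \<subseteq> dsubsets d \<and>
     (\<forall>A\<in>K. \<forall>B\<in>dsubsets d. gale_le (sorted_list_of_set B) (sorted_list_of_set A) \<longrightarrow> B \<in> K)"

definition strongly_stable :: "nat \<Rightarrow> nat multiset set \<Rightarrow> bool" where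
  "strongly_stable d M \<longleftrightarrow>
     M \<subseteq> dmultisets d \<and>
     (\<forall>A\<in>M. \<forall>B\<in>dmultisets d.
        gale_le (sorted_list_of_multiset B) (sorted_list_of_multiset A) \<longrightarrow> B \<in> M)"

definition F_set :: "nat set set \<Rightarrow> nat list set" where
  "F_set K = sorted_list_of_set ` K"

definition F_mset :: "nat multiset set \<Rightarrow> nat list set" where
  "F_mset M = sorted_list_of_multiset ` M"

definition depol :: "nat set \<Rightarrow> nat multiset" where
  "depol A = mset (map2 (-) (sorted_list_of_set A) [0..<card A])"

text \<open>The map induced by \<^const>\<open>depol\<close> on increasing sequences.\<close>

definition depol_vertex :: "nat list \<Rightarrow> nat list" where
  "depol_vertex x = sorted_list_of_multiset (depol (set x))"

definition set_monomial :: "nat set \<Rightarrow> nat mono" where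
  "set_monomial A = (\<Sum>i\<in>A. Poly_Mapping.single i 1)"

definition mset_monomial :: "nat multiset \<Rightarrow> nat mono" where
  "mset_monomial A = (\<Sum>i\<in>#A. Poly_Mapping.single i 1)"


section \<open>Specialization\<close>

text \<open>The label \<open>x\<^sub>i\<^sub>1 \<cdots> x\<^sub>i\<^sub>d\<close> of the vertex \<open>(i\<^sub>1, \<dots>, i\<^sub>d)\<close> after re-labelling.\<close>

definition sp_edge_monomial :: "nat list \<Rightarrow> nat mono" where
  "sp_edge_monomial x = (\<Sum>j<length x. Poly_Mapping.single (x ! j) 1)"

text \<open>
  The algebra homomorphism sending each variable \<open>(j, i)\<close> to the variable \<open>i\<close>, first on monomials,
  then on polynomials, then entrywise on complexes.
\<close>

definition sp_mono :: "(nat \<times> nat) mono \<Rightarrow> nat mono" where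
  "sp_mono m =
     (\<Sum>v\<in>Poly_Mapping.keys m. Poly_Mapping.single (snd v) (Poly_Mapping.lookup m v))"

definition sp :: "(nat \<times> nat, 'k::field) mpoly \<Rightarrow> (nat, 'k) mpoly" where
  "sp p =
     (\<Sum>m\<in>Poly_Mapping.keys p. Poly_Mapping.single (sp_mono m) (Poly_Mapping.lookup p m))"

definition sp_complex ::
  "('b, (nat \<times> nat) mono, nat \<times> nat, 'k::field) free_complex \<Rightarrow> ('b, nat mono, nat, 'k) free_complex"
  where
  "sp_complex C =
     \<lparr>cx_basis = cx_basis C,
      cx_deg = (\<lambda>i b. sp_mono (cx_deg C i b)),
      cx_diff = (\<lambda>i b c. sp (cx_diff C i b c))\<rparr>"

end

theory Submission
  imports Defs
begin

text \<open>
  Split into multidegrees, the cellular complex of a labelled complex of boxes becomes a family of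
  chain complexes over the ground field: the part of degree \<open>\<alpha>\<close> is spanned by the faces whose label
  divides \<open>\<alpha>\<close> (\<open>degree_part_cx_map\<close>). A label is a least common multiple, so these faces are the
  boxes inside the subhypergraph \<open>H\<^sub>\<alpha>\<close> of the edges whose own label divides \<open>\<alpha>\<close>. Hence the complex
  is a resolution as soon as the complex of boxes inside each nonempty \<open>H\<^sub>\<alpha>\<close> is acyclic.

  Acyclicity follows from a cone point (\<open>box_complex_acyclic\<close>). This is an edge \<open>a\<close> such that every
  edge that agrees with \<open>a\<close> in the coordinates before \<open>j\<close> remains an edge when its coordinate \<open>j\<close> is
  replaced by \<open>a\<^sub>j\<close>. A cycle is moved, one coordinate at a time, to a homologous cycle of boxes whose
  first factors are \<open>{a\<^sub>0}, {a\<^sub>1}, \<dots>\<close>. At coordinate \<open>t\<close>, the boxes whose factor \<open>t\<close> misses \<open>a\<^sub>t\<close> are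
  cancelled by the boundary of the boxes obtained by adding \<open>a\<^sub>t\<close>. A remaining box whose factor \<open>t\<close>
  contains \<open>a\<^sub>t\<close> and something else would leave an uncancelled face, the one without \<open>a\<^sub>t\<close>. After
  all coordinates only the vertex \<open>a\<close> is left, and it is not a cycle of the augmented complex. The
  argument relies only on the incidence signs being units and on the boundary having square zero, so
  it is valid for every orientation.

  A cone point of \<open>H\<^sub>\<alpha>\<close> is found greedily, as a lexicographically least edge
  (\<open>exchange_closed_cone_point\<close>), if \<open>H\<^sub>\<alpha>\<close> has an exchange property: when \<open>x\<close> and \<open>y\<close> agree before
  \<open>j\<close> and \<open>y\<^sub>j \<le> x\<^sub>j\<close>, replacing \<open>x\<^sub>j\<close> by \<open>y\<^sub>j\<close> gives an edge. Order ideals, also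
  those among the increasing sequences, have this property. For the
  labels with a separate variable for each coordinate it passes to \<open>H\<^sub>\<alpha>\<close> because divisibility can be
  tested in each coordinate. For the specialized labels it passes to \<open>H\<^sub>\<alpha>\<close> because edges are sorted:
  if \<open>y\<^sub>j < x\<^sub>j\<close>, the value \<open>y\<^sub>j\<close> does not occur in \<open>x\<close> after \<open>j\<close>, so its new multiplicity is bounded
  by its multiplicity in \<open>y\<close>.

  The coordinates of a vertex of a box can be chosen independently. For both labellings the label
  of \<open>X\<^sub>1 \<times> \<dots> \<times> X\<^sub>d\<close> is therefore the product of the variables of all elements of all \<open>X\<^sub>j\<close>, with
  repetitions (\<open>face_label_product_box\<close>). Its degree exceeds the dimension of the box by \<open>d\<close>, which
  makes the resolution linear and minimal.

  Betti numbers are defined by means of an unspecified resolution. It is compared with the cellular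
  one by chain maps that lift the identity and are inverse up to homotopy (\<open>chain_map_lift\<close>,
  \<open>chain_map_null_homotopic\<close>). Modulo the variables the differential of the minimal resolution
  vanishes, so the Betti numbers count its basis elements (\<open>graded_betti_minimal\<close>). Those in part (iii)
  agree since depolarization subtracts a constant in each coordinate and hence maps boxes to boxes
  (\<open>coordinatewise_isomorphism\<close>).
\<close>

section \<open>Polynomials and their homogeneous parts\<close>

abbreviation keys :: "('a \<Rightarrow>\<^sub>0 'b::zero) \<Rightarrow> 'a set" where "keys \<equiv> Poly_Mapping.keys"
abbreviation lookup :: "('a \<Rightarrow>\<^sub>0 'b::zero) \<Rightarrow> 'a \<Rightarrow> 'b" where "lookup \<equiv> Poly_Mapping.lookup"
abbreviation single :: "'a \<Rightarrow> 'b::zero \<Rightarrow> 'a \<Rightarrow>\<^sub>0 'b" where "single \<equiv> Poly_Mapping.single"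

lemma zero_in_polys [simp]: "0 \<in> polys V"
  by (simp add: polys_def)

lemma one_in_polys [simp]: "1 \<in> polys V"
  by (simp add: polys_def)

lemma single_in_polys: "keys m \<subseteq> V \<Longrightarrow> single m c \<in> polys V"
  by (simp add: polys_def)

lemma add_in_polys: "p \<in> polys V \<Longrightarrow> q \<in> polys V \<Longrightarrow> p + q \<in> polys V"
  using keys_add[of p q] by (fastforce simp: polys_def)

lemma uminus_in_polys: "p \<in> polys V \<Longrightarrow> - p \<in> polys V"
  by (simp add: polys_def in_keys_iff)

lemma diff_in_polys: "p \<in> polys V \<Longrightarrow> q \<in> polys V \<Longrightarrow> p - q \<in> polys V"
  using add_in_polys[of p V "- q"] uminus_in_polys[of q V] by simp

lemma keys_plus_nat: "keys (m + n) = keys m \<union> keys (n :: 'v mono)"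
  by (auto simp: in_keys_iff lookup_add)

lemma mult_in_polys: "p \<in> polys V \<Longrightarrow> q \<in> polys V \<Longrightarrow> p * q \<in> polys V"
  using keys_mult[of p q] unfolding polys_def by (fastforce simp: keys_plus_nat)

lemma sum_in_polys: "(\<And>a. a \<in> A \<Longrightarrow> f a \<in> polys V) \<Longrightarrow> sum f A \<in> polys V"
  by (induction A rule: infinite_finite_induct) (auto intro: add_in_polys)

lemma ring_poly_ring: "ring (poly_ring V :: ('v, 'k::field) mpoly ring)"
proof (rule ringI)
  show "abelian_group (poly_ring V :: ('v, 'k) mpoly ring)"
    by (rule abelian_groupI)
      (auto simp: poly_ring_def add_in_polys algebra_simps intro: bexI[where x = "- x" for x] uminus_in_polys)
  show "monoid (poly_ring V :: ('v, 'k) mpoly ring)"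
    by unfold_locales (auto simp: poly_ring_def mult_in_polys algebra_simps)
qed (auto simp: poly_ring_def algebra_simps)

lemma sum_single_lookup: "(\<Sum>m\<in>keys p. single m (lookup p m)) = p"
  by (rule poly_mapping_eqI)
    (simp add: lookup_sum lookup_single when_def in_keys_iff)

lemma lookup_mult_single:
  fixes p :: "('v, 'k::field) mpoly"
  shows "lookup (p * single m s) u = (\<Sum>n\<in>keys p. if n + m = u then lookup p n * s else 0)"
proof -
  have "p * single m s = (\<Sum>n\<in>keys p. single n (lookup p n)) * single m s"
    by (simp add: sum_single_lookup)
  also have "\<dots> = (\<Sum>n\<in>keys p. single (n + m) (lookup p n * s))"
    by (simp add: sum_distrib_right mult_single)
  finally show ?thesis
    by (simp add: lookup_sum lookup_single when_def)
qed

lemma lookup_mult_single_add: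
  fixes p :: "('v, 'k::field) mpoly"
  shows "lookup (p * single m s) (u + m) = lookup p u * s"
  by (simp add: lookup_mult_single in_keys_iff)

lemma lookup_mult_single_none:
  fixes p :: "('v, 'k::field) mpoly"
  assumes "\<And>n. n + m \<noteq> u"
  shows "lookup (p * single m s) u = 0"
  using assms by (simp add: lookup_mult_single)

lemma plus_eq_0_mono: "m + n = 0 \<longleftrightarrow> m = 0 \<and> n = (0 :: 'v mono)"
  by (auto simp: poly_mapping_eq_iff fun_eq_iff lookup_add)

text \<open>
  Taking constant coefficients is the ring homomorphism onto the ground field that turns a free
  resolution into the complex computing \<open>Tor\<close>.
\<close>

lemma lookup_mult_0:
  fixes p q :: "('v, 'k::field) mpoly"
  shows "lookup (p * q) 0 = lookup p 0 * lookup q 0"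
proof -
  have "lookup (\<Sum>m\<in>keys q. p * single m (lookup q m)) 0 = (\<Sum>m\<in>keys q. if m = 0 then lookup p 0 * lookup q 0 else 0)"
    unfolding lookup_sum
  proof (rule sum.cong[OF refl])
    fix m
    show "lookup (p * single m (lookup q m)) 0 = (if m = 0 then lookup p 0 * lookup q 0 else 0)"
      using lookup_mult_single_add[of p 0 "lookup q 0" 0] lookup_mult_single_none[of m 0 p]
      by (auto simp: plus_eq_0_mono)
  qed
  also have "(\<Sum>m\<in>keys q. p * single m (lookup q m)) = p * q"
    by (simp add: sum_single_lookup flip: sum_distrib_left)
  finally show ?thesis
    by (simp add: in_keys_iff)
qed

text \<open>
  Depending on the predicate, a homogeneous component for one of the gradings. Exactness provides
  preimages without any control on degrees; passing to components makes them homogeneous.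
\<close>

definition terms_where :: "('v mono \<Rightarrow> bool) \<Rightarrow> ('v, 'k::field) mpoly \<Rightarrow> ('v, 'k) mpoly" where
  "terms_where P p = (\<Sum>m\<in>{m \<in> keys p. P m}. single m (lookup p m))"

lemma lookup_terms_where: "lookup (terms_where P p) m = (if P m then lookup p m else 0)"
  by (simp add: terms_where_def lookup_sum lookup_single when_def in_keys_iff)

lemma keys_terms_where: "keys (terms_where P p) = {m \<in> keys p. P m}"
  by (auto simp: in_keys_iff lookup_terms_where split: if_splits)

lemma terms_where_in_polys: "p \<in> polys V \<Longrightarrow> terms_where P p \<in> polys V"
  by (auto simp: polys_def keys_terms_where)

lemma terms_where_add: "terms_where P (p + q) = terms_where P p + terms_where P q"
  by (rule poly_mapping_eqI) (simp add: lookup_terms_where lookup_add)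

lemma terms_where_sum: "terms_where P (sum f A) = (\<Sum>a\<in>A. terms_where P (f a))"
  by (rule poly_mapping_eqI) (simp add: lookup_terms_where lookup_sum)

lemma terms_where_id: "(\<And>m. m \<in> keys p \<Longrightarrow> P m) \<Longrightarrow> terms_where P p = p"
  by (rule poly_mapping_eqI) (auto simp: lookup_terms_where in_keys_iff)

lemma terms_where_none: "(\<And>m. m \<in> keys p \<Longrightarrow> \<not> P m) \<Longrightarrow> terms_where P p = 0"
  by (rule poly_mapping_eqI) (auto simp: lookup_terms_where in_keys_iff)

text \<open>
  If all terms of \<open>q\<close> are homogeneous of the same degree, taking a component of \<open>p * q\<close> amounts to taking
  a component of \<open>p\<close>; the hypothesis expresses this without dividing degrees.
\<close>

lemma terms_where_mult:
  fixes p q :: "('v, 'k::field) mpoly"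
  assumes "\<And>m n. n \<in> keys q \<Longrightarrow> P (m + n) \<longleftrightarrow> Q m"
  shows "terms_where P (p * q) = terms_where Q p * q"
proof -
  have "p = terms_where Q p + terms_where (\<lambda>m. \<not> Q m) p"
    by (rule poly_mapping_eqI) (simp add: lookup_terms_where lookup_add)
  then have "p * q = terms_where Q p * q + terms_where (\<lambda>m. \<not> Q m) p * q"
    by (metis distrib_right)
  moreover have "terms_where P (terms_where Q p * q) = terms_where Q p * q"
    using keys_mult[of "terms_where Q p" q] assms by (intro terms_where_id) (fastforce simp: keys_terms_where)
  moreover have "terms_where P (terms_where (\<lambda>m. \<not> Q m) p * q) = 0"
    using keys_mult[of "terms_where (\<lambda>m. \<not> Q m) p" q] assms by (intro terms_where_none) (fastforce simp: keys_terms_where)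
  ultimately show ?thesis
    by (simp add: terms_where_add)
qed

section \<open>Chain maps between graded free resolutions\<close>

definition additive_degree :: "('v mono \<Rightarrow> 'g::comm_monoid_add) \<Rightarrow> bool" where
  "additive_degree w \<longleftrightarrow> w 0 = 0 \<and> (\<forall>m n. w (m + n) = w m + w n)"

text \<open>
  Resolutions of \<open>S/I\<close> for an arbitrary grading. Working with \<open>S/I\<close> rather than with \<open>I\<close> puts the
  augmentation on the same footing as the other differentials, so that liftings and homotopies need no
  separate treatment at the end of the complex.
\<close>

definition graded_resolution ::
  "'v set \<Rightarrow> ('v mono \<Rightarrow> 'g::comm_monoid_add) \<Rightarrow> ('v, 'k::field) mpoly set \<Rightarrow>
   ('b, 'g, 'v, 'k) free_complex \<Rightarrow> bool" where
  "graded_resolution V w I C \<longleftrightarrow>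
     graded_complex V w C \<and>
     (\<exists>z. cx_basis C 0 = {z} \<and> cx_deg C 0 z = 0 \<and>
          (\<lambda>f. cx_map C 0 f z) ` cx_module V C 1 = I) \<and>
     (\<forall>i\<ge>1. exact_at V C i)"

lemma resolves_quotient_iff: "resolves_quotient V I C \<longleftrightarrow> graded_resolution V id I C"
  by (simp add: resolves_quotient_def graded_resolution_def)

text \<open>
  Evaluation at \<open>f\<close> of the linear map that sends the basis element \<open>b\<close> to the row \<open>A b\<close>.
\<close>

definition lincomb ::
  "'b set \<Rightarrow> ('b \<Rightarrow> 'c \<Rightarrow> ('v, 'k::field) mpoly) \<Rightarrow> ('b \<Rightarrow> ('v, 'k) mpoly) \<Rightarrow> 'c \<Rightarrow> ('v, 'k) mpoly" where
  "lincomb B A f = (\<lambda>c. \<Sum>b\<in>B. f b * A b c)"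

definition cx_row ::
  "('b, 'g, 'v, 'k::field) free_complex \<Rightarrow> nat \<Rightarrow> 'b \<Rightarrow> 'b \<Rightarrow> ('v, 'k) mpoly" where
  "cx_row C i b = (\<lambda>c. if c \<in> cx_basis C i then cx_diff C i b c else 0)"

definition homogeneous ::
  "('v mono \<Rightarrow> 'g::comm_monoid_add) \<Rightarrow> ('b, 'g, 'v, 'k::field) free_complex \<Rightarrow> nat \<Rightarrow> 'g \<Rightarrow>
   ('b \<Rightarrow> ('v, 'k) mpoly) \<Rightarrow> bool" where
  "homogeneous w C i \<alpha> f \<longleftrightarrow> (\<forall>c. \<forall>m\<in>keys (f c). w m + cx_deg C i c = \<alpha>)"

definition component ::
  "('v mono \<Rightarrow> 'g::comm_monoid_add) \<Rightarrow> ('b, 'g, 'v, 'k::field) free_complex \<Rightarrow> nat \<Rightarrow> 'g \<Rightarrow>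
   ('b \<Rightarrow> ('v, 'k) mpoly) \<Rightarrow> 'b \<Rightarrow> ('v, 'k) mpoly" where
  "component w C i \<alpha> f = (\<lambda>c. terms_where (\<lambda>m. w m + cx_deg C i c = \<alpha>) (f c))"

lemma cx_map_lincomb: "cx_map C i f = lincomb (cx_basis C (Suc i)) (cx_row C i) f"
  by (auto simp: cx_map_def lincomb_def cx_row_def fun_eq_iff)

lemma lincomb_lincomb:
  "lincomb B A (lincomb B' A' f) = lincomb B' (\<lambda>b. lincomb B A (A' b)) f"
  by (auto simp: lincomb_def fun_eq_iff sum_distrib_left sum_distrib_right mult.assoc intro: sum.swap)

lemma cx_map_of_lincomb: "cx_map C i (lincomb B A f) = lincomb B (\<lambda>b. cx_map C i (A b)) f"
  by (simp add: cx_map_lincomb lincomb_lincomb)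

lemma lincomb_cong: "(\<And>b. b \<in> B \<Longrightarrow> A b = A' b) \<Longrightarrow> lincomb B A f = lincomb B A' f"
  by (auto simp: lincomb_def fun_eq_iff intro!: sum.cong)

lemma lincomb_diff: "lincomb B A (f - g) = lincomb B A f - lincomb B A g"
  by (simp add: lincomb_def fun_eq_iff left_diff_distrib sum_subtractf)

lemma lincomb_diff_rows: "lincomb B (\<lambda>b. A b - A' b) f = lincomb B A f - lincomb B A' f"
  by (simp add: lincomb_def fun_eq_iff right_diff_distrib sum_subtractf)

lemma lincomb_zero [simp]: "lincomb B A 0 = 0"
  by (simp add: lincomb_def fun_eq_iff)

lemma lincomb_zero_rows: "(\<And>b. b \<in> B \<Longrightarrow> A b = 0) \<Longrightarrow> lincomb B A f = 0"
  by (auto simp: lincomb_def fun_eq_iff)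

lemma cx_map_diff: "cx_map C i (f - g) = cx_map C i f - cx_map C i g"
  by (simp add: cx_map_lincomb lincomb_diff)

lemma zero_in_cx_module [simp]: "0 \<in> cx_module V C i"
  by (simp add: cx_module_def)

lemma diff_in_cx_module:
  "f \<in> cx_module V C i \<Longrightarrow> g \<in> cx_module V C i \<Longrightarrow> f - g \<in> cx_module V C i"
  by (simp add: cx_module_def diff_in_polys)

lemma lincomb_in_cx_module:
  assumes "\<And>b. b \<in> B \<Longrightarrow> A b \<in> cx_module V C i" "\<And>b. b \<in> B \<Longrightarrow> f b \<in> polys V"
  shows "lincomb B A f \<in> cx_module V C i"
  using assms by (auto simp: cx_module_def lincomb_def intro!: sum_in_polys mult_in_polys sum.neutral)

lemma cx_module_polys: "f \<in> cx_module V C i \<Longrightarrow> f b \<in> polys V"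
  by (simp add: cx_module_def)

lemma cx_row_in_cx_module:
  assumes "graded_complex V w C" "b \<in> cx_basis C (Suc i)"
  shows "cx_row C i b \<in> cx_module V C i"
  using assms by (auto simp: graded_complex_def cx_module_def cx_row_def)

lemma cx_map_in_cx_module:
  assumes "graded_complex V w C" "f \<in> cx_module V C (Suc i)"
  shows "cx_map C i f \<in> cx_module V C i"
  using assms cx_row_in_cx_module unfolding cx_map_lincomb
  by (intro lincomb_in_cx_module) (auto simp: cx_module_polys)

lemma homogeneous_row:
  assumes "graded_complex V w C" "b \<in> cx_basis C (Suc i)"
  shows "homogeneous w C i (cx_deg C (Suc i) b) (cx_row C i b)"
  using assms by (auto simp: graded_complex_def homogeneous_def cx_row_def)

lemma component_in_cx_module: "f \<in> cx_module V C i \<Longrightarrow> component w C i \<alpha> f \<in> cx_module V C i"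
  by (auto simp: cx_module_def component_def terms_where_in_polys) (simp add: terms_where_def)

lemma homogeneous_component: "homogeneous w C i \<alpha> (component w C i \<alpha> f)"
  by (simp add: homogeneous_def component_def keys_terms_where)

lemma component_homogeneous: "homogeneous w C i \<alpha> f \<Longrightarrow> component w C i \<alpha> f = f"
  by (auto simp: homogeneous_def component_def fun_eq_iff intro!: terms_where_id)

lemma cx_map_component:
  assumes C: "graded_complex V w C" and w: "additive_degree w"
  shows "cx_map C i (component w C (Suc i) \<alpha> f) = component w C i \<alpha> (cx_map C i f)"
proof
  fix c
  show "cx_map C i (component w C (Suc i) \<alpha> f) c = component w C i \<alpha> (cx_map C i f) c"
  proof (cases "c \<in> cx_basis C i")
    case True
    have "terms_where (\<lambda>m. w m + cx_deg C i c = \<alpha>) (f b * cx_diff C i b c)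
        = terms_where (\<lambda>m. w m + cx_deg C (Suc i) b = \<alpha>) (f b) * cx_diff C i b c"
      if "b \<in> cx_basis C (Suc i)" for b
    proof (rule terms_where_mult)
      fix m n assume "n \<in> keys (cx_diff C i b c)"
      then have "w n + cx_deg C i c = cx_deg C (Suc i) b"
        using C that True by (auto simp: graded_complex_def)
      then show "w (m + n) + cx_deg C i c = \<alpha> \<longleftrightarrow> w m + cx_deg C (Suc i) b = \<alpha>"
        using w by (simp add: additive_degree_def add.assoc)
    qed
    then show ?thesis
      using True by (simp add: cx_map_def component_def terms_where_sum)
  next
    case False
    then show ?thesis
      by (simp add: cx_map_def component_def terms_where_def)
  qed
qed

lemma homogeneous_preimage:
  assumes "graded_complex V w C" "additive_degree w"
    and "f \<in> cx_module V C (Suc i)" "homogeneous w C i \<alpha> (cx_map C i f)"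
  obtains g where "g \<in> cx_module V C (Suc i)" "homogeneous w C (Suc i) \<alpha> g" "cx_map C i g = cx_map C i f"
proof
  show "component w C (Suc i) \<alpha> f \<in> cx_module V C (Suc i)"
    using assms component_in_cx_module by blast
  show "homogeneous w C (Suc i) \<alpha> (component w C (Suc i) \<alpha> f)"
    by (rule homogeneous_component)
  show "cx_map C i (component w C (Suc i) \<alpha> f) = cx_map C i f"
    using assms by (simp add: cx_map_component component_homogeneous)
qed

lemma homogeneous_lincomb:
  assumes w: "additive_degree w" and f: "\<And>b m. b \<in> B \<Longrightarrow> m \<in> keys (f b) \<Longrightarrow> w m + \<delta> b = \<alpha>"
    and A: "\<And>b. b \<in> B \<Longrightarrow> homogeneous w C i (\<delta> b) (A b)"
  shows "homogeneous w C i \<alpha> (lincomb B A f)"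
  unfolding homogeneous_def
proof (intro allI ballI)
  fix c m assume "m \<in> keys (lincomb B A f c)"
  then obtain b where b: "b \<in> B" "m \<in> keys (f b * A b c)"
    unfolding lincomb_def in_keys_iff lookup_sum by (metis (no_types, lifting) sum.neutral)
  then obtain m1 m2 where m: "m = m1 + m2" "m1 \<in> keys (f b)" "m2 \<in> keys (A b c)"
    using keys_mult[of "f b" "A b c"] by blast
  then have "w m2 + cx_deg C i c = \<delta> b" "w m1 + \<delta> b = \<alpha>"
    using A[OF b(1)] f[OF b(1)] by (auto simp: homogeneous_def)
  then show "w m + cx_deg C i c = \<alpha>"
    using w m(1) by (simp add: additive_degree_def add.assoc)
qed

lemma homogeneous_diff:
  "homogeneous w C i \<alpha> f \<Longrightarrow> homogeneous w C i \<alpha> g \<Longrightarrow> homogeneous w C i \<alpha> (f - g)"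
  using keys_diff unfolding homogeneous_def by (metis (no_types, opaque_lifting) in_keys_iff lookup_minus minus_apply diff_zero)

lemma exact_at_Suc:
  "exact_at V C (Suc i) \<longleftrightarrow>
     {f \<in> cx_module V C (Suc i). cx_map C i f = 0} = cx_map C (Suc i) ` cx_module V C (Suc (Suc i))"
  by (simp add: exact_at_def zero_fun_def)

lemma cx_map_cx_map:
  assumes "exact_at V C (Suc i)" "f \<in> cx_module V C (Suc (Suc i))"
  shows "cx_map C i (cx_map C (Suc i) f) = 0"
  using assms unfolding exact_at_Suc by blast

lemma cx_map_unit:
  assumes "graded_complex V w C" "b \<in> cx_basis C (Suc i)"
  shows "(\<lambda>b'. if b' = b then 1 else 0) \<in> cx_module V C (Suc i)"
    and "cx_map C i (\<lambda>b'. if b' = b then 1 else 0) = cx_row C i b"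
proof -
  show "(\<lambda>b'. if b' = b then 1 else 0) \<in> cx_module V C (Suc i)"
    using assms by (auto simp: cx_module_def)
  have "finite (cx_basis C (Suc i))"
    using assms by (simp add: graded_complex_def)
  then show "cx_map C i (\<lambda>b'. if b' = b then 1 else 0) = cx_row C i b"
    using assms by (simp add: cx_map_lincomb lincomb_def if_distrib[of "\<lambda>x. x * _"] cong: if_cong)
qed

lemma cx_map_row:
  assumes "graded_complex V w C" "exact_at V C (Suc i)" "b \<in> cx_basis C (Suc (Suc i))"
  shows "cx_map C i (cx_row C (Suc i) b) = 0"
  using cx_map_cx_map[OF assms(2) cx_map_unit(1)[OF assms(1,3)]] cx_map_unit(2)[OF assms(1,3)] by simp

text \<open>
  Preimages of homogeneous cycles can be taken homogeneous, because the differential commutes with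
  taking components.
\<close>

lemma homogeneous_exact:
  assumes "graded_complex V w C" "additive_degree w" "exact_at V C (Suc i)"
    and "f \<in> cx_module V C (Suc i)" "cx_map C i f = 0" "homogeneous w C (Suc i) \<alpha> f"
  obtains g where "g \<in> cx_module V C (Suc (Suc i))" "homogeneous w C (Suc (Suc i)) \<alpha> g" "cx_map C (Suc i) g = f"
proof -
  have "f \<in> cx_map C (Suc i) ` cx_module V C (Suc (Suc i))"
    using assms(3-5) unfolding exact_at_Suc by blast
  then obtain g where "g \<in> cx_module V C (Suc (Suc i))" "cx_map C (Suc i) g = f"
    by blast
  then show ?thesis
    using homogeneous_preimage[OF assms(1,2), of g "Suc i" \<alpha>] assms(6) that by auto
qed

text \<open>
  The rows of a matrix of degree \<open>0\<close> from position \<open>i\<close> of \<open>C\<close> to position \<open>j\<close> of \<open>D\<close>. Chain maps have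
  \<open>j = i\<close>, homotopies have \<open>j = i + 1\<close>.
\<close>

definition degree_rows ::
  "'v set \<Rightarrow> ('v mono \<Rightarrow> 'g::comm_monoid_add) \<Rightarrow> ('b, 'g, 'v, 'k::field) free_complex \<Rightarrow>
   ('c, 'g, 'v, 'k) free_complex \<Rightarrow> nat \<Rightarrow> nat \<Rightarrow> ('b \<Rightarrow> 'c \<Rightarrow> ('v, 'k) mpoly) \<Rightarrow> bool" where
  "degree_rows V w C D i j A \<longleftrightarrow>
     (\<forall>b\<in>cx_basis C i. A b \<in> cx_module V D j \<and> homogeneous w D j (cx_deg C i b) (A b))"

definition chain_map ::
  "'v set \<Rightarrow> ('v mono \<Rightarrow> 'g::comm_monoid_add) \<Rightarrow> ('b, 'g, 'v, 'k::field) free_complex \<Rightarrow>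
   ('c, 'g, 'v, 'k) free_complex \<Rightarrow> (nat \<Rightarrow> 'b \<Rightarrow> 'c \<Rightarrow> ('v, 'k) mpoly) \<Rightarrow> bool" where
  "chain_map V w C D \<phi> \<longleftrightarrow>
     (\<forall>i. degree_rows V w C D i i (\<phi> i)) \<and>
     (\<forall>i. \<forall>b\<in>cx_basis C (Suc i).
        cx_map D i (\<phi> (Suc i) b) = lincomb (cx_basis C i) (\<phi> i) (cx_row C i b))"

lemma degree_rows_lincomb:
  assumes w: "additive_degree w" and A: "degree_rows V w C D i j A"
    and f: "f \<in> cx_module V C i" "homogeneous w C i \<alpha> f"
  shows "lincomb (cx_basis C i) A f \<in> cx_module V D j"
    and "homogeneous w D j \<alpha> (lincomb (cx_basis C i) A f)"
proof -
  show "lincomb (cx_basis C i) A f \<in> cx_module V D j"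
    using A f by (intro lincomb_in_cx_module) (auto simp: degree_rows_def cx_module_polys)
  show "homogeneous w D j \<alpha> (lincomb (cx_basis C i) A f)"
    using A f by (intro homogeneous_lincomb[OF w, where \<delta> = "cx_deg C i"])
      (auto simp: degree_rows_def homogeneous_def)
qed

lemma choose_degree_rows:
  assumes "\<And>b. b \<in> cx_basis C i \<Longrightarrow>
      \<exists>g. g \<in> cx_module V D j \<and> homogeneous w D j (cx_deg C i b) g \<and> Q b g"
  shows "\<exists>A. degree_rows V w C D i j A \<and> (\<forall>b\<in>cx_basis C i. Q b (A b))"
  using bchoice[of "cx_basis C i"
      "\<lambda>b g. g \<in> cx_module V D j \<and> homogeneous w D j (cx_deg C i b) g \<and> Q b g"] assms
  unfolding degree_rows_def by blast

text \<open>
  The comparison theorem. A lift in position \<open>i + 1\<close> exists if the images of the rows of the differential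
  of \<open>C\<close> under the map in position \<open>i\<close> are boundaries of \<open>D\<close>. In position \<open>0\<close> this holds because both
  complexes have the ideal \<open>I\<close> as image; later the images are cycles, and \<open>D\<close> is exact.
\<close>

lemma chain_map_lift:
  fixes C :: "('b, 'g::comm_monoid_add, 'v, 'k::field) free_complex"
    and D :: "('c, 'g, 'v, 'k) free_complex"
  assumes w: "additive_degree w" and C: "graded_resolution V w I C" and D: "graded_resolution V w I D"
  obtains \<phi> where "chain_map V w C D \<phi>"
    and "\<forall>b\<in>cx_basis C 0. \<forall>c\<in>cx_basis D 0. \<phi> 0 b c = 1"
proof -
  have gC: "graded_complex V w C" and eC: "\<And>i. exact_at V C (Suc i)"
    and gD: "graded_complex V w D" and eD: "\<And>i. exact_at V D (Suc i)"
    using C D by (auto simp: graded_resolution_def)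
  obtain z where z: "cx_basis C 0 = {z}" "cx_deg C 0 z = 0" "(\<lambda>f. cx_map C 0 f z) ` cx_module V C 1 = I"
    using C by (auto simp: graded_resolution_def)
  obtain y where y: "cx_basis D 0 = {y}" "cx_deg D 0 y = 0" "(\<lambda>f. cx_map D 0 f y) ` cx_module V D 1 = I"
    using D by (auto simp: graded_resolution_def)
  \<comment> \<open>The invariant includes the solvability of the next step, so that a recursion depending only on
    the last map can be used.\<close>
  define P where "P = (\<lambda>i \<phi>. degree_rows V w C D i i \<phi> \<and> (i = 0 \<longrightarrow> \<phi> z y = 1) \<and>
    (\<forall>b\<in>cx_basis C (Suc i). \<exists>g\<in>cx_module V D (Suc i). cx_map D i g = lincomb (cx_basis C i) \<phi> (cx_row C i b)))"
  define Q where "Q = (\<lambda>i \<phi> \<phi>'. \<forall>b\<in>cx_basis C (Suc i). cx_map D i (\<phi>' b) = lincomb (cx_basis C i) \<phi> (cx_row C i b))"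
  have "\<exists>\<phi>. \<forall>i. P i (\<phi> i) \<and> Q i (\<phi> i) (\<phi> (Suc i))"
  proof (rule dependent_nat_choice)
    define \<phi> where "\<phi> = (\<lambda>(b :: 'b) c. if c = y then 1 else 0 :: ('v, 'k) mpoly)"
    have "degree_rows V w C D 0 0 \<phi>"
      using w z y by (auto simp: degree_rows_def \<phi>_def cx_module_def homogeneous_def additive_degree_def split: if_splits)
    moreover have "\<exists>g\<in>cx_module V D (Suc 0). cx_map D 0 g = lincomb (cx_basis C 0) \<phi> (cx_row C 0 b)"
      if b: "b \<in> cx_basis C (Suc 0)" for b
    proof -
      have "cx_row C 0 b z \<in> I"
        using cx_map_unit[OF gC b] z(3) by (metis One_nat_def image_eqI)
      then obtain g where "g \<in> cx_module V D (Suc 0)" "cx_map D 0 g y = cx_row C 0 b z"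
        using y(3) by auto
      then show ?thesis
        using z(1) y(1) by (intro bexI[of _ g]) (auto simp: lincomb_def \<phi>_def cx_map_def fun_eq_iff)
    qed
    ultimately show "\<exists>\<phi>. P 0 \<phi>"
      by (intro exI[of _ \<phi>]) (simp add: P_def \<phi>_def)
  next
    fix \<phi> i assume P: "P i \<phi>"
    have "\<exists>g. g \<in> cx_module V D (Suc i) \<and> homogeneous w D (Suc i) (cx_deg C (Suc i) b) g \<and>
        cx_map D i g = lincomb (cx_basis C i) \<phi> (cx_row C i b)" if b: "b \<in> cx_basis C (Suc i)" for b
    proof -
      obtain g where g: "g \<in> cx_module V D (Suc i)" "cx_map D i g = lincomb (cx_basis C i) \<phi> (cx_row C i b)"
        using P b by (auto simp: P_def)
      have "homogeneous w D i (cx_deg C (Suc i) b) (lincomb (cx_basis C i) \<phi> (cx_row C i b))"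
        using P degree_rows_lincomb(2)[OF w _ cx_row_in_cx_module[OF gC b] homogeneous_row[OF gC b]]
        unfolding P_def by blast
      then show ?thesis
        using homogeneous_preimage[OF gD w g(1)] g(2) by metis
    qed
    then obtain \<phi>' where \<phi>': "degree_rows V w C D (Suc i) (Suc i) \<phi>'"
      and comm: "\<And>b. b \<in> cx_basis C (Suc i) \<Longrightarrow> cx_map D i (\<phi>' b) = lincomb (cx_basis C i) \<phi> (cx_row C i b)"
      using choose_degree_rows[where Q = "\<lambda>b g. cx_map D i g = lincomb (cx_basis C i) \<phi> (cx_row C i b)"]
      by blast
    have "\<exists>g\<in>cx_module V D (Suc (Suc i)). cx_map D (Suc i) g = lincomb (cx_basis C (Suc i)) \<phi>' (cx_row C (Suc i) b)"
      if b: "b \<in> cx_basis C (Suc (Suc i))" for b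
    proof -
      let ?f = "lincomb (cx_basis C (Suc i)) \<phi>' (cx_row C (Suc i) b)"
      have "?f \<in> cx_module V D (Suc i)"
        using degree_rows_lincomb(1)[OF w \<phi>' cx_row_in_cx_module[OF gC b] homogeneous_row[OF gC b]] .
      moreover have "cx_map D i ?f = lincomb (cx_basis C (Suc i))
          (\<lambda>b. lincomb (cx_basis C i) \<phi> (cx_row C i b)) (cx_row C (Suc i) b)"
        unfolding cx_map_of_lincomb by (rule lincomb_cong) (rule comm)
      then have "cx_map D i ?f = lincomb (cx_basis C i) \<phi> (cx_map C i (cx_row C (Suc i) b))"
        by (simp add: cx_map_lincomb[of C] lincomb_lincomb)
      then have "cx_map D i ?f = 0"
        using cx_map_row[OF gC eC b] by simp
      ultimately show ?thesis
        using eD[of i] unfolding exact_at_Suc by (metis (mono_tags, lifting) imageE mem_Collect_eq)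
    qed
    then show "\<exists>\<phi>'. P (Suc i) \<phi>' \<and> Q i \<phi> \<phi>'"
      using \<phi>' comm by (intro exI[of _ \<phi>']) (simp add: P_def Q_def)
  qed
  then obtain \<phi> where \<phi>: "\<And>i. P i (\<phi> i)" "\<And>i. Q i (\<phi> i) (\<phi> (Suc i))"
    by blast
  show thesis
  proof
    show "chain_map V w C D \<phi>"
      using \<phi> by (auto simp: chain_map_def P_def Q_def)
    show "\<forall>b\<in>cx_basis C 0. \<forall>c\<in>cx_basis D 0. \<phi> 0 b c = 1"
      using \<phi>(1)[of 0] z(1) y(1) by (auto simp: P_def)
  qed
qed

text \<open>
  A chain map that vanishes in position \<open>0\<close> lifts the zero map of \<open>S/I\<close>. Its homotopy starts with \<open>0\<close>, and
  the defect of the homotopy relation in one position is a cycle, hence a boundary, in the next one.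
\<close>

lemma chain_map_null_homotopic:
  assumes w: "additive_degree w" and gC: "graded_complex V w C" and eC: "\<And>i. exact_at V C (Suc i)"
    and gD: "graded_complex V w D" and eD: "\<And>i. exact_at V D (Suc i)"
    and \<theta>: "chain_map V w C D \<theta>" and \<theta>0: "\<And>b. b \<in> cx_basis C 0 \<Longrightarrow> \<theta> 0 b = 0"
  obtains h where "\<And>i. degree_rows V w C D i (Suc i) (h i)"
    and "\<And>i b. b \<in> cx_basis C (Suc i) \<Longrightarrow>
      \<theta> (Suc i) b = cx_map D (Suc i) (h (Suc i) b) + lincomb (cx_basis C i) (h i) (cx_row C i b)"
proof -
  have rows: "\<And>i. degree_rows V w C D i i (\<theta> i)"
    and comm: "\<And>i b. b \<in> cx_basis C (Suc i) \<Longrightarrow>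
       cx_map D i (\<theta> (Suc i) b) = lincomb (cx_basis C i) (\<theta> i) (cx_row C i b)"
    using \<theta> by (auto simp: chain_map_def)
  define P where "P = (\<lambda>i h. degree_rows V w C D i (Suc i) h \<and>
    (\<forall>b\<in>cx_basis C (Suc i). cx_map D i (\<theta> (Suc i) b - lincomb (cx_basis C i) h (cx_row C i b)) = 0))"
  define Q where "Q = (\<lambda>i h h'. \<forall>b\<in>cx_basis C (Suc i).
    cx_map D (Suc i) (h' b) = \<theta> (Suc i) b - lincomb (cx_basis C i) h (cx_row C i b))"
  have "\<exists>h. \<forall>i. P i (h i) \<and> Q i (h i) (h (Suc i))"
  proof (rule dependent_nat_choice)
    have "degree_rows V w C D 0 (Suc 0) (\<lambda>b. 0)"
      by (auto simp: degree_rows_def homogeneous_def)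
    moreover have "cx_map D 0 (\<theta> (Suc 0) b - lincomb (cx_basis C 0) (\<lambda>b. 0) (cx_row C 0 b)) = 0"
      if "b \<in> cx_basis C (Suc 0)" for b
      using comm[OF that] \<theta>0 by (simp add: lincomb_zero_rows)
    ultimately show "\<exists>h. P 0 h"
      unfolding P_def by blast
  next
    fix h i assume P: "P i h"
    let ?y = "\<lambda>b. \<theta> (Suc i) b - lincomb (cx_basis C i) h (cx_row C i b)"
    have "\<exists>g. g \<in> cx_module V D (Suc (Suc i)) \<and> homogeneous w D (Suc (Suc i)) (cx_deg C (Suc i) b) g \<and>
        cx_map D (Suc i) g = ?y b" if b: "b \<in> cx_basis C (Suc i)" for b
    proof -
      have "degree_rows V w C D i (Suc i) h"
        using P by (simp add: P_def)
      note * = degree_rows_lincomb[OF w this cx_row_in_cx_module[OF gC b] homogeneous_row[OF gC b]]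
      have "?y b \<in> cx_module V D (Suc i)" "homogeneous w D (Suc i) (cx_deg C (Suc i) b) (?y b)"
        using rows b * by (auto simp: degree_rows_def intro!: diff_in_cx_module homogeneous_diff)
      moreover have "cx_map D i (?y b) = 0"
        using P b by (simp add: P_def)
      ultimately show ?thesis
        using homogeneous_exact[OF gD w eD, of "?y b" i] by metis
    qed
    then obtain h' where h': "degree_rows V w C D (Suc i) (Suc (Suc i)) h'"
      and eq: "\<And>b. b \<in> cx_basis C (Suc i) \<Longrightarrow> cx_map D (Suc i) (h' b) = ?y b"
      using choose_degree_rows[where Q = "\<lambda>b g. cx_map D (Suc i) g = ?y b"] by blast
    have "cx_map D (Suc i) (\<theta> (Suc (Suc i)) b - lincomb (cx_basis C (Suc i)) h' (cx_row C (Suc i) b)) = 0"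
      if b: "b \<in> cx_basis C (Suc (Suc i))" for b
    proof -
      have "cx_map D (Suc i) (lincomb (cx_basis C (Suc i)) h' (cx_row C (Suc i) b))
          = lincomb (cx_basis C (Suc i)) ?y (cx_row C (Suc i) b)"
        using eq by (simp add: cx_map_of_lincomb cong: lincomb_cong)
      also have "\<dots> = cx_map D (Suc i) (\<theta> (Suc (Suc i)) b)
          - lincomb (cx_basis C i) h (cx_map C i (cx_row C (Suc i) b))"
        by (simp add: comm[OF b] lincomb_diff_rows cx_map_lincomb[of C] lincomb_lincomb)
      finally show ?thesis
        using cx_map_row[OF gC eC b] by (simp add: cx_map_diff)
    qed
    then show "\<exists>h'. P (Suc i) h' \<and> Q i h h'"
      using h' eq by (intro exI[of _ h']) (simp add: P_def Q_def)
  qed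
  then obtain h where h: "\<And>i. P i (h i)" "\<And>i. Q i (h i) (h (Suc i))"
    by blast
  show thesis
  proof
    show "degree_rows V w C D i (Suc i) (h i)" for i
      using h(1) by (simp add: P_def)
    show "\<theta> (Suc i) b = cx_map D (Suc i) (h (Suc i) b) + lincomb (cx_basis C i) (h i) (cx_row C i b)"
      if "b \<in> cx_basis C (Suc i)" for i b
      using h(2)[of i] that by (simp add: Q_def)
  qed
qed

section \<open>Reduction modulo the variables\<close>

definition reduced_lincomb ::
  "'b set \<Rightarrow> ('b \<Rightarrow> 'c \<Rightarrow> ('v, 'k::field) mpoly) \<Rightarrow> ('b \<Rightarrow> 'k) \<Rightarrow> 'c \<Rightarrow> 'k" where
  "reduced_lincomb B A v = (\<lambda>c. \<Sum>b\<in>B. v b * lookup (A b c) 0)"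

lemma red_map_reduced_lincomb:
  "red_map C i v = reduced_lincomb (cx_basis C (Suc i)) (cx_row C i) v"
  by (auto simp: red_map_def reduced_lincomb_def cx_row_def fun_eq_iff)

lemma reduced_lincomb_lincomb:
  "reduced_lincomb B A (reduced_lincomb B' A' v) = reduced_lincomb B' (\<lambda>b. lincomb B A (A' b)) v"
  by (auto simp: reduced_lincomb_def lincomb_def fun_eq_iff lookup_sum lookup_mult_0 sum_distrib_left
      sum_distrib_right mult.assoc intro: sum.swap)

lemma reduced_lincomb_cong:
  "(\<And>b. b \<in> B \<Longrightarrow> A b = A' b) \<Longrightarrow> reduced_lincomb B A v = reduced_lincomb B A' v"
  by (auto simp: reduced_lincomb_def fun_eq_iff intro!: sum.cong)

lemma reduced_lincomb_add: "reduced_lincomb B A (u + v) = reduced_lincomb B A u + reduced_lincomb B A v"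
  by (simp add: reduced_lincomb_def fun_eq_iff distrib_right sum.distrib)

lemma reduced_lincomb_uminus: "reduced_lincomb B A (- v) = - reduced_lincomb B A v"
  by (simp add: reduced_lincomb_def fun_eq_iff sum_negf)

lemma reduced_lincomb_scale: "reduced_lincomb B A (\<lambda>b. a * v b) = (\<lambda>c. a * reduced_lincomb B A v c)"
  by (simp add: reduced_lincomb_def fun_eq_iff sum_distrib_left mult.assoc)

lemma reduced_lincomb_zero [simp]: "reduced_lincomb B A 0 = 0"
  by (simp add: reduced_lincomb_def fun_eq_iff)

lemma reduced_lincomb_add_rows:
  "reduced_lincomb B (\<lambda>b. A b + A' b) v = reduced_lincomb B A v + reduced_lincomb B A' v"
  by (simp add: reduced_lincomb_def fun_eq_iff distrib_left sum.distrib lookup_add)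

lemma reduced_lincomb_diff_rows:
  "reduced_lincomb B (\<lambda>b. A b - A' b) v = reduced_lincomb B A v - reduced_lincomb B A' v"
  by (simp add: reduced_lincomb_def fun_eq_iff right_diff_distrib sum_subtractf lookup_minus)

text \<open>
  A nonzero constant coefficient in a matrix of degree \<open>0\<close> joins basis elements of equal degree.
\<close>

lemma reduced_lincomb_in_red_space:
  assumes w: "additive_degree w" and A: "degree_rows V w C D i j A" and v: "v \<in> red_space C i \<alpha>"
  shows "reduced_lincomb (cx_basis C i) A v \<in> red_space D j \<alpha>"
  unfolding red_space_def
proof (intro CollectI allI impI)
  fix c assume "reduced_lincomb (cx_basis C i) A v c \<noteq> 0"
  then obtain b where b: "b \<in> cx_basis C i" "v b * lookup (A b c) 0 \<noteq> 0"
    unfolding reduced_lincomb_def by (meson sum.neutral)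
  then have "0 \<in> keys (A b c)" "cx_deg C i b = \<alpha>"
    using v by (auto simp: in_keys_iff red_space_def)
  then show "c \<in> cx_basis D j \<and> cx_deg D j c = \<alpha>"
    using A b(1) w
    by (fastforce simp: degree_rows_def homogeneous_def cx_module_def additive_degree_def)
qed

lemma row_degree_rows:
  assumes "graded_complex V w C"
  shows "degree_rows V w C C (Suc i) i (cx_row C i)"
  using cx_row_in_cx_module[OF assms] homogeneous_row[OF assms] by (simp add: degree_rows_def)

lemma red_map_in_red_space:
  assumes "additive_degree w" "graded_complex V w C" "v \<in> red_space C (Suc i) \<alpha>"
  shows "red_map C i v \<in> red_space C i \<alpha>"
  unfolding red_map_reduced_lincomb
  by (rule reduced_lincomb_in_red_space[OF assms(1) row_degree_rows[OF assms(2)] assms(3)])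

lemma red_map_red_map:
  assumes C: "graded_complex V w C" and e: "exact_at V C (Suc i)"
  shows "red_map C i (red_map C (Suc i) v) = 0"
proof -
  have "red_map C i (red_map C (Suc i) v)
      = reduced_lincomb (cx_basis C (Suc (Suc i))) (\<lambda>b. cx_map C i (cx_row C (Suc i) b)) v"
    by (simp add: red_map_reduced_lincomb reduced_lincomb_lincomb cx_map_lincomb)
  also have "\<dots> = 0"
    using cx_map_row[OF C e] by (simp add: reduced_lincomb_def fun_eq_iff)
  finally show ?thesis .
qed

lemma red_map_chain_map:
  assumes "chain_map V w C D \<phi>"
  shows "red_map D i (reduced_lincomb (cx_basis C (Suc i)) (\<phi> (Suc i)) v)
    = reduced_lincomb (cx_basis C i) (\<phi> i) (red_map C i v)"
proof -
  have "red_map D i (reduced_lincomb (cx_basis C (Suc i)) (\<phi> (Suc i)) v)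
      = reduced_lincomb (cx_basis C (Suc i)) (\<lambda>b. cx_map D i (\<phi> (Suc i) b)) v"
    by (simp add: red_map_reduced_lincomb reduced_lincomb_lincomb cx_map_lincomb)
  also have "\<dots> = reduced_lincomb (cx_basis C (Suc i)) (\<lambda>b. lincomb (cx_basis C i) (\<phi> i) (cx_row C i b)) v"
    using assms by (intro reduced_lincomb_cong) (auto simp: chain_map_def)
  finally show ?thesis
    by (simp add: red_map_reduced_lincomb reduced_lincomb_lincomb)
qed

lemma red_map_minimal: "minimal_complex C \<Longrightarrow> red_map C i v = 0"
  by (auto simp: minimal_complex_def red_map_def fun_eq_iff)

lemma identity_degree_rows:
  assumes "additive_degree w"
  shows "degree_rows V w C C i i (\<lambda>b c. if c = b then 1 else 0)"
  using assms by (auto simp: degree_rows_def cx_module_def homogeneous_def additive_degree_def split: if_splits)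

lemma lincomb_identity:
  assumes "finite B" "\<And>b. b \<notin> B \<Longrightarrow> f b = 0"
  shows "lincomb B (\<lambda>b c. if c = b then 1 else 0) f = f"
  using assms by (auto simp: lincomb_def fun_eq_iff if_distrib[of "\<lambda>x. _ * x"] cong: if_cong)

lemma reduced_lincomb_identity:
  assumes "finite B" "\<And>b. b \<notin> B \<Longrightarrow> v b = 0"
  shows "reduced_lincomb B (\<lambda>b c. if c = b then 1 else 0) v = v"
  using assms by (auto simp: reduced_lincomb_def fun_eq_iff if_distrib[of "\<lambda>x. lookup x 0"]
      if_distrib[of "\<lambda>x. _ * x"] cong: if_cong)

lemma degree_rows_diff:
  "degree_rows V w C D i j A \<Longrightarrow> degree_rows V w C D i j A' \<Longrightarrow> degree_rows V w C D i j (\<lambda>b. A b - A' b)"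
  by (auto simp: degree_rows_def intro: diff_in_cx_module homogeneous_diff)

lemma degree_rows_compose:
  assumes "additive_degree w" "degree_rows V w C D i j A" "degree_rows V w D E j l A'"
  shows "degree_rows V w C E i l (\<lambda>b. lincomb (cx_basis D j) A' (A b))"
  using assms degree_rows_lincomb[OF assms(1,3)] by (auto simp: degree_rows_def)

text \<open>
  The composite of two lifts of the identity differs from the identity by a null-homotopic map. On a
  reduced cycle one of the two terms of the homotopy vanishes and the other one is a reduced boundary.
\<close>

lemma round_trip:
  fixes C :: "('b, 'g::comm_monoid_add, 'v, 'k::field) free_complex"
    and D :: "('c, 'g, 'v, 'k) free_complex"
  assumes w: "additive_degree w" and gC: "graded_complex V w C" and eC: "\<And>i. exact_at V C (Suc i)"
    and \<phi>: "chain_map V w C D \<phi>" and \<psi>: "chain_map V w D C \<psi>"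
    and zC: "cx_basis C 0 = {z}" and zD: "cx_basis D 0 = {y}"
    and \<phi>0: "\<phi> 0 z y = 1" and \<psi>0: "\<psi> 0 y z = 1"
    and v: "v \<in> red_space C (Suc i) \<alpha>" "red_map C i v = 0"
  obtains u where "u \<in> red_space C (Suc (Suc i)) \<alpha>"
    and "reduced_lincomb (cx_basis D (Suc i)) (\<psi> (Suc i)) (reduced_lincomb (cx_basis C (Suc i)) (\<phi> (Suc i)) v)
      - v = red_map C (Suc i) u"
proof -
  let ?one = "\<lambda>(b :: 'b) c. if c = b then 1 else 0 :: ('v, 'k) mpoly"
  define \<theta> where "\<theta> = (\<lambda>i b. lincomb (cx_basis D i) (\<psi> i) (\<phi> i b) - ?one b)"
  have fin: "finite (cx_basis C i)" for i
    using gC by (simp add: graded_complex_def)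
  have row0: "b' \<notin> cx_basis C i \<Longrightarrow> cx_row C i b b' = 0" for i b b'
    by (simp add: cx_row_def)
  have one_row: "cx_map C i (?one b) = cx_row C i b" if "b \<in> cx_basis C (Suc i)" for i b
    using cx_map_unit(2)[OF gC that] .
  have "chain_map V w C C \<theta>"
    unfolding chain_map_def
  proof (intro conjI allI ballI)
    show "degree_rows V w C C i i (\<theta> i)" for i
      unfolding \<theta>_def using \<phi> \<psi> w
      by (intro degree_rows_diff degree_rows_compose identity_degree_rows) (auto simp: chain_map_def)
    fix i b assume b: "b \<in> cx_basis C (Suc i)"
    have "cx_map C i (lincomb (cx_basis D (Suc i)) (\<psi> (Suc i)) (\<phi> (Suc i) b))
        = lincomb (cx_basis D (Suc i)) (\<lambda>b. lincomb (cx_basis D i) (\<psi> i) (cx_row D i b)) (\<phi> (Suc i) b)"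
      unfolding cx_map_of_lincomb using \<psi> by (intro lincomb_cong) (auto simp: chain_map_def)
    also have "\<dots> = lincomb (cx_basis D i) (\<psi> i) (cx_map D i (\<phi> (Suc i) b))"
      by (simp add: cx_map_lincomb lincomb_lincomb)
    also have "cx_map D i (\<phi> (Suc i) b) = lincomb (cx_basis C i) (\<phi> i) (cx_row C i b)"
      using \<phi> b by (simp add: chain_map_def)
    finally show "cx_map C i (\<theta> (Suc i) b) = lincomb (cx_basis C i) (\<theta> i) (cx_row C i b)"
      using lincomb_identity[OF fin row0]
      by (simp add: \<theta>_def cx_map_diff one_row[OF b] lincomb_diff_rows lincomb_lincomb)
  qed
  moreover have "\<theta> 0 b = 0" if "b \<in> cx_basis C 0" for b
  proof -
    have "\<psi> 0 y \<in> cx_module V C 0"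
      using \<psi> zD by (auto simp: chain_map_def degree_rows_def)
    then have "\<psi> 0 y c = 0" if "c \<noteq> z" for c
      using that zC by (auto simp: cx_module_def)
    then show ?thesis
      using that zC zD \<phi>0 \<psi>0 by (auto simp: \<theta>_def lincomb_def fun_eq_iff)
  qed
  ultimately obtain h where h: "\<And>i. degree_rows V w C C i (Suc i) (h i)"
    and eq: "\<And>i b. b \<in> cx_basis C (Suc i) \<Longrightarrow>
      \<theta> (Suc i) b = cx_map C (Suc i) (h (Suc i) b) + lincomb (cx_basis C i) (h i) (cx_row C i b)"
    using chain_map_null_homotopic[OF w gC eC gC eC] by metis
  show thesis
  proof
    let ?B = "cx_basis C (Suc i)"
    show "reduced_lincomb ?B (h (Suc i)) v \<in> red_space C (Suc (Suc i)) \<alpha>"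
      using reduced_lincomb_in_red_space[OF w h v(1)] .
    have v0: "v b = 0" if "b \<notin> ?B" for b
      using v(1) that by (auto simp: red_space_def)
    have one_v: "reduced_lincomb ?B ?one v = v"
      by (rule reduced_lincomb_identity[OF fin v0])
    have "reduced_lincomb (cx_basis D (Suc i)) (\<psi> (Suc i)) (reduced_lincomb ?B (\<phi> (Suc i)) v) - v
        = reduced_lincomb ?B (\<theta> (Suc i)) v"
      using one_v
      by (simp add: \<theta>_def reduced_lincomb_diff_rows reduced_lincomb_lincomb)
    also have "\<dots> = reduced_lincomb ?B
        (\<lambda>b. cx_map C (Suc i) (h (Suc i) b) + lincomb (cx_basis C i) (h i) (cx_row C i b)) v"
      using eq by (intro reduced_lincomb_cong) simp
    also have "\<dots> = red_map C (Suc i) (reduced_lincomb ?B (h (Suc i)) v)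
        + reduced_lincomb (cx_basis C i) (h i) (red_map C i v)"
      by (simp add: reduced_lincomb_add_rows red_map_reduced_lincomb reduced_lincomb_lincomb cx_map_lincomb)
    finally show "reduced_lincomb (cx_basis D (Suc i)) (\<psi> (Suc i)) (reduced_lincomb ?B (\<phi> (Suc i)) v) - v
        = red_map C (Suc i) (reduced_lincomb ?B (h (Suc i)) v)"
      using v(2) by simp
  qed
qed

interpretation fun_space: vector_space "\<lambda>a (v :: 'b \<Rightarrow> 'k::field) b. a * v b"
  by unfold_locales (auto simp: fun_eq_iff algebra_simps)

abbreviation unit_vec :: "'b \<Rightarrow> 'b \<Rightarrow> 'k::field" where
  "unit_vec b \<equiv> (\<lambda>c. if c = b then 1 else 0)"

lemma sum_fun_apply: "(\<Sum>a\<in>A. f a) x = (\<Sum>a\<in>A. f a x)"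
  by (induction A rule: infinite_finite_induct) auto

lemma red_space_span:
  fixes C :: "('b, 'g::comm_monoid_add, 'v, 'k::field) free_complex"
  assumes "finite (cx_basis C i)"
  shows "red_space C i \<alpha> \<subseteq> fun_space.span (unit_vec ` cx_basis C i)"
proof
  fix v assume v: "v \<in> red_space C i \<alpha>"
  have "v = (\<Sum>b\<in>cx_basis C i. (\<lambda>c. v b * (unit_vec b c :: 'k)))"
  proof
    fix c
    show "v c = (\<Sum>b\<in>cx_basis C i. (\<lambda>c. v b * (unit_vec b c :: 'k))) c"
      using assms v by (auto simp: sum_fun_apply red_space_def if_distrib[of "\<lambda>x. _ * x"] cong: if_cong)
  qed
  moreover have "(\<Sum>b\<in>cx_basis C i. (\<lambda>c. v b * (unit_vec b c :: 'k))) \<in> fun_space.span (unit_vec ` cx_basis C i)"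
    by (intro fun_space.span_sum fun_space.span_scale fun_space.span_base) auto
  ultimately show "v \<in> fun_space.span (unit_vec ` cx_basis C i)"
    by metis
qed

lemma subspace_boundaries:
  fixes C :: "('b, 'g::comm_monoid_add, 'v, 'k::field) free_complex"
  shows "fun_space.subspace (red_map C i ` red_space C (Suc i) \<alpha>)"
proof (rule fun_space.subspaceI)
  let ?R = "red_space C (Suc i) \<alpha>"
  have "red_map C i 0 = 0" "(0 :: 'b \<Rightarrow> 'k) \<in> ?R"
    by (simp_all add: red_map_reduced_lincomb red_space_def)
  then show "0 \<in> red_map C i ` ?R"
    by (metis image_eqI)
  fix x y assume "x \<in> red_map C i ` ?R" "y \<in> red_map C i ` ?R"
  then obtain u v where uv: "x = red_map C i u" "u \<in> ?R" "y = red_map C i v" "v \<in> ?R"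
    by blast
  have "u b \<noteq> 0 \<or> v b \<noteq> 0" if "(u + v) b \<noteq> 0" for b
    using that by auto
  then have "u + v \<in> ?R"
    using uv unfolding red_space_def by blast
  moreover have "x + y = red_map C i (u + v)"
    using uv by (simp add: red_map_reduced_lincomb reduced_lincomb_add)
  ultimately show "x + y \<in> red_map C i ` ?R"
    by blast
next
  let ?R = "red_space C (Suc i) \<alpha>"
  fix a x assume "x \<in> red_map C i ` ?R"
  then obtain u where u: "x = red_map C i u" "u \<in> ?R"
    by blast
  then have "(\<lambda>b. a * x b) = red_map C i (\<lambda>b. a * u b)" "(\<lambda>b. a * u b) \<in> ?R"
    by (auto simp: red_map_reduced_lincomb reduced_lincomb_scale red_space_def)
  then show "(\<lambda>b. a * x b) \<in> red_map C i ` ?R"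
    by blast
qed

text \<open>
  A dimension count for \<open>Z = B \<oplus> s(E)\<close>, in a space of functions that may be infinite-dimensional: \<open>T\<close> is the
  projection, with kernel containing \<open>B\<close>, and the vectors \<open>s b\<close> form a section. The coordinate \<open>b\<close> of \<open>T\<close>
  separates \<open>s b\<close> from the span of \<open>B\<close> and the other vectors, which gives independence.
\<close>

lemma dim_split:
  fixes T :: "('c \<Rightarrow> 'k::field) \<Rightarrow> 'b \<Rightarrow> 'k" and s :: "'b \<Rightarrow> 'c \<Rightarrow> 'k"
  assumes F: "finite F" "Z \<subseteq> fun_space.span F"
    and B: "fun_space.subspace B" "B \<subseteq> Z" and E: "finite E"
    and T_add: "\<And>u v. T (u + v) = T u + T v" and T_scale: "\<And>a v. T (\<lambda>c. a * v c) = (\<lambda>b. a * T v b)"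
    and sZ: "\<And>b. b \<in> E \<Longrightarrow> s b \<in> Z" and Ts: "\<And>b. b \<in> E \<Longrightarrow> T (s b) = unit_vec b"
    and TB: "\<And>v. v \<in> B \<Longrightarrow> T v = 0"
    and split: "\<And>v. v \<in> Z \<Longrightarrow> v - (\<Sum>b\<in>E. (\<lambda>c. T v b * s b c)) \<in> B"
  shows "kdim Z = kdim B + card E"
proof -
  obtain BB where BB: "BB \<subseteq> B" "fun_space.independent BB" "B \<subseteq> fun_space.span BB" "card BB = kdim B"
    by (rule fun_space.basis_exists)
  have "BB \<subseteq> fun_space.span F"
    using BB(1) B(2) F(2) by (meson order_trans)
  then have finBB: "finite BB"
    using fun_space.independent_span_bound[OF F(1) BB(2)] by simp
  have T0: "T 0 = 0"
    using T_scale[of 0 "\<lambda>_. 0"] by (simp add: zero_fun_def)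
  have main: "fun_space.independent (BB \<union> s ` E') \<and> card (BB \<union> s ` E') = card BB + card E'"
    if "finite E'" "E' \<subseteq> E" for E'
    using that
  proof (induction E')
    case empty
    then show ?case using BB(2) by simp
  next
    case (insert b E')
    define U where "U = {v. T v b = 0}"
    have "fun_space.subspace U"
    proof (rule fun_space.subspaceI)
      show "0 \<in> U"
        using T0 by (simp add: U_def)
      show "x + y \<in> U" if "x \<in> U" "y \<in> U" for x y
        using that by (simp add: U_def T_add)
      show "(\<lambda>c. a * x c) \<in> U" if "x \<in> U" for a x
        using that unfolding U_def mem_Collect_eq T_scale by simp
    qed
    moreover have "BB \<union> s ` E' \<subseteq> U"
    proof
      fix v assume "v \<in> BB \<union> s ` E'"
      then consider "v \<in> B" | b' where "b' \<in> E'" "v = s b'"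
        using BB(1) by blast
      then show "v \<in> U"
      proof cases
        case 1
        then show ?thesis
          using TB by (simp add: U_def)
      next
        case 2
        then have "T v = unit_vec b'" "b' \<noteq> b"
          using Ts insert.hyps insert.prems by auto
        then show ?thesis
          by (simp add: U_def)
      qed
    qed
    ultimately have "fun_space.span (BB \<union> s ` E') \<subseteq> U"
      by (intro fun_space.span_minimal)
    moreover have "s b \<notin> U"
      using Ts insert.prems by (simp add: U_def)
    ultimately have nin: "s b \<notin> fun_space.span (BB \<union> s ` E')"
      by blast
    then have nin': "s b \<notin> BB \<union> s ` E'"
      by (rule contrapos_nn) (rule fun_space.span_base)
    have sub: "E' \<subseteq> E"
      using insert.prems by simp
    have IH: "fun_space.independent (BB \<union> s ` E')" "card (BB \<union> s ` E') = card BB + card E'"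
      using insert.IH[OF sub] by (rule conjunct1, rule conjunct2)
    have "fun_space.independent (insert (s b) (BB \<union> s ` E'))"
      by (rule fun_space.independent_insertI[OF nin IH(1)])
    moreover have "card (insert (s b) (BB \<union> s ` E')) = card BB + card (insert b E')"
      using nin' IH(2) finBB insert.hyps by simp
    ultimately show ?case
      by (simp only: image_insert Un_insert_right simp_thms)
  qed
  have "Z \<subseteq> fun_space.span (BB \<union> s ` E)"
  proof
    fix v assume v: "v \<in> Z"
    let ?r = "\<Sum>b\<in>E. (\<lambda>c. T v b * s b c)"
    have "v - ?r \<in> fun_space.span (BB \<union> s ` E)"
      using split[OF v] BB(3) fun_space.span_mono[OF Un_upper1, of BB "s ` E"] by (meson subsetD)
    moreover have "?r \<in> fun_space.span (BB \<union> s ` E)"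
      by (intro fun_space.span_sum fun_space.span_scale fun_space.span_base) auto
    ultimately have "(v - ?r) + ?r \<in> fun_space.span (BB \<union> s ` E)"
      by (rule fun_space.span_add)
    then show "v \<in> fun_space.span (BB \<union> s ` E)"
      by simp
  qed
  moreover have "BB \<union> s ` E \<subseteq> Z"
    using BB(1) B(2) sZ by blast
  ultimately have "kdim Z = card (BB \<union> s ` E)"
    using fun_space.basis_card_eq_dim[of "BB \<union> s ` E" Z] main[OF E subset_refl] by simp
  then show ?thesis
    using main[OF E subset_refl] BB(4) by simp
qed

text \<open>
  Lifts of the identity from the minimal resolution \<open>C\<close> to \<open>D\<close> and back induce maps \<open>S\<close> and \<open>T\<close> on the
  reductions. Since the reduced differential of \<open>C\<close> is zero, \<open>T S\<close> is the identity, while \<open>S T\<close> is the identity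
  on cycles up to boundaries. So the cycles of \<open>D\<close> are the boundaries plus a copy of the reduction of \<open>C\<close>.
\<close>

theorem reduced_homology_of_resolution:
  fixes C :: "('b, 'g::comm_monoid_add, 'v, 'k::field) free_complex"
    and D :: "('c, 'g, 'v, 'k) free_complex"
  assumes w: "additive_degree w" and C: "graded_resolution V w I C" "minimal_complex C"
    and D: "graded_resolution V w I D"
  shows "kdim {v \<in> red_space D (Suc i) \<alpha>. red_map D i v = 0}
    = kdim (red_map D (Suc i) ` red_space D (Suc (Suc i)) \<alpha>)
      + card {b \<in> cx_basis C (Suc i). cx_deg C (Suc i) b = \<alpha>}"
proof -
  have gC: "graded_complex V w C" and eC: "\<And>i. exact_at V C (Suc i)"
    and gD: "graded_complex V w D" and eD: "\<And>i. exact_at V D (Suc i)"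
    using C(1) D by (auto simp: graded_resolution_def)
  obtain z where z: "cx_basis C 0 = {z}"
    using C(1) by (auto simp: graded_resolution_def)
  obtain y where y: "cx_basis D 0 = {y}"
    using D by (auto simp: graded_resolution_def)
  obtain \<phi> where \<phi>1: "chain_map V w C D \<phi>"
    and "\<forall>b\<in>cx_basis C 0. \<forall>c\<in>cx_basis D 0. \<phi> 0 b c = 1"
    by (rule chain_map_lift[OF w C(1) D])
  then have \<phi>: "chain_map V w C D \<phi>" "\<phi> 0 z y = 1"
    using z y by simp_all
  obtain \<psi> where \<psi>1: "chain_map V w D C \<psi>"
    and "\<forall>b\<in>cx_basis D 0. \<forall>c\<in>cx_basis C 0. \<psi> 0 b c = 1"
    by (rule chain_map_lift[OF w D C(1)])
  then have \<psi>: "chain_map V w D C \<psi>" "\<psi> 0 y z = 1"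
    using z y by simp_all
  define S where "S = reduced_lincomb (cx_basis C (Suc i)) (\<phi> (Suc i))"
  define T where "T = reduced_lincomb (cx_basis D (Suc i)) (\<psi> (Suc i))"
  define Z where "Z = {v \<in> red_space D (Suc i) \<alpha>. red_map D i v = 0}"
  define E where "E = {b \<in> cx_basis C (Suc i). cx_deg C (Suc i) b = \<alpha>}"
  have finC: "finite (cx_basis C (Suc i))" and finD: "finite (cx_basis D (Suc i))"
    using gC gD by (auto simp: graded_complex_def)
  have S_Z: "S u \<in> Z" if "u \<in> red_space C (Suc i) \<alpha>" for u
    using \<phi>(1) that w unfolding Z_def S_def
    by (auto simp: red_map_chain_map red_map_minimal[OF C(2)] chain_map_def intro: reduced_lincomb_in_red_space)
  have T_space: "T v \<in> red_space C (Suc i) \<alpha>" if "v \<in> Z" for v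
    using \<psi>(1) that w unfolding Z_def T_def by (auto simp: chain_map_def intro: reduced_lincomb_in_red_space)
  have TS: "T (S u) = u" if "u \<in> red_space C (Suc i) \<alpha>" for u
    using round_trip[OF w gC eC \<phi>(1) \<psi>(1) z y \<phi>(2) \<psi>(2) that red_map_minimal[OF C(2)]]
      red_map_minimal[OF C(2)] unfolding S_def T_def by (metis right_minus_eq)
  have T_zero: "T (red_map D (Suc i) u) = 0" for u
    using red_map_chain_map[OF \<psi>(1), of "Suc i" u] by (simp add: T_def red_map_minimal[OF C(2)])
  have E_vec: "unit_vec b \<in> red_space C (Suc i) \<alpha>" if "b \<in> E" for b
    using that by (auto simp: red_space_def E_def)
  have S_sum: "S u = (\<Sum>b\<in>E. (\<lambda>c. u b * S (unit_vec b) c))" if u: "u \<in> red_space C (Suc i) \<alpha>" for u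
  proof
    fix c
    have S_unit: "S (unit_vec b) c = lookup (\<phi> (Suc i) b c) 0" if "b \<in> E" for b
      using that finC by (simp add: S_def reduced_lincomb_def E_def if_distrib[of "\<lambda>x. x * _"] cong: if_cong)
    have "(\<Sum>b\<in>E. (\<lambda>c. u b * S (unit_vec b) c)) c = (\<Sum>b\<in>E. u b * lookup (\<phi> (Suc i) b c) 0)"
      by (simp add: sum_fun_apply S_unit)
    also have "\<dots> = (\<Sum>b\<in>cx_basis C (Suc i). u b * lookup (\<phi> (Suc i) b c) 0)"
      using u finC by (intro sum.mono_neutral_left) (auto simp: E_def red_space_def)
    finally show "S u c = (\<Sum>b\<in>E. (\<lambda>c. u b * S (unit_vec b) c)) c"
      by (simp add: S_def reduced_lincomb_def)
  qed
  have "kdim Z = kdim (red_map D (Suc i) ` red_space D (Suc (Suc i)) \<alpha>) + card E"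
  proof (rule dim_split[where F = "unit_vec ` cx_basis D (Suc i)" and T = T and s = "\<lambda>b. S (unit_vec b)"])
    show "Z \<subseteq> fun_space.span (unit_vec ` cx_basis D (Suc i))"
      using red_space_span[OF finD] by (auto simp: Z_def)
    show "fun_space.subspace (red_map D (Suc i) ` red_space D (Suc (Suc i)) \<alpha>)"
      by (rule subspace_boundaries)
    show "red_map D (Suc i) ` red_space D (Suc (Suc i)) \<alpha> \<subseteq> Z"
      unfolding Z_def by (auto intro: red_map_in_red_space[OF w gD] simp: red_map_red_map[OF gD eD])
    show "v - (\<Sum>b\<in>E. (\<lambda>c. T v b * S (unit_vec b) c)) \<in> red_map D (Suc i) ` red_space D (Suc (Suc i)) \<alpha>"
      if v: "v \<in> Z" for v
    proof -
      have v': "v \<in> red_space D (Suc i) \<alpha>" "red_map D i v = 0"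
        using v by (simp_all add: Z_def)
      obtain u where u: "u \<in> red_space D (Suc (Suc i)) \<alpha>" "S (T v) - v = red_map D (Suc i) u"
        unfolding S_def T_def
        by (rule round_trip[OF w gD eD \<psi>(1) \<phi>(1) y z \<psi>(2) \<phi>(2) v'])
      have "v - S (T v) = red_map D (Suc i) (- u)"
        by (simp only: red_map_reduced_lincomb reduced_lincomb_uminus
            u(2)[symmetric, unfolded red_map_reduced_lincomb] minus_diff_eq)
      moreover have "- u \<in> red_space D (Suc (Suc i)) \<alpha>"
        using u(1) by (simp add: red_space_def)
      ultimately show ?thesis
        unfolding S_sum[OF T_space[OF v], symmetric] by (rule image_eqI)
    qed
    show "finite (unit_vec ` cx_basis D (Suc i) :: ('c \<Rightarrow> 'k) set)" "finite E"
      using finD finC by (auto simp: E_def)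
    show "T (u + v) = T u + T v" "T (\<lambda>c. a * v c) = (\<lambda>b. a * T v b)" for u v a
      by (simp_all add: T_def reduced_lincomb_add reduced_lincomb_scale)
    show "S (unit_vec b) \<in> Z" "T (S (unit_vec b)) = unit_vec b" if "b \<in> E" for b
      using S_Z[OF E_vec[OF that]] TS[OF E_vec[OF that]] by auto
    show "T v = 0" if "v \<in> red_map D (Suc i) ` red_space D (Suc (Suc i)) \<alpha>" for v
      using that by (rule imageE) (simp add: T_zero)
  qed
  then show ?thesis
    by (simp add: Z_def E_def)
qed

section \<open>Graded Betti numbers of ideals with a minimal resolution\<close>

text \<open>
  The passage from a resolution of \<open>I\<close> to one of \<open>S/I\<close> keeps the index type: bases in different positions
  need not be disjoint, so an arbitrary element can serve as the generator in position \<open>0\<close>.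
\<close>

definition augment ::
  "('b, 'g::comm_monoid_add, 'v, 'k::field) free_complex \<Rightarrow> ('b \<Rightarrow> ('v, 'k) mpoly) \<Rightarrow>
   ('b, 'g, 'v, 'k) free_complex" where
  "augment G \<epsilon> =
     \<lparr>cx_basis = (\<lambda>i. case i of 0 \<Rightarrow> {undefined} | Suc j \<Rightarrow> cx_basis G j),
      cx_deg = (\<lambda>i b. case i of 0 \<Rightarrow> 0 | Suc j \<Rightarrow> cx_deg G j b),
      cx_diff = (\<lambda>i b c. case i of 0 \<Rightarrow> \<epsilon> b | Suc j \<Rightarrow> cx_diff G j b c)\<rparr>"

lemma augment_sel [simp]:
  "cx_basis (augment G \<epsilon>) 0 = {undefined}"
  "cx_basis (augment G \<epsilon>) (Suc j) = cx_basis G j"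
  "cx_deg (augment G \<epsilon>) 0 b = 0"
  "cx_deg (augment G \<epsilon>) (Suc j) b = cx_deg G j b"
  "cx_diff (augment G \<epsilon>) 0 b c = \<epsilon> b"
  "cx_diff (augment G \<epsilon>) (Suc j) b c = cx_diff G j b c"
  by (simp_all add: augment_def)

lemma cx_module_augment: "cx_module V (augment G \<epsilon>) (Suc i) = cx_module V G i"
  by (simp add: cx_module_def)

lemma cx_map_augment_Suc: "cx_map (augment G \<epsilon>) (Suc i) = cx_map G i"
  by (simp add: cx_map_def fun_eq_iff)

lemma cx_map_augment_0:
  "cx_map (augment G \<epsilon>) 0 f = (\<lambda>c. if c = undefined then \<Sum>b\<in>cx_basis G 0. f b * \<epsilon> b else 0)"
  by (simp add: cx_map_def fun_eq_iff)

lemma red_space_augment: "red_space (augment G \<epsilon>) (Suc i) \<alpha> = red_space G i \<alpha>"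
  by (simp add: red_space_def)

lemma red_map_augment_Suc: "red_map (augment G \<epsilon>) (Suc i) = red_map G i"
  by (simp add: red_map_def fun_eq_iff)

lemma augment_resolution:
  assumes "resolves_ideal V w I G \<epsilon>"
  shows "graded_resolution V w I (augment G \<epsilon>)"
  unfolding graded_resolution_def
proof (intro conjI exI allI impI)
  have G: "graded_complex V w G"
      "\<forall>b\<in>cx_basis G 0. \<epsilon> b \<in> polys V \<and> (\<forall>m\<in>Poly_Mapping.keys (\<epsilon> b). w m = cx_deg G 0 b)"
      "(\<lambda>f. \<Sum>b\<in>cx_basis G 0. f b * \<epsilon> b) ` cx_module V G 0 = I"
      "{f \<in> cx_module V G 0. (\<Sum>b\<in>cx_basis G 0. f b * \<epsilon> b) = 0} = cx_map G 0 ` cx_module V G 1"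
      "\<And>i. exact_at V G (Suc i)"
    using assms by (simp_all add: resolves_ideal_def)
  show "graded_complex V w (augment G \<epsilon>)"
    unfolding graded_complex_def
  proof (intro conjI allI)
    show "finite (cx_basis (augment G \<epsilon>) i)" for i
      using G(1) by (cases i) (simp_all add: graded_complex_def)
    show "\<forall>b\<in>cx_basis (augment G \<epsilon>) (Suc i). \<forall>c\<in>cx_basis (augment G \<epsilon>) i.
        cx_diff (augment G \<epsilon>) i b c \<in> polys V \<and> (\<forall>m\<in>keys (cx_diff (augment G \<epsilon>) i b c).
          w m + cx_deg (augment G \<epsilon>) i c = cx_deg (augment G \<epsilon>) (Suc i) b)" for i
      using G(1,2) by (cases i) (simp_all add: graded_complex_def)
  qed
  show "cx_basis (augment G \<epsilon>) 0 = {undefined}" "cx_deg (augment G \<epsilon>) 0 undefined = 0"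
    by simp_all
  show "(\<lambda>f. cx_map (augment G \<epsilon>) 0 f undefined) ` cx_module V (augment G \<epsilon>) 1 = I"
    using G(3) by (simp add: cx_map_augment_0 cx_module_augment)
  fix i :: nat assume "i \<ge> 1"
  then obtain j where i: "i = Suc j"
    by (cases i) auto
  show "exact_at V (augment G \<epsilon>) i"
  proof (cases j)
    case 0
    then show ?thesis
      using G(4) unfolding i 0 exact_at_Suc cx_module_augment cx_map_augment_Suc cx_map_augment_0
      by (simp add: fun_eq_iff)
  next
    case (Suc l)
    then show ?thesis
      using G(5)[of l] unfolding i Suc exact_at_Suc cx_module_augment cx_map_augment_Suc by simp
  qed
qed

definition truncate_complex ::
  "('b, 'g::comm_monoid_add, 'v, 'k::field) free_complex \<Rightarrow> ('b, 'g, 'v, 'k) free_complex" where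
  "truncate_complex C =
     \<lparr>cx_basis = (\<lambda>i. cx_basis C (Suc i)), cx_deg = (\<lambda>i. cx_deg C (Suc i)), cx_diff = (\<lambda>i. cx_diff C (Suc i))\<rparr>"

lemma truncate_sel [simp]:
  "cx_basis (truncate_complex C) i = cx_basis C (Suc i)"
  "cx_deg (truncate_complex C) i = cx_deg C (Suc i)"
  "cx_diff (truncate_complex C) i = cx_diff C (Suc i)"
  by (simp_all add: truncate_complex_def)

lemma truncate_resolution:
  fixes C :: "('b, 'g::comm_monoid_add, 'v, 'k::field) free_complex"
  assumes C: "graded_resolution V w I C"
  obtains \<epsilon> where "resolves_ideal V w I (truncate_complex C) \<epsilon>"
proof -
  obtain z where z: "cx_basis C 0 = {z}" "cx_deg C 0 z = 0" "(\<lambda>f. cx_map C 0 f z) ` cx_module V C 1 = I"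
    using C by (auto simp: graded_resolution_def)
  have g: "graded_complex V w C" and e: "\<And>i. exact_at V C (Suc i)"
    using C by (auto simp: graded_resolution_def)
  have mod: "cx_module V (truncate_complex C) i = cx_module V C (Suc i)" for i
    by (simp add: cx_module_def)
  have map: "cx_map (truncate_complex C) i = cx_map C (Suc i)" for i
    by (simp add: cx_map_def fun_eq_iff)
  have map0: "cx_map C 0 f = (\<lambda>c. if c = z then \<Sum>b\<in>cx_basis C (Suc 0). f b * cx_diff C 0 b z else 0)" for f
    using z(1) by (auto simp: cx_map_def fun_eq_iff)
  have delta_0: "(\<lambda>c. if c = z then p else 0) = 0 \<longleftrightarrow> p = 0" for p :: "('v, 'k) mpoly"
    by (auto simp: fun_eq_iff)
  have "resolves_ideal V w I (truncate_complex C) (\<lambda>b. cx_diff C 0 b z)"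
    unfolding resolves_ideal_def mod map
  proof (intro conjI allI impI ballI)
    show "graded_complex V w (truncate_complex C)"
      using g by (simp add: graded_complex_def)
    show "cx_diff C 0 b z \<in> polys V" "m \<in> keys (cx_diff C 0 b z) \<Longrightarrow> w m = cx_deg (truncate_complex C) 0 b"
      if "b \<in> cx_basis (truncate_complex C) 0" for b m
      using g that z(1,2) by (fastforce simp: graded_complex_def)+
    show "(\<lambda>f. \<Sum>b\<in>cx_basis (truncate_complex C) 0. f b * cx_diff C 0 b z) ` cx_module V C (Suc 0) = I"
      using z(3) by (simp add: map0)
    show "{f \<in> cx_module V C (Suc 0). (\<Sum>b\<in>cx_basis (truncate_complex C) 0. f b * cx_diff C 0 b z) = 0} =
        cx_map C (Suc 0) ` cx_module V C (Suc 1)"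
      using e[of 0] unfolding exact_at_Suc map0 by (simp add: delta_0)
    fix i :: nat assume "i \<ge> 1"
    then obtain j where i: "i = Suc j"
      by (cases i) auto
    show "exact_at V (truncate_complex C) i"
      using e[of "Suc j"] unfolding i exact_at_Suc mod map .
  qed
  then show thesis
    by (rule that)
qed

text \<open>
  Betti numbers refer to resolutions whose bases consist of natural numbers. Relabelling shows that a
  resolution with finite bases of any other type yields one of this kind.
\<close>

definition relabel ::
  "(nat \<Rightarrow> 'b \<Rightarrow> 'c) \<Rightarrow> ('b, 'g::comm_monoid_add, 'v, 'k::field) free_complex \<Rightarrow>
   ('c, 'g, 'v, 'k) free_complex" where
  "relabel e C =
     \<lparr>cx_basis = (\<lambda>i. e i ` cx_basis C i),
      cx_deg = (\<lambda>i n. cx_deg C i (inv_into (cx_basis C i) (e i) n)),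
      cx_diff = (\<lambda>i n n'. cx_diff C i (inv_into (cx_basis C (Suc i)) (e (Suc i)) n)
        (inv_into (cx_basis C i) (e i) n'))\<rparr>"

lemma relabel_resolution:
  fixes C :: "('b, 'g::comm_monoid_add, 'v, 'k::field) free_complex" and e :: "nat \<Rightarrow> 'b \<Rightarrow> 'c"
  assumes C: "graded_resolution V w I C" and e: "\<And>i. inj_on (e i) (cx_basis C i)"
  shows "graded_resolution V w I (relabel e C)"
proof -
  let ?D = "relabel e C"
  obtain z where z: "cx_basis C 0 = {z}" "cx_deg C 0 z = 0" "(\<lambda>f. cx_map C 0 f z) ` cx_module V C 1 = I"
    using C by (auto simp: graded_resolution_def)
  have g: "graded_complex V w C" and ex: "\<And>i. exact_at V C (Suc i)"
    using C by (auto simp: graded_resolution_def)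
  have basis: "cx_basis ?D i = e i ` cx_basis C i" for i
    by (simp add: relabel_def)
  have deg: "cx_deg ?D i (e i b) = cx_deg C i b" if "b \<in> cx_basis C i" for i b
    using that e by (simp add: relabel_def)
  have diff: "cx_diff ?D i (e (Suc i) b) (e i c) = cx_diff C i b c"
    if "b \<in> cx_basis C (Suc i)" "c \<in> cx_basis C i" for i b c
    using that e by (simp add: relabel_def)
  define push where "push = (\<lambda>i f n. if n \<in> e i ` cx_basis C i then f (inv_into (cx_basis C i) (e i) n) else 0 :: ('v, 'k) mpoly)"
  have push_e: "push i f (e i b) = f b" if "b \<in> cx_basis C i" for i f b
    using that e by (simp add: push_def)
  have modl: "cx_module V ?D i = push i ` cx_module V C i" for i
  proof
    show "push i ` cx_module V C i \<subseteq> cx_module V ?D i"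
      by (auto simp: cx_module_def push_def basis)
    show "cx_module V ?D i \<subseteq> push i ` cx_module V C i"
    proof
      fix f assume f: "f \<in> cx_module V ?D i"
      let ?f = "\<lambda>b. if b \<in> cx_basis C i then f (e i b) else 0"
      have "f = push i ?f"
        using f e by (auto simp: fun_eq_iff push_def cx_module_def basis inv_into_f_f)
      moreover have "?f \<in> cx_module V C i"
        using f by (simp add: cx_module_def)
      ultimately show "f \<in> push i ` cx_module V C i"
        by blast
    qed
  qed
  have mapl: "cx_map ?D i (push (Suc i) f) = push i (cx_map C i f)" for i f
  proof
    fix n
    show "cx_map ?D i (push (Suc i) f) n = push i (cx_map C i f) n"
    proof (cases "n \<in> e i ` cx_basis C i")
      case True
      then obtain c where c: "n = e i c" "c \<in> cx_basis C i"
        by blast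
      then have "cx_map ?D i (push (Suc i) f) n
          = (\<Sum>b\<in>cx_basis C (Suc i). push (Suc i) f (e (Suc i) b) * cx_diff ?D i (e (Suc i) b) (e i c))"
        using True by (simp add: cx_map_def basis sum.reindex[OF e])
      also have "\<dots> = (\<Sum>b\<in>cx_basis C (Suc i). f b * cx_diff C i b c)"
        using c by (intro sum.cong) (simp_all add: push_e diff)
      also have "\<dots> = push i (cx_map C i f) n"
        using c by (simp add: push_e) (simp add: cx_map_def)
      finally show ?thesis .
    qed (simp add: cx_map_def basis push_def)
  qed
  have push_0: "push i f = 0 \<longleftrightarrow> f = 0" if "f \<in> cx_module V C i" for i f
  proof
    assume *: "push i f = 0"
    show "f = 0"
    proof
      fix b show "f b = 0 b"
        using that push_e[of b i f] * by (cases "b \<in> cx_basis C i") (auto simp: cx_module_def)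
    qed
  qed (simp add: push_def fun_eq_iff)
  show ?thesis
    unfolding graded_resolution_def
  proof (intro conjI exI allI impI)
    show "graded_complex V w ?D"
      using g unfolding graded_complex_def basis by (auto simp: deg diff)
    show "cx_basis ?D 0 = {e 0 z}" "cx_deg ?D 0 (e 0 z) = 0"
      using z deg[of z 0] by (simp_all add: basis)
    show "(\<lambda>f. cx_map ?D 0 f (e 0 z)) ` cx_module V ?D 1 = I"
      using z push_e[of z 0] by (simp add: modl image_image mapl)
    fix i :: nat assume "i \<ge> 1"
    then obtain j where i: "i = Suc j"
      by (cases i) auto
    have "{f \<in> push i ` cx_module V C i. cx_map ?D j f = 0} = push i ` {f \<in> cx_module V C i. cx_map C j f = 0}"
    proof -
      have "cx_map ?D j (push i f) = 0 \<longleftrightarrow> cx_map C j f = 0" if "f \<in> cx_module V C i" for f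
        using push_0[OF cx_map_in_cx_module[OF g that[unfolded i]]] by (simp add: i mapl)
      then show ?thesis
        by blast
    qed
    then show "exact_at V ?D i"
      using ex[of j] unfolding i exact_at_Suc modl by (simp add: image_image mapl)
  qed
qed

text \<open>
  Relabelling the given resolution shows that the resolution chosen in the definition is really a
  resolution, after which the comparison applies.
\<close>

theorem graded_betti_minimal:
  fixes C :: "('b, 'g::comm_monoid_add, 'v, 'k::field) free_complex"
  assumes w: "additive_degree w" and C: "graded_resolution V w I C" "minimal_complex C"
  shows "graded_betti V w I i \<alpha> = card {b \<in> cx_basis C (Suc i). cx_deg C (Suc i) b = \<alpha>}"
proof -
  have g: "graded_complex V w C"
    using C(1) by (simp add: graded_resolution_def)
  have "\<exists>f :: 'b \<Rightarrow> nat. inj_on f (cx_basis C j)" for j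
    using g finite_imp_inj_to_nat_seg[of "cx_basis C j"] by (auto simp: graded_complex_def)
  then have e: "inj_on (SOME f :: 'b \<Rightarrow> nat. inj_on f (cx_basis C j)) (cx_basis C j)" for j
    by (rule someI_ex)
  define P where "P = (\<lambda>G :: (nat, 'g, 'v, 'k) free_complex. \<exists>\<epsilon>. resolves_ideal V w I G \<epsilon>)"
  define G where "G = (SOME G. P G)"
  obtain \<epsilon>' where "resolves_ideal V w I
      (truncate_complex (relabel (\<lambda>j. SOME f :: 'b \<Rightarrow> nat. inj_on f (cx_basis C j)) C)) \<epsilon>'"
    by (rule truncate_resolution[OF relabel_resolution[OF C(1) e]])
  then have "P G"
    unfolding G_def by (intro someI[of P]) (auto simp: P_def)
  then obtain \<epsilon> where G: "resolves_ideal V w I G \<epsilon>"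
    unfolding P_def by (rule exE)
  obtain z where z: "cx_basis C 0 = {z}" "(\<lambda>f. cx_map C 0 f z) ` cx_module V C 1 = I"
    using C(1) by (auto simp: graded_resolution_def)
  \<comment> \<open>The image of a minimal complex lies in the maximal ideal. This makes the reduced augmentation
    vanish, so that all elements in position 0 of the reduction are cycles.\<close>
  have const: "lookup p 0 = 0" if p: "p \<in> I" for p
  proof -
    obtain f where "p = cx_map C 0 f z"
      using p unfolding z(2)[symmetric] by (elim imageE)
    then show ?thesis
      using C(2) z(1) by (simp add: cx_map_def lookup_sum lookup_mult_0 minimal_complex_def)
  qed
  have \<epsilon>0: "lookup (\<epsilon> b) 0 = 0" if b: "b \<in> cx_basis G 0" for b
  proof (rule const)
    have fin: "finite (cx_basis G 0)"
      and I: "(\<lambda>f. \<Sum>b\<in>cx_basis G 0. f b * \<epsilon> b) ` cx_module V G 0 = I"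
      using G by (simp_all add: resolves_ideal_def graded_complex_def)
    have "\<epsilon> b = (\<Sum>b'\<in>cx_basis G 0. (if b' = b then 1 else 0) * \<epsilon> b')"
      using b fin by (simp add: if_distrib[of "\<lambda>x. x * _"] cong: if_cong)
    moreover have "(\<lambda>b'. if b' = b then 1 else 0) \<in> cx_module V G 0"
      using b by (auto simp: cx_module_def)
    ultimately show "\<epsilon> b \<in> I"
      unfolding I[symmetric] by (rule image_eqI)
  qed
  have "red_map (augment G \<epsilon>) 0 v = 0" for v
    by (simp add: red_map_def fun_eq_iff \<epsilon>0)
  then have "red_cycles G i \<alpha> = {v \<in> red_space (augment G \<epsilon>) (Suc i) \<alpha>. red_map (augment G \<epsilon>) i v = 0}"
    by (cases i) (simp_all add: red_cycles_def red_space_augment red_map_augment_Suc zero_fun_def)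
  moreover have "red_boundaries G i \<alpha>
      = red_map (augment G \<epsilon>) (Suc i) ` red_space (augment G \<epsilon>) (Suc (Suc i)) \<alpha>"
    by (simp add: red_boundaries_def red_space_augment red_map_augment_Suc)
  ultimately have "kdim (red_cycles G i \<alpha>)
      = kdim (red_boundaries G i \<alpha>) + card {b \<in> cx_basis C (Suc i). cx_deg C (Suc i) b = \<alpha>}"
    by (simp only: reduced_homology_of_resolution[OF w C augment_resolution[OF G]])
  then show ?thesis
    unfolding graded_betti_def red_homology_dim_def P_def[symmetric] G_def[symmetric] by simp
qed

text \<open>
  The same complex with the degrees of the basis elements transported along a coarser grading.
\<close>

definition regrade ::
  "('v mono \<Rightarrow> 'g) \<Rightarrow> ('b, 'v mono, 'v, 'k::field) free_complex \<Rightarrow> ('b, 'g, 'v, 'k) free_complex" where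
  "regrade w C = \<lparr>cx_basis = cx_basis C, cx_deg = (\<lambda>i b. w (cx_deg C i b)), cx_diff = cx_diff C\<rparr>"

lemma regrade_sel [simp]:
  "cx_basis (regrade w C) = cx_basis C"
  "cx_deg (regrade w C) i b = w (cx_deg C i b)"
  "cx_diff (regrade w C) = cx_diff C"
  by (simp_all add: regrade_def)

lemma graded_resolution_regrade:
  assumes w: "additive_degree w" and C: "graded_resolution V id I C"
  shows "graded_resolution V w I (regrade w C)"
proof -
  have [simp]: "cx_module V (regrade w C) i = cx_module V C i" for i
    by (simp add: cx_module_def)
  have [simp]: "cx_map (regrade w C) i = cx_map C i" for i
    by (simp add: cx_map_def fun_eq_iff)
  have [simp]: "exact_at V (regrade w C) i = exact_at V C i" for i
    by (simp add: exact_at_def)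
  have "w m + w n = w l" if "m + n = l" for m n l
    using w that by (auto simp: additive_degree_def)
  then have "graded_complex V w (regrade w C)" if "graded_complex V id C"
    using that by (auto simp: graded_complex_def)
  then show ?thesis
    using C w by (auto simp: graded_resolution_def additive_degree_def)
qed

lemma mono_deg_add: "mono_deg (m + n) = mono_deg m + mono_deg n"
  unfolding mono_deg_def by (rule setsum_keys_plus_distrib) auto

lemma additive_degree_mono_deg: "additive_degree mono_deg"
  by (simp add: additive_degree_def mono_deg_add) (simp add: mono_deg_def)

lemma additive_degree_id: "additive_degree id"
  by (simp add: additive_degree_def)

theorem fine_betti_minimal:
  assumes "resolves_quotient V I C" "minimal_complex C"
  shows "fine_betti V I i \<alpha> = card {b \<in> cx_basis C (Suc i). cx_deg C (Suc i) b = \<alpha>}"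
  unfolding fine_betti_def
  using graded_betti_minimal[OF additive_degree_id _ assms(2)] assms(1) resolves_quotient_iff by blast

theorem Z_betti_minimal:
  assumes "resolves_quotient V I C" "minimal_complex C"
  shows "Z_betti V I i j = card {b \<in> cx_basis C (Suc i). mono_deg (cx_deg C (Suc i) b) = j}"
proof -
  have "graded_resolution V mono_deg I (regrade mono_deg C)"
    using graded_resolution_regrade[OF additive_degree_mono_deg] assms(1) resolves_quotient_iff by blast
  moreover have "minimal_complex (regrade mono_deg C)"
    using assms(2) by (simp add: minimal_complex_def)
  ultimately show ?thesis
    unfolding Z_betti_def by (simp add: graded_betti_minimal[OF additive_degree_mono_deg])
qed

section \<open>Boxes and their supports\<close>

text \<open>
  The box with factors \<open>{x. (j, x) \<in> U}\<close>. Describing a box by the set of its pairs (part, vertex) makes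
  passing to a face the removal of elements of \<open>U\<close>, and dimensions become cardinalities.
\<close>

definition product_box :: "nat \<Rightarrow> (nat \<times> 'a) set \<Rightarrow> 'a list set" where
  "product_box d U = {x. length x = d \<and> (\<forall>j<d. (j, x ! j) \<in> U)}"

text \<open>
  The sets \<open>U\<close> that describe nonempty boxes with \<open>d\<close> factors.
\<close>

definition transversal :: "nat \<Rightarrow> (nat \<times> 'a) set \<Rightarrow> bool" where
  "transversal d U \<longleftrightarrow> U \<subseteq> {..<d} \<times> UNIV \<and> (\<forall>j<d. \<exists>x. (j, x) \<in> U)"

definition box_support :: "'a set list \<Rightarrow> (nat \<times> 'a) set" where
  "box_support Xs = {(j, x). j < length Xs \<and> x \<in> Xs ! j}"

lemma mem_listset: "x \<in> listset Xs \<longleftrightarrow> length x = length Xs \<and> (\<forall>j<length Xs. x ! j \<in> Xs ! j)"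
proof -
  have "x \<in> listset Xs \<longleftrightarrow> list_all2 (\<in>) x Xs"
    by (induction Xs arbitrary: x) (auto simp: set_Cons_def list_all2_Cons2)
  then show ?thesis
    by (auto simp: list_all2_conv_all_nth)
qed

lemma listset_product_box: "listset Xs = product_box (length Xs) (box_support Xs)"
  by (auto simp: mem_listset product_box_def box_support_def)

lemma bij_betw_box_support:
  "bij_betw box_support (boxes d H) {U. transversal d U \<and> product_box d U \<subseteq> H}"
proof (rule bij_betwI[where g = "\<lambda>U. map (\<lambda>j. {x. (j, x) \<in> U}) [0..<d]"])
  show "box_support \<in> boxes d H \<rightarrow> {U. transversal d U \<and> product_box d U \<subseteq> H}"
    by (auto simp: boxes_def listset_product_box transversal_def box_support_def all_set_conv_all_nth)
  have *: "box_support (map (\<lambda>j. {x. (j, x) \<in> U}) [0..<d]) = U" if "transversal d U" for U :: "(nat \<times> 'a) set"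
    using that by (auto simp: box_support_def transversal_def)
  then show "box_support (map (\<lambda>j. {x. (j, x) \<in> U}) [0..<d]) = U"
    if "U \<in> {U. transversal d U \<and> product_box d U \<subseteq> H}" for U
    using that by blast
  show "(\<lambda>U. map (\<lambda>j. {x. (j, x) \<in> U}) [0..<d]) \<in> {U. transversal d U \<and> product_box d U \<subseteq> H} \<rightarrow> boxes d H"
    using * by (auto simp: boxes_def listset_product_box transversal_def)
  show "map (\<lambda>j. {x. (j, x) \<in> box_support Xs}) [0..<d] = Xs" if "Xs \<in> boxes d H" for Xs
    using that by (auto simp: boxes_def box_support_def intro!: nth_equalityI)
qed

lemma cells_box_complex:
  "cells (box_complex d H) = insert {} (product_box d ` {U. transversal d U \<and> product_box d U \<subseteq> H})"
proof -
  have "listset ` boxes d H = product_box d ` box_support ` boxes d H"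
    unfolding image_image by (rule image_cong) (auto simp: listset_product_box boxes_def)
  then show ?thesis
    using bij_betw_box_support[of d H] by (simp add: box_complex_def bij_betw_def)
qed

lemma transversal_point:
  assumes "transversal d U" "(j, v) \<in> U"
  obtains x where "x \<in> product_box d U" "x ! j = v"
proof
  let ?x = "map (\<lambda>i. if i = j then v else SOME y. (i, y) \<in> U) [0..<d]"
  have "(i, SOME y. (i, y) \<in> U) \<in> U" if "i < d" for i
    using assms that someI_ex[of "\<lambda>y. (i, y) \<in> U"] by (auto simp: transversal_def)
  then show "?x \<in> product_box d U"
    using assms by (auto simp: product_box_def)
  show "?x ! j = v"
    using assms by (auto simp: transversal_def)
qed

text \<open>
  A nonempty box determines its support, because each element of a factor is a coordinate of some vertex.
\<close>

lemma hyperedge_vertices_product_box [simp]: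
  assumes "transversal d U"
  shows "hyperedge_vertices (product_box d U) = U"
proof
  show "hyperedge_vertices (product_box d U) \<subseteq> U"
    by (auto simp: hyperedge_vertices_def product_box_def)
  show "U \<subseteq> hyperedge_vertices (product_box d U)"
  proof clarify
    fix j v assume u: "(j, v) \<in> U"
    obtain x where "x \<in> product_box d U" "x ! j = v"
      by (rule transversal_point[OF assms u])
    moreover have "j < d"
      using assms u by (auto simp: transversal_def)
    ultimately show "(j, v) \<in> hyperedge_vertices (product_box d U)"
      unfolding hyperedge_vertices_def product_box_def by blast
  qed
qed

lemma hyperedge_vertices_mono: "P \<subseteq> Q \<Longrightarrow> hyperedge_vertices P \<subseteq> hyperedge_vertices Q"
  by (auto simp: hyperedge_vertices_def)

lemma product_box_mono: "U \<subseteq> W \<Longrightarrow> product_box d U \<subseteq> product_box d W"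
  by (auto simp: product_box_def)

lemma product_box_subset_iff:
  "transversal d U \<Longrightarrow> transversal d W \<Longrightarrow> product_box d U \<subseteq> product_box d W \<longleftrightarrow> U \<subseteq> W"
  by (metis hyperedge_vertices_mono hyperedge_vertices_product_box product_box_mono)

lemma product_box_psubset_iff:
  "transversal d U \<Longrightarrow> transversal d W \<Longrightarrow> product_box d U \<subset> product_box d W \<longleftrightarrow> U \<subset> W"
  by (simp add: psubset_eq product_box_subset_iff) (metis hyperedge_vertices_product_box)

lemma product_box_nonempty: "transversal d U \<Longrightarrow> product_box d U \<noteq> {}"
proof -
  assume U: "transversal d U"
  then have "map (\<lambda>i. SOME y. (i, y) \<in> U) [0..<d] \<in> product_box d U"
    using someI_ex[of "\<lambda>y. (i, y) \<in> U" for i] by (auto simp: transversal_def product_box_def)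
  then show ?thesis
    by blast
qed

lemma product_box_in_cells:
  "transversal d U \<Longrightarrow> product_box d U \<subseteq> H \<Longrightarrow> product_box d U \<in> cells (box_complex d H)"
  by (auto simp: cells_box_complex)

lemma empty_in_cells [simp]: "{} \<in> cells (box_complex d H)"
  by (simp add: box_complex_def)

lemma nonempty_cell:
  assumes "P \<in> cells (box_complex d H)" "P \<noteq> {}"
  shows "transversal d (hyperedge_vertices P)" "product_box d (hyperedge_vertices P) = P" "P \<subseteq> H"
proof -
  obtain U where U: "P = product_box d U" "transversal d U" "product_box d U \<subseteq> H"
    using assms unfolding cells_box_complex by auto
  then show "transversal d (hyperedge_vertices P)" "product_box d (hyperedge_vertices P) = P" "P \<subseteq> H"
    by simp_all
qed

lemma cell_subset: "P \<in> cells (box_complex d H) \<Longrightarrow> P \<subseteq> H"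
  using nonempty_cell(3) by blast

lemma cell_mono: "P \<in> cells (box_complex d H) \<Longrightarrow> P \<subseteq> H' \<Longrightarrow> P \<in> cells (box_complex d H')"
  unfolding cells_box_complex by auto

lemma finite_hyperedge_vertices: "finite H \<Longrightarrow> finite (hyperedge_vertices H)"
proof -
  assume "finite H"
  moreover have "hyperedge_vertices H = (\<Union>x\<in>H. (\<lambda>j. (j, x ! j)) ` {..<length x})"
    by (auto simp: hyperedge_vertices_def)
  ultimately show ?thesis
    by simp
qed

lemma finite_cells: "finite H \<Longrightarrow> finite (cells (box_complex d H))"
  using cell_subset by (intro finite_subset[of "cells (box_complex d H)" "Pow H"]) auto

lemma finite_cell_vertices:
  "finite H \<Longrightarrow> P \<in> cells (box_complex d H) \<Longrightarrow> finite (hyperedge_vertices P)"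
  by (rule finite_hyperedge_vertices[OF finite_subset[OF cell_subset]])

lemma cell_dim_empty [simp]: "cell_dim (box_complex d H) {} = -1"
  by (simp add: box_complex_def)

lemma finite_part: "finite U \<Longrightarrow> finite {x. (j, x) \<in> U}"
  by (rule finite_subset[of _ "snd ` U"]) (auto simp: image_iff Bex_def)

lemma card_transversal:
  assumes "transversal d U" "finite U"
  shows "card U = (\<Sum>j<d. card {x. (j, x) \<in> U})"
proof -
  have "card U = card (Sigma {..<d} (\<lambda>j. {x. (j, x) \<in> U}))"
    using assms(1) by (intro arg_cong[of _ _ card]) (auto simp: transversal_def)
  also have "\<dots> = (\<Sum>j<d. card {x. (j, x) \<in> U})"
    by (rule card_SigmaI) (simp_all add: finite_part[OF assms(2)])
  finally show ?thesis .
qed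

lemma cell_dim_product_box:
  assumes "transversal d U" "finite U"
  shows "cell_dim (box_complex d H) (product_box d U) = int (card U) - int d"
proof -
  have "(\<lambda>x. x ! j) ` product_box d U = {x. (j, x) \<in> U}" if "j < d" for j
  proof
    show "(\<lambda>x. x ! j) ` product_box d U \<subseteq> {x. (j, x) \<in> U}"
      using that by (auto simp: product_box_def)
    show "{x. (j, x) \<in> U} \<subseteq> (\<lambda>x. x ! j) ` product_box d U"
    proof
      fix v assume "v \<in> {x. (j, x) \<in> U}"
      then have "(j, v) \<in> U"
        by simp
      from transversal_point[OF assms(1) this] show "v \<in> (\<lambda>x. x ! j) ` product_box d U"
        by blast
    qed
  qed
  then have "cell_dim (box_complex d H) (product_box d U) = (\<Sum>j<d. int (card {x. (j, x) \<in> U}) - 1)"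
    using product_box_nonempty[OF assms(1)] by (simp add: box_complex_def)
  also have "\<dots> = int (card U) - int d"
    unfolding card_transversal[OF assms] by (simp add: sum_subtractf)
  finally show ?thesis .
qed

lemma cell_dim_nonempty:
  assumes "finite H" "P \<in> cells (box_complex d H)" "P \<noteq> {}"
  shows "cell_dim (box_complex d H) P = int (card (hyperedge_vertices P)) - int d"
  using cell_dim_product_box[OF nonempty_cell(1)[OF assms(2,3)] finite_cell_vertices[OF assms(1,2)]]
  by (simp add: nonempty_cell(2)[OF assms(2,3)])

lemma card_transversal_ge:
  assumes "transversal d U" "finite U"
  shows "card U \<ge> d"
proof -
  have "card {x. (j, x) \<in> U} \<ge> 1" if "j < d" for j
    using assms(1) that finite_part[OF assms(2)] by (auto simp: transversal_def Suc_le_eq card_gt_0_iff)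
  then have "(\<Sum>j<d. card {x. (j, x) \<in> U}) \<ge> (\<Sum>j<d. 1)"
    by (intro sum_mono) simp
  then show ?thesis
    by (simp add: card_transversal[OF assms])
qed

lemma cell_dim_eq_minus1_iff:
  assumes "finite H" "P \<in> cells (box_complex d H)"
  shows "cell_dim (box_complex d H) P = -1 \<longleftrightarrow> P = {}" "P \<noteq> {} \<Longrightarrow> cell_dim (box_complex d H) P \<ge> 0"
  using cell_dim_nonempty[OF assms]
    card_transversal_ge[OF nonempty_cell(1)[OF assms(2)] finite_cell_vertices[OF assms]]
  by (cases "P = {}"; simp)+

lemma psubset_cell_iff:
  assumes "P \<in> cells (box_complex d H)" "Q \<in> cells (box_complex d H)" "P \<noteq> {}" "Q \<noteq> {}"
  shows "Q \<subset> P \<longleftrightarrow> hyperedge_vertices Q \<subset> hyperedge_vertices P"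
  using product_box_psubset_iff[OF nonempty_cell(1)[OF assms(2,4)] nonempty_cell(1)[OF assms(1,3)]]
  by (simp add: nonempty_cell(2)[OF assms(2,4)] nonempty_cell(2)[OF assms(1,3)])

lemma cell_dim_strict_mono:
  assumes H: "finite H" and "P \<in> cells (box_complex d H)" "Q \<in> cells (box_complex d H)" "Q \<subset> P"
  shows "cell_dim (box_complex d H) Q < cell_dim (box_complex d H) P"
proof (cases "Q = {}")
  case True
  then show ?thesis
    using cell_dim_eq_minus1_iff(2)[OF H assms(2)] assms(4) by force
next
  case False
  then have P: "P \<noteq> {}"
    using assms(4) by auto
  have "hyperedge_vertices Q \<subset> hyperedge_vertices P"
    using psubset_cell_iff[OF assms(2,3) P False] assms(4) by simp
  then have "card (hyperedge_vertices Q) < card (hyperedge_vertices P)"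
    using finite_cell_vertices[OF H assms(2)] by (rule psubset_card_mono[rotated])
  then show ?thesis
    by (simp add: cell_dim_nonempty[OF H assms(2) P] cell_dim_nonempty[OF H assms(3) False])
qed

section \<open>Acyclicity of complexes of boxes with a cone point\<close>

definition chain_boundary ::
  "'p cell_complex \<Rightarrow> ('p set \<Rightarrow> 'p set \<Rightarrow> int) \<Rightarrow> int \<Rightarrow> ('p set \<Rightarrow> 'k::field) \<Rightarrow> 'p set \<Rightarrow> 'k" where
  "chain_boundary X sg n c Q =
     (\<Sum>P\<in>{P \<in> cells X. cell_dim X P = n}. if Q \<subset> P then of_int (sg P Q) * c P else 0)"

lemma chain_boundary_diff:
  "chain_boundary X sg n (\<lambda>P. c P - c' P) Q = chain_boundary X sg n c Q - chain_boundary X sg n c' Q"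
  unfolding chain_boundary_def sum_subtractf[symmetric]
  by (rule sum.cong) (auto simp: algebra_simps)

lemma chain_boundary_add:
  "chain_boundary X sg n (\<lambda>P. c P + c' P) Q = chain_boundary X sg n c Q + chain_boundary X sg n c' Q"
  unfolding chain_boundary_def sum.distrib[symmetric]
  by (rule sum.cong) (auto simp: algebra_simps)

text \<open>
  Cells strictly between \<open>R\<close> and \<open>P\<close> automatically have the intermediate dimension, so the inner sums are
  exactly those that an incidence function makes zero.
\<close>

lemma chain_boundary_boundary:
  fixes c :: "'a list set \<Rightarrow> 'k::field"
  assumes H: "finite H" and sg: "incidence_function (box_complex d H) sg"
    and R: "R \<in> cells (box_complex d H)" "cell_dim (box_complex d H) R = n - 1"
  shows "chain_boundary (box_complex d H) sg n (chain_boundary (box_complex d H) sg (n + 1) c) R = 0"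
proof -
  let ?X = "box_complex d H"
  let ?Y = "\<lambda>n. {P \<in> cells ?X. cell_dim ?X P = n}"
  have "chain_boundary ?X sg n (chain_boundary ?X sg (n + 1) c) R
      = (\<Sum>Q\<in>?Y n. \<Sum>P\<in>?Y (n + 1). if R \<subset> Q \<and> Q \<subset> P then of_int (sg P Q * sg Q R) * c P else 0)"
    unfolding chain_boundary_def by (intro sum.cong) (auto simp: sum_distrib_left intro!: sum.cong)
  also have "\<dots> = (\<Sum>P\<in>?Y (n + 1). \<Sum>Q\<in>?Y n. if R \<subset> Q \<and> Q \<subset> P then of_int (sg P Q * sg Q R) * c P else 0)"
    by (rule sum.swap)
  also have "\<dots> = 0"
  proof (rule sum.neutral, rule ballI)
    fix P assume P: "P \<in> ?Y (n + 1)"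
    have fin: "finite (?Y n)"
      using finite_cells[OF H] by simp
    have "(\<Sum>Q\<in>?Y n. if R \<subset> Q \<and> Q \<subset> P then of_int (sg P Q * sg Q R) * c P else 0)
        = (\<Sum>Q\<in>?Y n \<inter> {Q. R \<subset> Q \<and> Q \<subset> P}. of_int (sg P Q * sg Q R) * c P)"
      using fin by (simp add: sum.If_cases)
    also have "?Y n \<inter> {Q. R \<subset> Q \<and> Q \<subset> P} = {Q \<in> cells ?X. R \<subset> Q \<and> Q \<subset> P}"
    proof
      show "{Q \<in> cells ?X. R \<subset> Q \<and> Q \<subset> P} \<subseteq> ?Y n \<inter> {Q. R \<subset> Q \<and> Q \<subset> P}"
      proof
        fix Q assume Q: "Q \<in> {Q \<in> cells ?X. R \<subset> Q \<and> Q \<subset> P}"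
        then have Q': "Q \<in> cells ?X" "R \<subset> Q" "Q \<subset> P" and P': "P \<in> cells ?X"
          using P by auto
        have "cell_dim ?X R < cell_dim ?X Q" "cell_dim ?X Q < cell_dim ?X P"
          by (rule cell_dim_strict_mono[OF H]; fact)+
        then show "Q \<in> ?Y n \<inter> {Q. R \<subset> Q \<and> Q \<subset> P}"
          using Q R(2) P by auto
      qed
    qed auto
    also have "(\<Sum>Q\<in>{Q \<in> cells ?X. R \<subset> Q \<and> Q \<subset> P}. of_int (sg P Q * sg Q R) * c P)
        = of_int (\<Sum>Q\<in>{Q \<in> cells ?X. R \<subset> Q \<and> Q \<subset> P}. sg P Q * sg Q R) * c P"
      by (simp add: sum_distrib_right)
    also have "\<dots> = 0"
    proof (cases "R \<subset> P")
      case True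
      then have "(\<Sum>Q\<in>{Q \<in> cells ?X. R \<subset> Q \<and> Q \<subset> P}. sg P Q * sg Q R) = 0"
        using sg R P unfolding incidence_function_def by auto
      then show ?thesis
        by simp
    next
      case False
      then have "{Q \<in> cells ?X. R \<subset> Q \<and> Q \<subset> P} = {}"
        by (auto dest: psubset_trans)
      then show ?thesis
        by (simp only: sum.empty of_int_0 mult_zero_left)
    qed
    finally show "(\<Sum>Q\<in>?Y n. if R \<subset> Q \<and> Q \<subset> P then of_int (sg P Q * sg Q R) * c P else 0) = 0" .
  qed
  finally show ?thesis .
qed

text \<open>
  The coordinates of \<open>a\<close> can be substituted from left to right. The restriction to edges that already agree
  with \<open>a\<close> on the left is essential: in a hypergraph of increasing sequences, replacing an isolated
  coordinate may destroy monotonicity.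
\<close>

definition cone_point :: "nat \<Rightarrow> 'a list set \<Rightarrow> 'a list \<Rightarrow> bool" where
  "cone_point d H a \<longleftrightarrow> a \<in> H \<and> length a = d \<and>
     (\<forall>x\<in>H. \<forall>j<d. (\<forall>i<j. x ! i = a ! i) \<longrightarrow> x[j := a ! j] \<in> H)"

lemma transversal_if_product_box_nonempty:
  "U \<subseteq> {..<d} \<times> UNIV \<Longrightarrow> product_box d U \<noteq> {} \<Longrightarrow> transversal d U"
  by (auto simp: transversal_def product_box_def)

lemma chain_boundary_zero: "chain_boundary X sg n (\<lambda>_. 0) Q = 0"
  unfolding chain_boundary_def by (intro sum.neutral) simp

text \<open>
  A coface of codimension one is determined by any vertex that it adds.
\<close>

lemma coface_by_vertex:
  assumes H: "finite H" and R: "R \<in> cells (box_complex d H)" "R \<noteq> {}"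
    and P: "P \<in> cells (box_complex d H)" "R \<subset> P"
    and dim: "cell_dim (box_complex d H) P = cell_dim (box_complex d H) R + 1"
    and u: "u \<in> hyperedge_vertices P" "u \<notin> hyperedge_vertices R"
  shows "P = product_box d (insert u (hyperedge_vertices R))"
    and "R = product_box d (hyperedge_vertices P - {u})"
proof -
  have P0: "P \<noteq> {}"
    using R(2) P(2) by auto
  have sub: "insert u (hyperedge_vertices R) \<subseteq> hyperedge_vertices P"
    using psubset_cell_iff[OF P(1) R(1) P0 R(2)] P(2) u(1) by auto
  have fin: "finite (hyperedge_vertices P)"
    by (rule finite_cell_vertices[OF H P(1)])
  have finR: "finite (hyperedge_vertices R)"
    by (rule finite_cell_vertices[OF H R(1)])
  have "card (hyperedge_vertices P) = card (insert u (hyperedge_vertices R))"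
    using dim finR u(2) by (simp add: cell_dim_nonempty[OF H P(1) P0] cell_dim_nonempty[OF H R])
  then have eq: "insert u (hyperedge_vertices R) = hyperedge_vertices P"
    using card_subset_eq[OF fin sub] by simp
  then have "hyperedge_vertices R = hyperedge_vertices P - {u}"
    using u(2) by auto
  then show "P = product_box d (insert u (hyperedge_vertices R))"
      "R = product_box d (hyperedge_vertices P - {u})"
    using nonempty_cell(2)[OF P(1) P0] nonempty_cell(2)[OF R] eq by simp_all
qed

text \<open>
  A vertex of the enlarged box either lies in the old box or arises from one of its vertices by a
  substitution that the cone point allows.
\<close>

lemma cone_extends_cell:
  assumes a: "cone_point d H a" and t: "t < d"
    and P: "P \<in> cells (box_complex d H)" "P \<noteq> {}" and fixed: "\<forall>x\<in>P. \<forall>i<t. x ! i = a ! i"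
  shows "transversal d (insert (t, a ! t) (hyperedge_vertices P))"
    and "product_box d (insert (t, a ! t) (hyperedge_vertices P)) \<subseteq> H"
proof -
  note tr = nonempty_cell(1)[OF P]
  show "transversal d (insert (t, a ! t) (hyperedge_vertices P))"
    using tr t by (auto simp: transversal_def)
  show "product_box d (insert (t, a ! t) (hyperedge_vertices P)) \<subseteq> H"
  proof
    fix x assume x: "x \<in> product_box d (insert (t, a ! t) (hyperedge_vertices P))"
    obtain v where v: "(t, v) \<in> hyperedge_vertices P"
      using tr t by (auto simp: transversal_def)
    have "x[t := v] \<in> product_box d (hyperedge_vertices P)"
      using x v t unfolding product_box_def by (auto simp: nth_list_update)
    then have x': "x[t := v] \<in> P"
      by (simp add: nonempty_cell(2)[OF P])
    show "x \<in> H"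
    proof (cases "(t, x ! t) \<in> hyperedge_vertices P")
      case True
      then have "x \<in> product_box d (hyperedge_vertices P)"
        using x by (auto simp: product_box_def)
      then show ?thesis
        using nonempty_cell(2,3)[OF P] by auto
    next
      case False
      then have "x ! t = a ! t"
        using x t by (auto simp: product_box_def)
      then have "(x[t := v])[t := a ! t] = x"
        by (metis list_update_id list_update_overwrite)
      moreover have "(x[t := v])[t := a ! t] \<in> H"
        using a x' fixed t nonempty_cell(3)[OF P] unfolding cone_point_def by blast
      ultimately show ?thesis
        by simp
    qed
  qed
qed

text \<open>
  One coordinate of the deformation: a cycle supported on boxes whose factors before \<open>t\<close> are \<open>{a\<^sub>i}\<close> is
  homologous to one for which the factor \<open>t\<close> is \<open>{a\<^sub>t}\<close> too.
\<close>

lemma cone_step: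
  fixes c :: "'a list set \<Rightarrow> 'k::field"
  assumes H: "finite H" "H' \<subseteq> H" and sg: "incidence_function (box_complex d H) sg"
    and a: "cone_point d H' a" and n: "n \<ge> 0" and t: "t < d"
    and supp: "\<And>P. c P \<noteq> 0 \<Longrightarrow> P \<in> cells (box_complex d H') \<and> cell_dim (box_complex d H) P = n \<and>
        (\<forall>x\<in>P. \<forall>i<t. x ! i = a ! i)"
    and cyc: "\<And>R. R \<in> cells (box_complex d H) \<Longrightarrow> cell_dim (box_complex d H) R = n - 1 \<Longrightarrow>
        chain_boundary (box_complex d H) sg n c R = 0"
  shows "\<exists>c'. (\<forall>P. c' P \<noteq> 0 \<longrightarrow> P \<in> cells (box_complex d H') \<and> cell_dim (box_complex d H) P = n + 1) \<and>
    (\<forall>P\<in>cells (box_complex d H). cell_dim (box_complex d H) P = n \<longrightarrow>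
       c P - chain_boundary (box_complex d H) sg (n + 1) c' P \<noteq> 0 \<longrightarrow>
       P \<in> cells (box_complex d H') \<and> (\<forall>x\<in>P. \<forall>i<Suc t. x ! i = a ! i))"
proof -
  let ?X = "box_complex d H" and ?X' = "box_complex d H'" and ?V = hyperedge_vertices
  let ?u = "(t, a ! t)"
  define del where "del = (\<lambda>P. product_box d (?V P - {?u}))"
  \<comment> \<open>Each box without the element \<open>a\<^sub>t\<close> is filled by the box with \<open>a\<^sub>t\<close> added; the sign makes its
    contribution to the boundary equal to the original coefficient.\<close>
  define c' where "c' = (\<lambda>P. if P \<in> cells ?X' \<and> P \<noteq> {} \<and> cell_dim ?X P = n + 1 \<and> ?u \<in> ?V P
    then of_int (sg P (del P)) * c (del P) else 0)"
  define e where "e = (\<lambda>P. c P - chain_boundary ?X sg (n + 1) c' P)"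
  have XX: "P \<in> cells ?X" if "P \<in> cells ?X'" for P
    using cell_mono[OF that] cell_subset[OF that] H(2) by blast
  have ne: "P \<noteq> {}" if "cell_dim ?X P = n" for P
    using that n by auto
  have c'_nz: "P \<in> cells ?X'" "P \<noteq> {}" "cell_dim ?X P = n + 1" "?u \<in> ?V P" "c (del P) \<noteq> 0" if "c' P \<noteq> 0" for P
    using that by (auto simp: c'_def split: if_splits)
  have sg_sq: "(of_int (sg P Q) :: 'k) * of_int (sg P Q) = 1" "(of_int (sg P Q) :: 'k) \<noteq> 0"
    if "P \<in> cells ?X" "Q \<in> cells ?X" "Q \<subset> P" "cell_dim ?X P = cell_dim ?X Q + 1" for P Q
  proof -
    have "sg P Q \<in> {1, -1}"
      using sg that unfolding incidence_function_def by blast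
    then show "(of_int (sg P Q) :: 'k) * of_int (sg P Q) = 1" "(of_int (sg P Q) :: 'k) \<noteq> 0"
      by auto
  qed
  have finY: "finite {P \<in> cells ?X. cell_dim ?X P = m}" for m
    using finite_cells[OF H(1)] by simp
  have coface: "P = product_box d (insert ?u (?V R))" "R = del P"
    if "R \<in> cells ?X" "R \<noteq> {}" "P \<in> cells ?X" "R \<subset> P" "cell_dim ?X P = cell_dim ?X R + 1"
      "?u \<in> ?V P" "?u \<notin> ?V R" for P R
    using coface_by_vertex[OF H(1) that] unfolding del_def .
  \<comment> \<open>Among the boxes in the support of the filling, the only coface of a box \<open>Q\<close> without \<open>a\<^sub>t\<close> is \<open>Q\<close>
    with \<open>a\<^sub>t\<close> added, so \<open>Q\<close> cancels.\<close>
  have b: "chain_boundary ?X sg (n + 1) c' Q = c Q"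
    if Q: "Q \<in> cells ?X" "cell_dim ?X Q = n" "?u \<notin> ?V Q" for Q
  proof -
    note Q0 = ne[OF Q(2)]
    let ?P = "product_box d (insert ?u (?V Q))"
    have nz: "P = ?P \<and> del P = Q" if "P \<in> cells ?X" "Q \<subset> P" "c' P \<noteq> 0" for P
      using coface[OF Q(1) Q0 that(1,2) _ c'_nz(4)[OF that(3)] Q(3)] c'_nz(3)[OF that(3)] Q(2) by simp
    show ?thesis
    proof (cases "c Q = 0")
      case True
      have "(if Q \<subset> P then of_int (sg P Q) * c' P else 0) = 0" if "P \<in> cells ?X" for P
      proof (cases "Q \<subset> P \<and> c' P \<noteq> 0")
        case *: True
        have "c (del P) \<noteq> 0" "del P = Q"
          using c'_nz(5)[of P] nz[OF that] * by blast+
        then show ?thesis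
          using True by simp
      qed auto
      then show ?thesis
        using True by (simp add: chain_boundary_def)
    next
      case False
      have Q': "Q \<in> cells ?X'" and fixed: "\<forall>x\<in>Q. \<forall>i<t. x ! i = a ! i"
        using supp[OF False] by auto
      note ext = cone_extends_cell[OF a t Q' Q0 fixed]
      have P': "?P \<in> cells ?X'"
        by (rule product_box_in_cells[OF ext])
      have VP: "?V ?P = insert ?u (?V Q)"
        using ext(1) by simp
      have P0: "?P \<noteq> {}"
        by (rule product_box_nonempty[OF ext(1)])
      have dimP: "cell_dim ?X ?P = n + 1"
        using Q(2,3) finite_cell_vertices[OF H(1) Q(1)]
        by (simp add: cell_dim_nonempty[OF H(1) XX[OF P'] P0] cell_dim_nonempty[OF H(1) Q(1) Q0] VP)
      have QP: "Q \<subset> ?P"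
        unfolding psubset_cell_iff[OF XX[OF P'] Q(1) P0 Q0] VP using Q(3) by auto
      have "del ?P = Q"
        using coface(2)[OF Q(1) Q0 XX[OF P'] QP] dimP Q(2,3) VP by simp
      then have c'P: "c' ?P = of_int (sg ?P Q) * c Q"
        using P' P0 dimP VP by (simp add: c'_def)
      have "chain_boundary ?X sg (n + 1) c' Q = (\<Sum>P\<in>{?P}. if Q \<subset> P then of_int (sg P Q) * c' P else 0)"
        unfolding chain_boundary_def
      proof (rule sum.mono_neutral_right[OF finY])
        show "{?P} \<subseteq> {P \<in> cells ?X. cell_dim ?X P = n + 1}"
          using XX[OF P'] dimP by simp
        show "\<forall>P\<in>{P \<in> cells ?X. cell_dim ?X P = n + 1} - {?P}.
            (if Q \<subset> P then of_int (sg P Q) * c' P else 0) = 0"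
          using nz by auto
      qed
      also have "\<dots> = (of_int (sg ?P Q) * of_int (sg ?P Q)) * c Q"
        using QP by (simp add: c'P)
      also have "\<dots> = c Q"
        using sg_sq(1)[OF XX[OF P'] Q(1) QP] dimP Q(2) by simp
      finally show ?thesis .
    qed
  qed
  have a': "Q \<in> cells ?X' \<and> (\<forall>x\<in>Q. \<forall>i<t. x ! i = a ! i)"
    if Q: "Q \<in> cells ?X" "cell_dim ?X Q = n" "e Q \<noteq> 0" for Q
  proof (cases "c Q = 0")
    case False
    then show ?thesis
      using supp[OF False] by simp
  next
    case True
    then have "chain_boundary ?X sg (n + 1) c' Q \<noteq> 0"
      using Q(3) by (simp add: e_def)
    have "\<exists>P. Q \<subset> P \<and> c' P \<noteq> 0"
    proof (rule ccontr)
      assume "\<not> ?thesis"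
      then have "chain_boundary ?X sg (n + 1) c' Q = 0"
        unfolding chain_boundary_def by (intro sum.neutral) auto
      with \<open>chain_boundary ?X sg (n + 1) c' Q \<noteq> 0\<close> show False
        by simp
    qed
    then obtain P where P: "Q \<subset> P" "c' P \<noteq> 0"
      by blast
    note P' = c'_nz[OF P(2)]
    note D = supp[OF P'(5)]
    have D0: "del P \<noteq> {}"
      using D by (intro ne) simp
    have "?V P - {?u} \<subseteq> {..<d} \<times> UNIV"
      using nonempty_cell(1)[OF P'(1,2)] by (auto simp: transversal_def)
    then have VD: "transversal d (?V P - {?u})"
      using D0 unfolding del_def by (rule transversal_if_product_box_nonempty)
    have "x ! i = a ! i" if x: "x \<in> Q" and i: "i < t" for x i
    proof -
      have "x \<in> product_box d (?V P)"
        using x P(1) nonempty_cell(2)[OF P'(1,2)] by auto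
      then have "(i, x ! i) \<in> ?V P - {?u}"
        using i t by (auto simp: product_box_def)
      from transversal_point[OF VD this]
      obtain y where y: "y \<in> del P" "y ! i = x ! i"
        unfolding del_def .
      have "\<forall>x\<in>del P. \<forall>i<t. x ! i = a ! i"
        using D by simp
      then show ?thesis
        using i y by force
    qed
    moreover have "Q \<subseteq> H'"
      using cell_subset[OF P'(1)] P(1) by auto
    then have "Q \<in> cells ?X'"
      by (rule cell_mono[OF Q(1)])
    ultimately show ?thesis
      by simp
  qed
  have e_cyc: "chain_boundary ?X sg n e R = 0" if "R \<in> cells ?X" "cell_dim ?X R = n - 1" for R
    unfolding e_def chain_boundary_diff
    using cyc[OF that] chain_boundary_boundary[OF H(1) sg that] by simp
  have e_u: "?u \<in> ?V Q" if "Q \<in> cells ?X" "cell_dim ?X Q = n" "e Q \<noteq> 0" for Q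
    using b[OF that(1,2)] that(3) by (auto simp: e_def)
  \<comment> \<open>If the factor \<open>t\<close> of a surviving box \<open>Q\<close> had another element, the face without \<open>a\<^sub>t\<close> would have
    \<open>Q\<close> as its only coface in the support, contradicting that the difference is a cycle.\<close>
  have c'': "x ! t = a ! t" if Q: "Q \<in> cells ?X" "cell_dim ?X Q = n" "e Q \<noteq> 0" and x: "x \<in> Q" for Q x
  proof (rule ccontr)
    assume xt: "x ! t \<noteq> a ! t"
    note Q0 = ne[OF Q(2)]
    let ?W = "?V Q - {?u}"
    let ?R = "product_box d ?W"
    have "x \<in> product_box d (?V Q)"
      using x nonempty_cell(2)[OF Q(1) Q0] by simp
    then have "x \<in> ?R"
      using xt by (auto simp: product_box_def)
    moreover have "?W \<subseteq> {..<d} \<times> UNIV"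
      using nonempty_cell(1)[OF Q(1) Q0] by (auto simp: transversal_def)
    ultimately have tr: "transversal d ?W"
      using transversal_if_product_box_nonempty by blast
    have RQ: "?R \<subseteq> Q"
      using product_box_mono[of ?W "?V Q" d] nonempty_cell(2)[OF Q(1) Q0] by simp
    then have R: "?R \<in> cells ?X"
      using product_box_in_cells[OF tr] cell_subset[OF Q(1)] by blast
    have R0: "?R \<noteq> {}"
      using \<open>x \<in> ?R\<close> by auto
    have VR: "?V ?R = ?W"
      using tr by simp
    have "card (?V Q) = Suc (card ?W)"
      using e_u[OF Q] finite_cell_vertices[OF H(1) Q(1)] by (metis card.remove)
    then have dimR: "cell_dim ?X ?R = n - 1"
      using Q(2) by (simp add: cell_dim_nonempty[OF H(1) R R0] cell_dim_nonempty[OF H(1) Q(1) Q0] VR)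
    have RQ': "?R \<subset> Q"
      unfolding psubset_cell_iff[OF Q(1) R Q0 R0] VR using e_u[OF Q] by auto
    have "chain_boundary ?X sg n e ?R = (\<Sum>P\<in>{Q}. if ?R \<subset> P then of_int (sg P ?R) * e P else 0)"
      unfolding chain_boundary_def
    proof (rule sum.mono_neutral_right[OF finY])
      show "{Q} \<subseteq> {P \<in> cells ?X. cell_dim ?X P = n}"
        using Q by simp
      have "P = Q" if "P \<in> cells ?X" "cell_dim ?X P = n" "?R \<subset> P" "e P \<noteq> 0" for P
      proof -
        have "P = product_box d (insert ?u ?W)"
          using coface(1)[OF R R0 that(1,3)] that(2) dimR e_u[OF that(1,2,4)] VR by simp
        also have "insert ?u ?W = ?V Q"
          using e_u[OF Q] by auto
        finally show ?thesis
          by (simp add: nonempty_cell(2)[OF Q(1) Q0])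
      qed
      then show "\<forall>P\<in>{P \<in> cells ?X. cell_dim ?X P = n} - {Q}.
          (if ?R \<subset> P then of_int (sg P ?R) * e P else 0) = 0"
        by auto
    qed
    also have "\<dots> = of_int (sg Q ?R) * e Q"
      using RQ' by simp
    also have "\<dots> \<noteq> 0"
      using sg_sq(2)[OF Q(1) R RQ'] dimR Q(2,3) by simp
    finally show False
      using e_cyc[OF R dimR] by simp
  qed
  show ?thesis
  proof (intro exI[of _ c'] conjI allI impI ballI)
    fix P assume "c' P \<noteq> 0"
    then show "P \<in> cells ?X'" "cell_dim ?X P = n + 1"
      by (fact c'_nz)+
  next
    fix P assume P: "P \<in> cells ?X" "cell_dim ?X P = n" "c P - chain_boundary ?X sg (n + 1) c' P \<noteq> 0"
    then have e: "e P \<noteq> 0"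
      by (simp add: e_def)
    show "P \<in> cells ?X'"
      using a'[OF P(1,2) e] by simp
    show "x ! i = a ! i" if "x \<in> P" "i < Suc t" for x i
      using a'[OF P(1,2) e] c''[OF P(1,2) e that(1)] that by (cases "i = t") auto
  qed
qed

text \<open>
  After all coordinates have been treated, the cycle is supported on the single vertex \<open>a\<close>. In positive
  dimension it is zero; in dimension \<open>0\<close> its coefficient is its boundary at the empty face, hence zero.
  Boundaries are computed in the complex of the larger hypergraph \<open>H\<close>, to which the orientation belongs.
\<close>

theorem box_complex_acyclic:
  fixes c :: "'a list set \<Rightarrow> 'k::field"
  assumes d: "d > 0" and H: "finite H" "H' \<subseteq> H" and sg: "incidence_function (box_complex d H) sg"
    and cone: "H' \<noteq> {} \<Longrightarrow> \<exists>a. cone_point d H' a" and n: "n \<ge> 0"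
    and supp: "\<And>P. c P \<noteq> 0 \<Longrightarrow> P \<in> cells (box_complex d H') \<and> cell_dim (box_complex d H) P = n"
    and cyc: "\<And>R. R \<in> cells (box_complex d H) \<Longrightarrow> cell_dim (box_complex d H) R = n - 1 \<Longrightarrow>
        chain_boundary (box_complex d H) sg n c R = 0"
  shows "\<exists>c'. (\<forall>P. c' P \<noteq> 0 \<longrightarrow> P \<in> cells (box_complex d H') \<and> cell_dim (box_complex d H) P = n + 1) \<and>
    (\<forall>P\<in>cells (box_complex d H). cell_dim (box_complex d H) P = n \<longrightarrow>
       chain_boundary (box_complex d H) sg (n + 1) c' P = c P)"
proof (cases "\<forall>P. c P = 0")
  case True
  then show ?thesis
    by (intro exI[of _ "\<lambda>_. 0"]) (simp add: chain_boundary_zero)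
next
  case False
  let ?X = "box_complex d H" and ?X' = "box_complex d H'"
  obtain P0 where "c P0 \<noteq> 0"
    using False by blast
  then have "P0 \<in> cells ?X'" "cell_dim ?X P0 = n"
    using supp by blast+
  then have "P0 \<noteq> {}"
    using n by auto
  then have "H' \<noteq> {}"
    using nonempty_cell(3)[OF \<open>P0 \<in> cells ?X'\<close>] by auto
  then obtain a where a: "cone_point d H' a"
    using cone by blast
  have finY: "finite {P \<in> cells ?X. cell_dim ?X P = m}" for m
    using finite_cells[OF H(1)] by simp
  have stage: "\<exists>c'. (\<forall>P. c' P \<noteq> 0 \<longrightarrow> P \<in> cells ?X' \<and> cell_dim ?X P = n + 1) \<and>
    (\<forall>P\<in>cells ?X. cell_dim ?X P = n \<longrightarrow> c P - chain_boundary ?X sg (n + 1) c' P \<noteq> 0 \<longrightarrow>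
       P \<in> cells ?X' \<and> (\<forall>x\<in>P. \<forall>i<t. x ! i = a ! i))" if "t \<le> d" for t
    using that
  proof (induction t)
    case 0
    show ?case
      by (intro exI[of _ "\<lambda>_. 0"]) (auto simp: chain_boundary_zero dest: supp)
  next
    case (Suc t)
    then have t: "t < d" "t \<le> d"
      by simp_all
    obtain c' where c': "\<forall>P. c' P \<noteq> 0 \<longrightarrow> P \<in> cells ?X' \<and> cell_dim ?X P = n + 1"
      and fixed: "\<forall>P\<in>cells ?X. cell_dim ?X P = n \<longrightarrow> c P - chain_boundary ?X sg (n + 1) c' P \<noteq> 0 \<longrightarrow>
       P \<in> cells ?X' \<and> (\<forall>x\<in>P. \<forall>i<t. x ! i = a ! i)"
      using Suc.IH[OF t(2)] by (elim exE conjE)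
    define e where "e = (\<lambda>P. if P \<in> cells ?X \<and> cell_dim ?X P = n then c P - chain_boundary ?X sg (n + 1) c' P else 0)"
    have e_supp: "P \<in> cells ?X' \<and> cell_dim ?X P = n \<and> (\<forall>x\<in>P. \<forall>i<t. x ! i = a ! i)" if "e P \<noteq> 0" for P
      using that fixed by (auto simp: e_def split: if_splits)
    have e_cyc: "chain_boundary ?X sg n e R = 0" if R: "R \<in> cells ?X" "cell_dim ?X R = n - 1" for R
    proof -
      have "chain_boundary ?X sg n e R
          = chain_boundary ?X sg n (\<lambda>P. c P - chain_boundary ?X sg (n + 1) c' P) R"
        unfolding chain_boundary_def[of _ _ n] by (intro sum.cong) (auto simp: e_def)
      then show ?thesis
        using cyc[OF R] chain_boundary_boundary[OF H(1) sg R] by (simp add: chain_boundary_diff)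
    qed
    have "\<exists>c''. (\<forall>P. c'' P \<noteq> 0 \<longrightarrow> P \<in> cells ?X' \<and> cell_dim ?X P = n + 1) \<and>
      (\<forall>P\<in>cells ?X. cell_dim ?X P = n \<longrightarrow> e P - chain_boundary ?X sg (n + 1) c'' P \<noteq> 0 \<longrightarrow>
       P \<in> cells ?X' \<and> (\<forall>x\<in>P. \<forall>i<Suc t. x ! i = a ! i))"
      by (rule cone_step[OF H sg a n t(1)]) (rule e_supp e_cyc; assumption)+
    then obtain c'' where c'': "\<forall>P. c'' P \<noteq> 0 \<longrightarrow> P \<in> cells ?X' \<and> cell_dim ?X P = n + 1"
      and fixed'': "\<forall>P\<in>cells ?X. cell_dim ?X P = n \<longrightarrow> e P - chain_boundary ?X sg (n + 1) c'' P \<noteq> 0 \<longrightarrow>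
       P \<in> cells ?X' \<and> (\<forall>x\<in>P. \<forall>i<Suc t. x ! i = a ! i)"
      by (elim exE conjE)
    show ?case
    proof (intro exI[of _ "\<lambda>P. c' P + c'' P"] conjI allI impI ballI)
      fix P assume "c' P + c'' P \<noteq> 0"
      then have "c' P \<noteq> 0 \<or> c'' P \<noteq> 0"
        by auto
      then show "P \<in> cells ?X'" "cell_dim ?X P = n + 1"
        using c' c'' by blast+
    next
      fix P assume P: "P \<in> cells ?X" "cell_dim ?X P = n"
        "c P - chain_boundary ?X sg (n + 1) (\<lambda>P. c' P + c'' P) P \<noteq> 0"
      then have "e P - chain_boundary ?X sg (n + 1) c'' P \<noteq> 0"
        by (simp add: e_def chain_boundary_add algebra_simps)
      then have "P \<in> cells ?X' \<and> (\<forall>x\<in>P. \<forall>i<Suc t. x ! i = a ! i)"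
        using fixed'' P(1,2) by simp
      then show "P \<in> cells ?X'" "\<And>x i. x \<in> P \<Longrightarrow> i < Suc t \<Longrightarrow> x ! i = a ! i"
        by auto
    qed
  qed
  obtain c' where c': "\<forall>P. c' P \<noteq> 0 \<longrightarrow> P \<in> cells ?X' \<and> cell_dim ?X P = n + 1"
    and fixed: "\<forall>P\<in>cells ?X. cell_dim ?X P = n \<longrightarrow> c P - chain_boundary ?X sg (n + 1) c' P \<noteq> 0 \<longrightarrow>
       P \<in> cells ?X' \<and> (\<forall>x\<in>P. \<forall>i<d. x ! i = a ! i)"
    using stage[OF order_refl] by (elim exE conjE)
  define e where "e = (\<lambda>P. c P - chain_boundary ?X sg (n + 1) c' P)"
  have e_cyc: "chain_boundary ?X sg n e R = 0" if R: "R \<in> cells ?X" "cell_dim ?X R = n - 1" for R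
    using cyc[OF R] chain_boundary_boundary[OF H(1) sg R] by (simp add: e_def chain_boundary_diff)
  have point: "P = {a} \<and> n = 0" if P: "P \<in> cells ?X" "cell_dim ?X P = n" "e P \<noteq> 0" for P
  proof -
    have P0: "P \<noteq> {}"
      using P(2) n by auto
    have "x = a" if "x \<in> P" for x
    proof (rule nth_equalityI)
      have "x \<in> product_box d (hyperedge_vertices P)"
        using that nonempty_cell(2)[OF P(1) P0] by simp
      then show "length x = length a"
        using a by (simp add: product_box_def cone_point_def)
      then show "x ! i = a ! i" if "i < length x" for i
        using fixed P that \<open>x \<in> P\<close> a by (auto simp: e_def cone_point_def)
    qed
    then have Pa: "P = {a}"
      using P0 by blast
    have "hyperedge_vertices {a} = (\<lambda>j. (j, a ! j)) ` {..<d}"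
      using a by (auto simp: hyperedge_vertices_def cone_point_def)
    then have "card (hyperedge_vertices {a}) = d"
      by (simp add: card_image inj_on_def)
    then show ?thesis
      using cell_dim_nonempty[OF H(1) P(1) P0] P(2) Pa by simp
  qed
  have "e P = 0" if P: "P \<in> cells ?X" "cell_dim ?X P = n" for P
  proof (rule ccontr)
    assume eP: "e P \<noteq> 0"
    then have Pa: "P = {a}" "n = 0"
      using point[OF P] by auto
    have "chain_boundary ?X sg n e {} = (\<Sum>Q\<in>{P}. if {} \<subset> Q then of_int (sg Q {}) * e Q else 0)"
      unfolding chain_boundary_def
    proof (rule sum.mono_neutral_right[OF finY])
      show "\<forall>Q\<in>{Q \<in> cells ?X. cell_dim ?X Q = n} - {P}. (if {} \<subset> Q then of_int (sg Q {}) * e Q else 0) = 0"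
        using point Pa by auto
    qed (use P in auto)
    also have "\<dots> = e P"
      using sg P Pa unfolding incidence_function_def by auto
    finally show False
      using e_cyc[of "{}"] Pa eP by simp
  qed
  then show ?thesis
    using c' by (intro exI[of _ c']) (auto simp: e_def)
qed

section \<open>Labels of boxes\<close>

definition mono_dvd :: "'v mono \<Rightarrow> 'v mono \<Rightarrow> bool" where
  "mono_dvd m n \<longleftrightarrow> (\<forall>v. lookup m v \<le> lookup n v)"

lemma mono_dvd_trans: "mono_dvd l m \<Longrightarrow> mono_dvd m n \<Longrightarrow> mono_dvd l n"
  unfolding mono_dvd_def using order_trans by blast

lemma mono_dvd_diff_add: "mono_dvd m n \<Longrightarrow> n - m + m = n"
  by (rule poly_mapping_eqI) (simp add: mono_dvd_def lookup_add lookup_minus)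

lemma mono_dvd_add: "mono_dvd m (n + m)"
  by (simp add: mono_dvd_def lookup_add)

lemma lookup_face_label:
  assumes "finite P"
  shows "lookup (face_label l P) v = Max (insert 0 ((\<lambda>p. lookup (l p) v) ` P))"
proof -
  have "{v. Max (insert 0 ((\<lambda>p. lookup (l p) v) ` P)) \<noteq> 0} \<subseteq> (\<Union>p\<in>P. keys (l p))"
  proof (rule subsetI, rule ccontr)
    fix v assume v: "v \<in> {v. Max (insert 0 ((\<lambda>p. lookup (l p) v) ` P)) \<noteq> 0}" "v \<notin> (\<Union>p\<in>P. keys (l p))"
    then have "insert 0 ((\<lambda>p. lookup (l p) v) ` P) = {0}"
      by (auto simp: in_keys_iff)
    then have "Max (insert 0 ((\<lambda>p. lookup (l p) v) ` P)) = 0"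
      by (simp only: Max_singleton)
    then show False
      using v(1) by (simp del: Max_insert)
  qed
  then have "finite {v. Max (insert 0 ((\<lambda>p. lookup (l p) v) ` P)) \<noteq> 0}"
    by (rule finite_subset) (simp add: assms)
  then show ?thesis
    by (simp add: face_label_def)
qed

lemma face_label_dvd_iff: "finite P \<Longrightarrow> mono_dvd (face_label l P) m \<longleftrightarrow> (\<forall>p\<in>P. mono_dvd (l p) m)"
  by (auto simp: mono_dvd_def lookup_face_label)

lemma face_label_empty [simp]: "face_label l {} = 0"
  by (rule poly_mapping_eqI) (simp add: lookup_face_label)

lemma face_label_singleton [simp]: "face_label l {p} = l p"
  by (rule poly_mapping_eqI) (simp add: lookup_face_label)

lemma face_label_mono: "finite P \<Longrightarrow> Q \<subseteq> P \<Longrightarrow> mono_dvd (face_label l Q) (face_label l P)"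
  using face_label_dvd_iff[of Q l] face_label_dvd_iff[of P l] finite_subset[of Q P]
  by (meson mono_dvd_def order_refl subsetD)

lemma keys_face_label: "finite P \<Longrightarrow> keys (face_label l P) \<subseteq> (\<Union>p\<in>P. keys (l p))"
proof
  fix v assume P: "finite P" and v: "v \<in> keys (face_label l P)"
  then have "Max (insert 0 ((\<lambda>p. lookup (l p) v) ` P)) \<noteq> 0"
    by (simp add: in_keys_iff lookup_face_label)
  moreover have "Max (insert 0 ((\<lambda>p. lookup (l p) v) ` P)) \<in> insert 0 ((\<lambda>p. lookup (l p) v) ` P)"
    using P by (intro Max_in) auto
  ultimately show "v \<in> (\<Union>p\<in>P. keys (l p))"
    by (auto simp: in_keys_iff)
qed

text \<open>
  Both labellings at once: \<open>t j v\<close> is the variable of the vertex \<open>v\<close> of part \<open>j\<close>. The choice \<open>Pair\<close> gives the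
  labels with separate variables, the projection to \<open>v\<close> the specialized labels.
\<close>

definition vertex_label :: "(nat \<Rightarrow> 'a \<Rightarrow> 'v) \<Rightarrow> 'a list \<Rightarrow> 'v mono" where
  "vertex_label t x = (\<Sum>j<length x. single (t j (x ! j)) 1)"

lemma edge_monomial_eq: "edge_monomial = vertex_label Pair"
  by (simp add: fun_eq_iff edge_monomial_def vertex_label_def)

lemma sp_edge_monomial_eq: "sp_edge_monomial = vertex_label (\<lambda>_ x. x)"
  by (simp add: fun_eq_iff sp_edge_monomial_def vertex_label_def)

lemma lookup_sum_single: "finite A \<Longrightarrow> lookup (\<Sum>a\<in>A. single (g a) (1::nat)) v = card {a \<in> A. g a = v}"
proof -
  assume A: "finite A"
  have "lookup (\<Sum>a\<in>A. single (g a) (1::nat)) v = (\<Sum>a\<in>A. if g a = v then 1 else 0)"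
    unfolding lookup_sum by (rule sum.cong) (auto simp: lookup_single when_def)
  also have "\<dots> = card {a \<in> A. g a = v}"
    using A by (simp add: sum.If_cases Int_def)
  finally show ?thesis .
qed

lemma lookup_vertex_label: "lookup (vertex_label t x) v = card {j. j < length x \<and> t j (x ! j) = v}"
  using lookup_sum_single[of "{..<length x}" "\<lambda>j. t j (x ! j)" v] by (simp add: vertex_label_def)

lemma mono_deg_sum_single: "finite A \<Longrightarrow> mono_deg (\<Sum>a\<in>A. single (g a) 1) = card A"
proof (induction A rule: finite_induct)
  case empty
  show ?case
    by (simp add: mono_deg_def)
next
  case (insert a A)
  have "mono_deg (single (g a) 1) = 1"
    by (simp add: mono_deg_def)
  then show ?case
    using insert by (simp add: mono_deg_add)
qed

lemma finite_product_box: "finite U \<Longrightarrow> finite (product_box d U)"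
proof -
  assume "finite U"
  then have "finite {xs. set xs \<subseteq> snd ` U \<and> length xs = d}"
    by (intro finite_lists_length_eq) simp
  moreover have "product_box d U \<subseteq> {xs. set xs \<subseteq> snd ` U \<and> length xs = d}"
    by (force simp: product_box_def in_set_conv_nth)
  ultimately show ?thesis
    by (rule finite_subset[rotated])
qed

text \<open>
  The exponent of a variable in the label is the largest multiplicity in a vertex. Coordinates of vertices
  are chosen independently, so this maximum is the number of factors that contain the variable.
\<close>

lemma face_label_product_box:
  assumes U: "transversal d U" "finite U" and t: "\<And>j. inj (t j)"
  shows "face_label (vertex_label t) (product_box d U) = (\<Sum>u\<in>U. single (t (fst u) (snd u)) 1)"
proof (rule poly_mapping_eqI)
  fix v
  let ?A = "{u \<in> U. t (fst u) (snd u) = v}"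
  have fin: "finite (insert 0 ((\<lambda>p. lookup (vertex_label t p) v) ` product_box d U))"
    using finite_product_box[OF U(2)] by simp
  have "Max (insert 0 ((\<lambda>p. lookup (vertex_label t p) v) ` product_box d U)) = card ?A"
  proof (rule antisym)
    have "lookup (vertex_label t x) v \<le> card ?A" if x: "x \<in> product_box d U" for x
      unfolding lookup_vertex_label
    proof (rule card_inj_on_le[where f = "\<lambda>j. (j, x ! j)"])
      show "finite ?A"
        using U(2) by simp
      show "(\<lambda>j. (j, x ! j)) ` {j. j < length x \<and> t j (x ! j) = v} \<subseteq> ?A"
        using x by (auto simp: product_box_def)
    qed (auto simp: inj_on_def)
    then show "Max (insert 0 ((\<lambda>p. lookup (vertex_label t p) v) ` product_box d U)) \<le> card ?A"
      using fin by (subst Max_le_iff) auto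
  next
    \<comment> \<open>the coordinates of a vertex of the box can be chosen independently of each other\<close>
    define g where "g = (\<lambda>j. if \<exists>y. (j, y) \<in> U \<and> t j y = v then SOME y. (j, y) \<in> U \<and> t j y = v
      else SOME y. (j, y) \<in> U)"
    define x where "x = map g [0..<d]"
    have xj: "(j, x ! j) \<in> U \<and> ((\<exists>y. (j, y) \<in> U \<and> t j y = v) \<longrightarrow> t j (x ! j) = v)" if j: "j < d" for j
    proof (cases "\<exists>y. (j, y) \<in> U \<and> t j y = v")
      case True
      then show ?thesis
        using j someI_ex[OF True] by (simp add: x_def g_def)
    next
      case False
      have "\<exists>y. (j, y) \<in> U"
        using U(1) j by (simp add: transversal_def)
      then have "(j, SOME y. (j, y) \<in> U) \<in> U"
        by (rule someI_ex)
      moreover have "x ! j = (SOME y. (j, y) \<in> U)"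
        using j by (simp add: x_def) (simp only: g_def False if_False)
      ultimately show ?thesis
        using False by simp
    qed
    have lenx: "length x = d"
      by (simp add: x_def)
    have x: "x \<in> product_box d U"
      using xj lenx by (simp add: product_box_def)
    have "card ?A \<le> card {j. j < length x \<and> t j (x ! j) = v}"
    proof (rule card_inj_on_le[where f = fst])
      show "inj_on fst ?A"
        using t by (auto simp: inj_on_def)
      show "fst ` ?A \<subseteq> {j. j < length x \<and> t j (x ! j) = v}"
      proof
        fix j assume "j \<in> fst ` ?A"
        then obtain y where y: "(j, y) \<in> U" "t j y = v"
          by auto
        then have "j < d"
          using U(1) by (auto simp: transversal_def)
        then show "j \<in> {j. j < length x \<and> t j (x ! j) = v}"
          using xj y lenx by auto
      qed
    qed simp
    also have "\<dots> = lookup (vertex_label t x) v"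
      by (simp add: lookup_vertex_label)
    also have "\<dots> \<le> Max (insert 0 ((\<lambda>p. lookup (vertex_label t p) v) ` product_box d U))"
      using fin x by (intro Max_ge) auto
    finally show "card ?A \<le> Max (insert 0 ((\<lambda>p. lookup (vertex_label t p) v) ` product_box d U))" .
  qed
  then show "lookup (face_label (vertex_label t) (product_box d U)) v
      = lookup (\<Sum>u\<in>U. single (t (fst u) (snd u)) 1) v"
    unfolding lookup_face_label[OF finite_product_box[OF U(2)]] lookup_sum_single[OF U(2)] .
qed

lemma face_label_cell:
  assumes H: "finite H" and P: "P \<in> cells (box_complex d H)" "P \<noteq> {}" and t: "\<And>j. inj (t j)"
  shows "face_label (vertex_label t) P = (\<Sum>u\<in>hyperedge_vertices P. single (t (fst u) (snd u)) 1)"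
  using face_label_product_box[OF nonempty_cell(1)[OF P] finite_cell_vertices[OF H P(1)] t]
  by (simp add: nonempty_cell(2)[OF P])

lemma mono_deg_face_label_cell:
  assumes H: "finite H" and P: "P \<in> cells (box_complex d H)" "P \<noteq> {}" and t: "\<And>j. inj (t j)"
  shows "mono_deg (face_label (vertex_label t) P) = card (hyperedge_vertices P)"
  unfolding face_label_cell[where t = t, OF assms]
  by (rule mono_deg_sum_single[OF finite_cell_vertices[OF H P(1)]])

section \<open>Orientations\<close>

text \<open>
  The usual sign of a facet of a simplex, for the order given by \<open>f\<close>. A box is oriented like the simplex on
  its support: both have facets obtained by removing one element, except that a box has no facet when the
  element is the last one of its factor.
\<close>

definition removal_sign :: "('u \<Rightarrow> nat) \<Rightarrow> 'u set \<Rightarrow> 'u \<Rightarrow> int" where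
  "removal_sign f U u = (-1) ^ card {w \<in> U. f w < f u}"

definition box_incidence :: "(nat \<times> 'a \<Rightarrow> nat) \<Rightarrow> 'a list set \<Rightarrow> 'a list set \<Rightarrow> int" where
  "box_incidence f P Q = (if Q = {} then 1 else
     removal_sign f (hyperedge_vertices P) (THE u. hyperedge_vertices P - hyperedge_vertices Q = {u}))"

lemma box_incidence_remove:
  assumes "transversal d (U - {u})" "transversal d U" "u \<in> U"
  shows "box_incidence f (product_box d U) (product_box d (U - {u})) = removal_sign f U u"
proof -
  have "U - (U - {u}) = {u}"
    using assms(3) by auto
  then have "(THE w. U - (U - {u}) = {w}) = u"
    by (intro the_equality) auto
  then show ?thesis
    using assms product_box_nonempty[OF assms(1)] by (simp add: box_incidence_def)
qed

lemma removal_signs_cancel: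
  assumes "finite U" "u \<in> U" "v \<in> U" "f u < f v"
  shows "removal_sign f U u * removal_sign f (U - {u}) v + removal_sign f U v * removal_sign f (U - {v}) u = 0"
proof -
  have "{w \<in> U. f w < f v} = insert u {w \<in> U - {u}. f w < f v}"
    using assms by auto
  then have "card {w \<in> U. f w < f v} = Suc (card {w \<in> U - {u}. f w < f v})"
    using assms(1) by simp
  moreover have "{w \<in> U - {v}. f w < f u} = {w \<in> U. f w < f u}"
    using assms by auto
  ultimately show ?thesis
    by (simp add: removal_sign_def)
qed

lemma transversal_superset:
  "transversal d W \<Longrightarrow> W \<subseteq> U \<Longrightarrow> U \<subseteq> {..<d} \<times> UNIV \<Longrightarrow> transversal d U"
  unfolding transversal_def by blast

text \<open>
  The signs of the two ends of an edge of the complex must cancel. The support of an edge has just one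
  part with two elements. These are neighbours in an order that lists the parts one after the other, so
  their removal signs are opposite.
\<close>

lemma incidence_edge:
  assumes U: "finite U" "transversal d U" "card U = Suc d" and f: "inj_on f U"
    and f_parts: "\<And>i x j y. (i, x) \<in> U \<Longrightarrow> (j, y) \<in> U \<Longrightarrow> i < j \<Longrightarrow> f (i, x) < f (j, y)"
  shows "(\<Sum>u\<in>{u \<in> U. transversal d (U - {u})}. removal_sign f U u) = 0"
proof -
  have two: "\<not> transversal d (U - {u} - {v})" if "u \<in> U" "v \<in> U" "u \<noteq> v" for u v
  proof
    assume "transversal d (U - {u} - {v})"
    then have "d \<le> card (U - {u} - {v})"
      using U(1) by (intro card_transversal_ge) simp_all
    moreover have "card (U - {u} - {v}) = card U - 1 - 1"
      using that U(1) by simp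
    moreover have "card U \<ge> 2"
      using card_mono[OF U(1), of "{u, v}"] that by simp
    ultimately show False
      using U(3) by simp
  qed
  have "\<exists>j<d. card {x. (j, x) \<in> U} > 1"
  proof (rule ccontr)
    assume "\<not> ?thesis"
    then have "(\<Sum>j<d. card {x. (j, x) \<in> U}) \<le> (\<Sum>j<d. 1)"
      by (intro sum_mono) (meson lessThan_iff leI)
    then show False
      using card_transversal[OF U(2,1)] U(3) by simp
  qed
  then obtain j where j: "j < d" "card {x. (j, x) \<in> U} > 1"
    by blast
  then obtain y z where "y \<in> {x. (j, x) \<in> U}" "z \<in> {x. (j, x) \<in> U}" "y \<noteq> z"
    using card_le_Suc0_iff_eq[OF finite_part[OF U(1), of j]] by fastforce
  moreover then have "f (j, y) \<noteq> f (j, z)"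
    using f by (auto dest: inj_onD)
  ultimately obtain y z where yz: "(j, y) \<in> U" "(j, z) \<in> U" "f (j, y) < f (j, z)"
    by (metis mem_Collect_eq nat_neq_iff)
  then have ne: "(j, y) \<noteq> (j, z)"
    by auto
  have tr: "transversal d (U - {u})" if "u \<in> {(j, y), (j, z)}" for u
    unfolding transversal_def
  proof (intro conjI allI impI)
    show "U - {u} \<subseteq> {..<d} \<times> UNIV"
      using U(2) by (auto simp: transversal_def)
    fix i assume i: "i < d"
    obtain w where "(i, w) \<in> U"
      using U(2) i by (auto simp: transversal_def)
    then show "\<exists>x. (i, x) \<in> U - {u}"
      using that yz ne by (cases "i = j") auto
  qed
  have eq: "u \<in> {(j, y), (j, z)}" if u: "u \<in> U" "transversal d (U - {u})" for u
  proof (rule ccontr)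
    assume nu: "u \<notin> {(j, y), (j, z)}"
    have "transversal d (U - {(j, y)} - {u})"
      unfolding transversal_def
    proof (intro conjI allI impI)
      show "U - {(j, y)} - {u} \<subseteq> {..<d} \<times> UNIV"
        using U(2) by (auto simp: transversal_def)
      fix i assume i: "i < d"
      obtain w where "(i, w) \<in> U - {u}"
        using u(2) i by (auto simp: transversal_def)
      then show "\<exists>x. (i, x) \<in> U - {(j, y)} - {u}"
        using nu yz ne by (cases "i = j") auto
    qed
    then show False
      using two[of "(j, y)" u] nu yz u by auto
  qed
  \<comment> \<open>An element strictly between the two would lie in the same part and hence be removable as well.\<close>
  have between: "w = (j, y)" if w: "w \<in> U" "\<not> f w < f (j, y)" "f w < f (j, z)" for w
  proof (rule ccontr)
    assume nw: "w \<noteq> (j, y)"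
    obtain i x where wi: "w = (i, x)"
      by fastforce
    have "\<not> i < j" "\<not> j < i"
      using f_parts[of i x j y] f_parts[of j z i x] w yz unfolding wi by auto
    then have "i = j"
      by simp
    have "transversal d (U - {w})"
      unfolding transversal_def
    proof (intro conjI allI impI)
      show "U - {w} \<subseteq> {..<d} \<times> UNIV"
        using U(2) by (auto simp: transversal_def)
      fix i' assume i: "i' < d"
      obtain x' where "(i', x') \<in> U"
        using U(2) i by (auto simp: transversal_def)
      then show "\<exists>x. (i', x) \<in> U - {w}"
        using nw yz unfolding wi \<open>i = j\<close> by (cases "i' = j") auto
    qed
    then have "w \<in> {(j, y), (j, z)}"
      using eq w(1) by blast
    then show False
      using nw w(3) by auto
  qed
  have "{w \<in> U. f w < f (j, z)} = insert (j, y) {w \<in> U. f w < f (j, y)}"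
  proof
    show "{w \<in> U. f w < f (j, z)} \<subseteq> insert (j, y) {w \<in> U. f w < f (j, y)}"
      using between by blast
    show "insert (j, y) {w \<in> U. f w < f (j, y)} \<subseteq> {w \<in> U. f w < f (j, z)}"
      using yz by auto
  qed
  then have "card {w \<in> U. f w < f (j, z)} = Suc (card {w \<in> U. f w < f (j, y)})"
    using U(1) by simp
  moreover have "{u \<in> U. transversal d (U - {u})} = {(j, y), (j, z)}"
    using eq tr yz by blast
  ultimately show ?thesis
    using ne by (simp add: removal_sign_def)
qed

lemma remove_one_vertex:
  assumes "finite U" "W \<subset> U" "card U = Suc (card W)"
  obtains u where "u \<in> U" "W = U - {u}"
proof -
  obtain u where u: "u \<in> U" "u \<notin> W"
    using assms(2) by blast
  have "W = U - {u}"
    using assms u by (intro card_subset_eq) auto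
  then show thesis
    using u(1) that by blast
qed

text \<open>
  For a nonempty face \<open>R\<close> the two intermediate faces arise by removing two elements in either order, and the
  simplicial signs cancel. The empty face is special, since it corresponds to removing \<open>d\<close> elements at once
  from a vertex; it is the only place where the order has to respect the parts.
\<close>

theorem box_incidence_is_incidence_function:
  assumes H: "finite H" and f: "inj_on f (hyperedge_vertices H)"
    and f_parts: "\<And>i x j y. (i, x) \<in> hyperedge_vertices H \<Longrightarrow> (j, y) \<in> hyperedge_vertices H \<Longrightarrow>
      i < j \<Longrightarrow> f (i, x) < f (j, y)"
  shows "incidence_function (box_complex d H) (box_incidence f)"
  unfolding incidence_function_def
proof (intro conjI ballI impI)
  let ?X = "box_complex d H"
  show "box_incidence f P Q \<in> {1, -1}" for P Q
    by (simp add: box_incidence_def removal_sign_def minus_one_power_iff)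
  show "box_incidence f P {} = 1" for P
    by (simp add: box_incidence_def)
  fix P R assume P: "P \<in> cells ?X" and R: "R \<in> cells ?X"
    and RP: "R \<subset> P \<and> cell_dim ?X P = cell_dim ?X R + 2"
  let ?S = "{Q \<in> cells ?X. R \<subset> Q \<and> Q \<subset> P}"
  define U where "U = hyperedge_vertices P"
  have P0: "P \<noteq> {}"
    using RP by auto
  have tU: "transversal d U" and PU: "P = product_box d U" and PH: "P \<subseteq> H"
    using nonempty_cell[OF P P0] by (simp_all add: U_def)
  have finU: "finite U"
    unfolding U_def by (rule finite_cell_vertices[OF H P])
  have UH: "U \<subseteq> hyperedge_vertices H"
    unfolding U_def by (rule hyperedge_vertices_mono[OF PH])
  have fU: "inj_on f U"
    by (rule inj_on_subset[OF f UH])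
  have face: "product_box d W \<in> cells ?X" "product_box d W \<subset> P" "product_box d W \<noteq> {}"
    if "transversal d W" "W \<subset> U" for W
  proof -
    show lt: "product_box d W \<subset> P"
      unfolding PU product_box_psubset_iff[OF that(1) tU] by (rule that(2))
    then show "product_box d W \<in> cells ?X"
      using PH by (intro product_box_in_cells[OF that(1)]) auto
    show "product_box d W \<noteq> {}"
      by (rule product_box_nonempty[OF that(1)])
  qed
  have V_face: "transversal d (hyperedge_vertices Q)" "Q = product_box d (hyperedge_vertices Q)"
      "hyperedge_vertices Q \<subset> U" if "Q \<in> cells ?X" "Q \<noteq> {}" "Q \<subset> P" for Q
    using nonempty_cell[OF that(1,2)] psubset_cell_iff[OF P that(1) P0 that(2)] that(3) by (simp_all add: U_def)
  show "(\<Sum>Q\<in>?S. box_incidence f P Q * box_incidence f Q R) = 0"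
  proof (cases "R = {}")
    case True
    have cardU: "card U = Suc d"
      using RP True cell_dim_nonempty[OF H P P0] by (simp add: U_def)
    let ?T = "{u \<in> U. transversal d (U - {u})}"
    have S: "?S = (\<lambda>u. product_box d (U - {u})) ` ?T"
    proof
      show "(\<lambda>u. product_box d (U - {u})) ` ?T \<subseteq> ?S"
      proof
        fix Q assume "Q \<in> (\<lambda>u. product_box d (U - {u})) ` ?T"
        then obtain u where u: "u \<in> U" "transversal d (U - {u})" "Q = product_box d (U - {u})"
          by blast
        have "U - {u} \<subset> U"
          using u(1) by auto
        then show "Q \<in> ?S"
          using face[OF u(2)] u(3) True by auto
      qed
      show "?S \<subseteq> (\<lambda>u. product_box d (U - {u})) ` ?T"
      proof
        fix Q assume "Q \<in> ?S"
        then have Q: "Q \<in> cells ?X" "Q \<noteq> {}" "Q \<subset> P"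
          using True by auto
        note VQ = V_face[OF Q]
        have "d \<le> card (hyperedge_vertices Q)"
          by (rule card_transversal_ge[OF VQ(1) finite_cell_vertices[OF H Q(1)]])
        moreover have "card (hyperedge_vertices Q) < card U"
          by (rule psubset_card_mono[OF finU VQ(3)])
        ultimately have "card U = Suc (card (hyperedge_vertices Q))"
          using cardU by simp
        then obtain u where u: "u \<in> U" "hyperedge_vertices Q = U - {u}"
          by (rule remove_one_vertex[OF finU VQ(3)])
        have "Q = product_box d (U - {u})" "transversal d (U - {u})"
          using VQ(1,2) by (simp_all add: u(2))
        then show "Q \<in> (\<lambda>u. product_box d (U - {u})) ` ?T"
          using u(1) by blast
      qed
    qed
    have inj: "inj_on (\<lambda>u. product_box d (U - {u})) ?T"
    proof (rule inj_onI)
      fix u v assume u: "u \<in> ?T" and v: "v \<in> ?T"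
        and eq: "product_box d (U - {u}) = product_box d (U - {v})"
      have tr: "transversal d (U - {u})" "transversal d (U - {v})" and uU: "u \<in> U"
        using u v by simp_all
      have "U - {u} = U - {v}"
        using arg_cong[OF eq, of hyperedge_vertices] tr by simp
      then show "u = v"
        using uU by auto
    qed
    have "(\<Sum>Q\<in>?S. box_incidence f P Q * box_incidence f Q R)
        = (\<Sum>u\<in>?T. box_incidence f P (product_box d (U - {u})) * box_incidence f (product_box d (U - {u})) R)"
      unfolding S by (simp add: sum.reindex[OF inj])
    also have "\<dots> = (\<Sum>u\<in>?T. removal_sign f U u)"
    proof (rule sum.cong[OF refl])
      fix u assume "u \<in> ?T"
      then have "box_incidence f P (product_box d (U - {u})) = removal_sign f U u"
        unfolding PU by (intro box_incidence_remove tU) simp_all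
      moreover have "box_incidence f (product_box d (U - {u})) R = 1"
        using True by (simp add: box_incidence_def)
      ultimately show "box_incidence f P (product_box d (U - {u})) * box_incidence f (product_box d (U - {u})) R
          = removal_sign f U u"
        by simp
    qed
    also have "\<dots> = 0"
    proof (rule incidence_edge[OF finU tU cardU fU])
      fix i x j y assume "(i, x) \<in> U" "(j, y) \<in> U" "i < j"
      then show "f (i, x) < f (j, y)"
        using f_parts[of i x j y] UH by auto
    qed
    finally show ?thesis .
  next
    case False
    define W where "W = hyperedge_vertices R"
    have R': "R \<subset> P"
      using RP by (rule conjunct1)
    have tW: "transversal d W"
      unfolding W_def by (rule V_face(1)[OF R False R'])
    have RW: "R = product_box d W"
      unfolding W_def by (rule V_face(2)[OF R False R'])
    have WU: "W \<subset> U"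
      unfolding W_def by (rule V_face(3)[OF R False R'])
    have finW: "finite W"
      by (rule finite_subset[OF psubset_imp_subset[OF WU] finU])
    have cardU: "card U = Suc (Suc (card W))"
      using conjunct2[OF RP] unfolding cell_dim_nonempty[OF H P P0] cell_dim_nonempty[OF H R False]
        U_def W_def by linarith
    have "\<exists>a. a \<in> U - W"
      by (rule psubset_imp_ex_mem[OF WU])
    then obtain a where "a \<in> U - W"
      by (rule exE)
    then have a: "a \<in> U" "a \<notin> W"
      by simp_all
    have card_aW: "card U = Suc (card (insert a W))"
      using finW a(2) cardU by simp
    have "insert a W \<subseteq> U" "insert a W \<noteq> U"
      using a WU card_aW by auto
    then have aWU: "insert a W \<subset> U"
      by (rule psubsetI)
    obtain b where b: "b \<in> U" "insert a W = U - {b}"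
      by (rule remove_one_vertex[OF finU aWU card_aW])
    have "b \<noteq> a"
      using b(2) by blast
    then have fab: "f a \<noteq> f b"
      using inj_onD[OF fU, of a b] a(1) b(1) by blast
    define u where "u = (if f a < f b then a else b)"
    define v where "v = (if f a < f b then b else a)"
    have uv: "u \<in> U" "v \<in> U" "f u < f v"
      using a(1) b(1) fab by (simp_all add: u_def v_def)
    have "W = U - {a} - {b}"
      using b(2) a(2) by blast
    then have W: "W = U - {u} - {v}" "W = U - {v} - {u}"
      unfolding u_def v_def by auto
    have ne: "u \<noteq> v"
      using uv(3) by auto
    have tu: "transversal d (U - {u})" "transversal d (U - {v})"
    proof -
      have "U \<subseteq> {..<d} \<times> UNIV"
        using tU by (simp add: transversal_def)
      then have sub: "U - {u} \<subseteq> {..<d} \<times> UNIV" "U - {v} \<subseteq> {..<d} \<times> UNIV"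
        by blast+
      have "W \<subseteq> U - {u}"
        unfolding W(1) by blast
      then show "transversal d (U - {u})"
        using sub(1) by (rule transversal_superset[OF tW])
      have "W \<subseteq> U - {v}"
        unfolding W(2) by blast
      then show "transversal d (U - {v})"
        using sub(2) by (rule transversal_superset[OF tW])
    qed
    have S: "?S = {product_box d (U - {u}), product_box d (U - {v})}"
    proof
      have *: "product_box d Z \<in> ?S" if "transversal d Z" "Z \<subset> U" "W \<subset> Z" for Z
        using face[OF that(1,2)] product_box_psubset_iff[OF tW that(1)] that(3) by (simp add: RW)
      have "U - {u} \<subset> U" "U - {v} \<subset> U"
        using uv(1,2) by blast+
      moreover have "W \<subset> U - {u}" "W \<subset> U - {v}"
        using uv(1,2) ne unfolding W(1) by blast+
      ultimately have "product_box d (U - {u}) \<in> ?S" "product_box d (U - {v}) \<in> ?S"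
        using * tu by simp_all
      then show "{product_box d (U - {u}), product_box d (U - {v})} \<subseteq> ?S"
        by simp
      show "?S \<subseteq> {product_box d (U - {u}), product_box d (U - {v})}"
      proof
        fix Q assume Q: "Q \<in> ?S"
        then have Q': "Q \<in> cells ?X" "Q \<noteq> {}" "Q \<subset> P" "R \<subset> Q"
          by auto
        note VQ = V_face[OF Q'(1-3)]
        have "W \<subset> hyperedge_vertices Q"
          using psubset_cell_iff[OF Q'(1) R Q'(2) False] Q'(4) by (simp add: W_def)
        then have "hyperedge_vertices Q = U - {u} \<or> hyperedge_vertices Q = U - {v}"
          using VQ(3) unfolding W(1) by blast
        then show "Q \<in> {product_box d (U - {u}), product_box d (U - {v})}"
          by (metis VQ(2) insertCI)
      qed
    qed
    have distinct: "product_box d (U - {u}) \<noteq> product_box d (U - {v})"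
    proof
      assume eq: "product_box d (U - {u}) = product_box d (U - {v})"
      have "U - {u} = U - {v}"
        using arg_cong[OF eq, of hyperedge_vertices] tu by simp
      then show False
        using uv(1) ne by auto
    qed
    have "box_incidence f P (product_box d (U - {u})) = removal_sign f U u"
      "box_incidence f P (product_box d (U - {v})) = removal_sign f U v"
      unfolding PU using box_incidence_remove[OF tu(1) tU uv(1)] box_incidence_remove[OF tu(2) tU uv(2)] .
    moreover have "box_incidence f (product_box d (U - {u})) R = removal_sign f (U - {u}) v"
      unfolding RW W(1) using uv(2) ne by (intro box_incidence_remove[OF tW[unfolded W(1)] tu(1)]) auto
    moreover have "box_incidence f (product_box d (U - {v})) R = removal_sign f (U - {v}) u"
      unfolding RW W(2) using uv(1) ne by (intro box_incidence_remove[OF tW[unfolded W(2)] tu(2)]) auto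
    ultimately show ?thesis
      using removal_signs_cancel[OF finU uv(1-3)] unfolding S by (simp add: distinct)
  qed
qed

theorem box_complex_orientable:
  fixes H :: "'a list set"
  assumes H: "finite H"
  shows "\<exists>sg. incidence_function (box_complex d H) sg"
proof -
  have "finite (hyperedge_vertices H)"
    by (rule finite_hyperedge_vertices[OF H])
  then obtain e :: "nat \<times> 'a \<Rightarrow> nat" and N where e: "e ` hyperedge_vertices H = {i. i < N}"
      "inj_on e (hyperedge_vertices H)"
    using finite_imp_inj_to_nat_seg[of "hyperedge_vertices H"] by blast
  have less: "e u < N" if "u \<in> hyperedge_vertices H" for u
    using e(1) that by blast
  \<comment> \<open>Lexicographic order: first the part, then an arbitrary order of the vertices.\<close>
  define f where "f = (\<lambda>u. fst u * N + e u)"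
  have parts: "f (i, x) < f (j, y)" if "(i, x) \<in> hyperedge_vertices H" "(j, y) \<in> hyperedge_vertices H" "i < j" for i x j y
  proof -
    have "i * N + e (i, x) < Suc i * N"
      using less[OF that(1)] by simp
    also have "\<dots> \<le> j * N"
      using that(3) by (intro mult_right_mono) simp_all
    finally show ?thesis
      by (simp add: f_def)
  qed
  have "inj_on f (hyperedge_vertices H)"
  proof (rule inj_onI)
    fix u v assume uv: "u \<in> hyperedge_vertices H" "v \<in> hyperedge_vertices H" "f u = f v"
    then have "fst u = fst v"
      using parts[of "fst u" "snd u" "fst v" "snd v"] parts[of "fst v" "snd v" "fst u" "snd u"]
      by (metis less_irrefl nat_neq_iff prod.collapse)
    then have "e u = e v"
      using uv(3) by (simp add: f_def)
    then show "u = v"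
      using e(2) uv(1,2) by (auto dest: inj_onD)
  qed
  then have "incidence_function (box_complex d H) (box_incidence f)"
    by (rule box_incidence_is_incidence_function[OF H]) (rule parts)
  then show ?thesis
    by (intro exI[of _ "box_incidence f"])
qed

section \<open>The resolution supported by a complex of boxes\<close>

lemma mono_deg_zero [simp]: "mono_deg 0 = 0"
  by (simp add: mono_deg_def)

lemma keys_diff_mono: "keys (m - n) \<subseteq> keys (m :: 'v mono)"
  by (auto simp: in_keys_iff lookup_minus)

lemma add_inverse_poly_ring:
  fixes p :: "('v, 'k::field) mpoly"
  assumes "p \<in> polys V"
  shows "m_inv (add_monoid (poly_ring V)) p = - p"
proof -
  interpret R: ring "poly_ring V :: ('v, 'k) mpoly ring"
    by (rule ring_poly_ring)
  have "\<ominus>\<^bsub>poly_ring V\<^esub> p = - p"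
    by (rule R.minus_equality) (use assms in \<open>simp_all add: poly_ring_def uminus_in_polys\<close>)
  then show ?thesis
    by (simp add: a_inv_def)
qed

text \<open>
  The explicit form of the ideal in which the image of the last differential appears.
\<close>

lemma monomial_ideal_combinations:
  fixes l :: "'p \<Rightarrow> 'v mono"
  assumes H: "finite H" and l: "\<And>x. x \<in> H \<Longrightarrow> keys (l x) \<subseteq> V"
  shows "monomial_ideal V (l ` H)
    = {\<Sum>x\<in>H. h x * single (l x) (1 :: 'k::field) | h. \<forall>x\<in>H. h x \<in> polys V}" (is "_ = ?J")
proof -
  let ?R = "poly_ring V :: ('v, 'k) mpoly ring"
  let ?G = "(\<lambda>m. single m (1 :: 'k)) ` l ` H"
  interpret R: ring ?R
    by (rule ring_poly_ring)
  have lV: "single (l x) (1 :: 'k) \<in> polys V" if "x \<in> H" for x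
    using l[OF that] by (rule single_in_polys)
  have JV: "?J \<subseteq> polys V"
    using lV by (auto intro!: sum_in_polys mult_in_polys)
  have "ideal ?J ?R"
  proof (rule idealI[OF ring_poly_ring])
    show "subgroup ?J (add_monoid ?R)"
    proof (rule group.subgroupI)
      show "Group.group (add_monoid ?R)"
        by (rule R.add.is_group)
      show "?J \<subseteq> carrier (add_monoid ?R)"
        using JV by (simp add: poly_ring_def)
      have "(\<Sum>x\<in>H. 0 * single (l x) (1 :: 'k)) \<in> ?J"
        by (rule CollectI, rule exI[of _ "\<lambda>_. 0"]) simp
      then show "?J \<noteq> {}"
        by blast
    next
      fix p assume "p \<in> ?J"
      then obtain h where h: "p = (\<Sum>x\<in>H. h x * single (l x) 1)" "\<forall>x\<in>H. h x \<in> polys V"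
        by blast
      have "- p = (\<Sum>x\<in>H. - h x * single (l x) 1)"
        by (simp add: h(1) sum_negf)
      moreover have "p \<in> polys V"
        using JV \<open>p \<in> ?J\<close> by blast
      ultimately show "inv\<^bsub>add_monoid ?R\<^esub> p \<in> ?J"
        unfolding add_inverse_poly_ring[OF \<open>p \<in> polys V\<close>]
        using h(2) by (intro CollectI exI[of _ "\<lambda>x. - h x"]) (simp add: uminus_in_polys)
    next
      fix p q assume "p \<in> ?J" "q \<in> ?J"
      then obtain h h' where h: "p = (\<Sum>x\<in>H. h x * single (l x) 1)" "\<forall>x\<in>H. h x \<in> polys V"
          "q = (\<Sum>x\<in>H. h' x * single (l x) 1)" "\<forall>x\<in>H. h' x \<in> polys V"
        by blast
      have "p + q = (\<Sum>x\<in>H. (h x + h' x) * single (l x) 1)"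
        by (simp add: h sum.distrib distrib_right)
      then show "p \<otimes>\<^bsub>add_monoid ?R\<^esub> q \<in> ?J"
        using h(2,4) by (auto simp: poly_ring_def intro!: exI[of _ "\<lambda>x. h x + h' x"] add_in_polys)
    qed
  next
    fix p q assume "p \<in> ?J" "q \<in> carrier ?R"
    then obtain h where h: "p = (\<Sum>x\<in>H. h x * single (l x) 1)" "\<forall>x\<in>H. h x \<in> polys V" and q: "q \<in> polys V"
      by (auto simp: poly_ring_def)
    have "q * p = (\<Sum>x\<in>H. (q * h x) * single (l x) 1)"
      by (simp add: h sum_distrib_left mult.assoc)
    then have *: "q * p \<in> ?J"
      using h(2) q by (auto intro!: exI[of _ "\<lambda>x. q * h x"] mult_in_polys)
    then show "q \<otimes>\<^bsub>?R\<^esub> p \<in> ?J" "p \<otimes>\<^bsub>?R\<^esub> q \<in> ?J"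
      by (simp_all add: poly_ring_def mult.commute[of p q])
  qed
  moreover have "?G \<subseteq> ?J"
  proof
    fix p assume "p \<in> ?G"
    then obtain y where y: "y \<in> H" "p = single (l y) 1"
      by blast
    have "p = (\<Sum>x\<in>H. (if x = y then 1 else 0) * single (l x) 1)"
      using y H by (simp add: if_distrib[of "\<lambda>a. a * _"] cong: if_cong)
    then show "p \<in> ?J"
      by (auto intro!: exI[of _ "\<lambda>x. if x = y then 1 else 0"])
  qed
  ultimately have "Idl\<^bsub>?R\<^esub> ?G \<subseteq> ?J"
    by (rule R.genideal_minimal)
  moreover have "?J \<subseteq> Idl\<^bsub>?R\<^esub> ?G"
  proof
    fix p assume "p \<in> ?J"
    then obtain h where h: "p = (\<Sum>x\<in>H. h x * single (l x) 1)" "\<forall>x\<in>H. h x \<in> polys V"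
      by blast
    have G: "?G \<subseteq> carrier ?R"
      using lV by (auto simp: poly_ring_def)
    interpret I: ideal "Idl\<^bsub>?R\<^esub> ?G" ?R
      by (rule R.genideal_ideal[OF G])
    have "(\<Sum>x\<in>A. h x * single (l x) 1) \<in> Idl\<^bsub>?R\<^esub> ?G" if "finite A" "A \<subseteq> H" for A
      using that
    proof (induction A rule: finite_induct)
      case empty
      show ?case
        using I.zero_closed by (simp add: poly_ring_def)
    next
      case (insert x A)
      have "single (l x) 1 \<in> Idl\<^bsub>?R\<^esub> ?G"
        using R.genideal_self[OF G] insert.prems by auto
      then have "h x * single (l x) 1 \<in> Idl\<^bsub>?R\<^esub> ?G"
        using I.I_l_closed[of "single (l x) 1" "h x"] h(2) insert.prems by (simp add: poly_ring_def)
      moreover have "(\<Sum>x\<in>A. h x * single (l x) 1) \<in> Idl\<^bsub>?R\<^esub> ?G"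
        using insert.IH insert.prems by simp
      ultimately show ?case
        using I.a_closed[of "h x * single (l x) 1"] insert.hyps by (simp add: poly_ring_def)
    qed
    then show "p \<in> Idl\<^bsub>?R\<^esub> ?G"
      using H h(1) by blast
  qed
  ultimately show ?thesis
    unfolding monomial_ideal_def by (rule subset_antisym)
qed

text \<open>
  The coefficients of the multidegree \<open>\<alpha>\<close> part of an element of a cellular complex, as a chain of cells. The
  cell \<open>P\<close> contributes to this part the multiples of \<open>\<alpha>/m\<^sub>P\<close>, which make sense only if \<open>m\<^sub>P\<close> divides \<open>\<alpha>\<close>.
\<close>

definition degree_part ::
  "('p \<Rightarrow> 'v mono) \<Rightarrow> 'v mono \<Rightarrow> ('p set \<Rightarrow> ('v, 'k::field) mpoly) \<Rightarrow> 'p set \<Rightarrow> 'k" where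
  "degree_part l \<alpha> f P = (if mono_dvd (face_label l P) \<alpha> then lookup (f P) (\<alpha> - face_label l P) else 0)"

lemma cellular_sel [simp]:
  "cx_basis (cellular_complex X l sg) i = {P \<in> cells X. cell_dim X P = int i - 1}"
  "cx_deg (cellular_complex X l sg) i P = (if P \<in> cells X then face_label l P else 0)"
  "cx_diff (cellular_complex X l sg) i P Q = (if P \<in> cells X \<and> Q \<in> cells X \<and> Q \<subset> P
     then single (face_label l P - face_label l Q) (of_int (sg P Q)) else 0)"
  by (simp_all add: cellular_complex_def)

lemma degree_part_eqI:
  assumes "\<And>\<alpha>. degree_part l \<alpha> f P = degree_part l \<alpha> g P"
  shows "f P = g P"
proof (rule poly_mapping_eqI)
  fix u
  show "lookup (f P) u = lookup (g P) u"
    using assms[of "u + face_label l P"] by (simp add: degree_part_def mono_dvd_add)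
qed

text \<open>
  If \<open>m\<^sub>Q\<close> does not divide \<open>\<alpha>\<close>, neither does the label of any coface of \<open>Q\<close>, and both sides are zero.
\<close>

lemma degree_part_cx_map:
  fixes C :: "('p set, 'v mono, 'v, 'k::field) free_complex"
    and l :: "'p \<Rightarrow> 'v mono" and sg :: "'p set \<Rightarrow> 'p set \<Rightarrow> int"
  assumes fin: "\<And>P. P \<in> cells X \<Longrightarrow> finite P" and Q: "Q \<in> cells X" "cell_dim X Q = int i - 1"
  defines "C \<equiv> cellular_complex X l sg"
  shows "degree_part l \<alpha> (cx_map C i f) Q = chain_boundary X sg (int i) (degree_part l \<alpha> f) Q"
proof -
  let ?Y = "{P \<in> cells X. cell_dim X P = int i}"
  have map: "cx_map C i f Q = (\<Sum>P\<in>?Y. f P * (if Q \<subset> P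
      then single (face_label l P - face_label l Q) (of_int (sg P Q)) else 0))"
    using Q unfolding C_def cx_map_def by (auto intro!: sum.cong)
  show ?thesis
  proof (cases "mono_dvd (face_label l Q) \<alpha>")
    case True
    have "lookup (f P * (if Q \<subset> P then single (face_label l P - face_label l Q) (of_int (sg P Q)) else 0))
          (\<alpha> - face_label l Q) = (if Q \<subset> P then of_int (sg P Q) * degree_part l \<alpha> f P else 0)"
      if P: "P \<in> ?Y" for P
    proof (cases "Q \<subset> P")
      case QP: True
      then have dvd: "mono_dvd (face_label l Q) (face_label l P)"
        using fin P by (intro face_label_mono) auto
      have "lookup (f P * single (face_label l P - face_label l Q) (of_int (sg P Q))) (\<alpha> - face_label l Q)
          = of_int (sg P Q) * degree_part l \<alpha> f P"
      proof (cases "mono_dvd (face_label l P) \<alpha>")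
        case P\<alpha>: True
        have "\<alpha> - face_label l Q = (\<alpha> - face_label l P) + (face_label l P - face_label l Q)"
          using P\<alpha> dvd by (intro poly_mapping_eqI) (auto simp: mono_dvd_def lookup_add lookup_minus)
        then show ?thesis
          using P\<alpha> by (simp add: lookup_mult_single_add degree_part_def)
      next
        case P\<alpha>: False
        have "n + (face_label l P - face_label l Q) \<noteq> \<alpha> - face_label l Q" for n
        proof
          assume "n + (face_label l P - face_label l Q) = \<alpha> - face_label l Q"
          then have "n + (face_label l P - face_label l Q) + face_label l Q = \<alpha>"
            using mono_dvd_diff_add[OF True] by simp
          then have "n + face_label l P = \<alpha>"
            using mono_dvd_diff_add[OF dvd] by (simp add: add.assoc)
          then show False
            using P\<alpha> mono_dvd_add by blast
        qed
        then show ?thesis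
          using P\<alpha> by (simp add: lookup_mult_single_none degree_part_def)
      qed
      then show ?thesis
        using QP by simp
    qed auto
    then show ?thesis
      using True by (simp add: degree_part_def[of _ _ "cx_map C i f"] map lookup_sum chain_boundary_def)
  next
    case False
    have "(if Q \<subset> P then of_int (sg P Q) * degree_part l \<alpha> f P else 0) = 0" if P: "P \<in> ?Y" for P
    proof (cases "Q \<subset> P")
      case True
      then have "mono_dvd (face_label l Q) (face_label l P)"
        using fin P by (intro face_label_mono) auto
      then have "\<not> mono_dvd (face_label l P) \<alpha>"
        using False mono_dvd_trans by blast
      then show ?thesis
        by (simp add: degree_part_def)
    qed auto
    then show ?thesis
      using False by (simp add: degree_part_def[of _ _ "cx_map C i f"] chain_boundary_def)
  qed
qed

lemma cellular_graded:
  assumes fin: "finite (cells X)" "\<And>P. P \<in> cells X \<Longrightarrow> finite P"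
    and V: "\<And>P. P \<in> cells X \<Longrightarrow> keys (face_label l P) \<subseteq> V"
  shows "graded_complex V id (cellular_complex X l sg :: ('p set, 'v mono, 'v, 'k::field) free_complex)"
  unfolding graded_complex_def
proof (intro conjI allI ballI)
  let ?C = "cellular_complex X l sg :: ('p set, 'v mono, 'v, 'k::field) free_complex"
  show "finite (cx_basis ?C i)" for i
    using fin(1) by simp
  fix i P Q assume PQ: "P \<in> cx_basis ?C (Suc i)" "Q \<in> cx_basis ?C i"
  show "cx_diff ?C i P Q \<in> polys V"
    using V[of P] PQ keys_diff_mono[of "face_label l P" "face_label l Q"]
    by (auto intro!: single_in_polys)
  fix m assume m: "m \<in> keys (cx_diff ?C i P Q)"
  then have QP: "Q \<subset> P"
    using m by (auto split: if_splits)
  have "m = face_label l P - face_label l Q"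
    using m by (auto split: if_splits)
  moreover have "mono_dvd (face_label l Q) (face_label l P)"
    using fin(2)[of P] PQ QP by (intro face_label_mono) auto
  ultimately show "id m + cx_deg ?C i Q = cx_deg ?C (Suc i) P"
    using PQ by (simp add: mono_dvd_diff_add)
qed

text \<open>
  A cycle is split into multidegrees, each part is filled inside the complex of boxes of the edges whose
  label divides that degree, and the fillings are assembled into an element of the free module.
\<close>

lemma cellular_exact:
  fixes C :: "('a list set, 'v mono, 'v, 'k::field) free_complex"
    and l :: "'a list \<Rightarrow> 'v mono"
  assumes d: "d > 0" and H: "finite H" and sg: "incidence_function (box_complex d H) sg"
    and V: "\<And>x. x \<in> H \<Longrightarrow> keys (l x) \<subseteq> V"
    and cone: "\<And>\<alpha>. {x \<in> H. mono_dvd (l x) \<alpha>} \<noteq> {} \<Longrightarrow> \<exists>a. cone_point d {x \<in> H. mono_dvd (l x) \<alpha>} a"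
  defines "C \<equiv> cellular_complex (box_complex d H) l sg"
  shows "exact_at V C (Suc i)"
  unfolding exact_at_Suc
proof
  let ?X = "box_complex d H" and ?fl = "face_label l"
  have finX: "finite (cells ?X)"
    by (rule finite_cells[OF H])
  have finP: "finite P" if "P \<in> cells ?X" for P
    using cell_subset[OF that] H by (rule finite_subset)
  have flV: "keys (?fl P) \<subseteq> V" if "P \<in> cells ?X" for P
    using keys_face_label[OF finP[OF that], of l] V cell_subset[OF that] by fastforce
  have graded: "graded_complex V id C"
    unfolding C_def by (rule cellular_graded[OF finX finP flV])
  have dp: "degree_part l \<alpha> (cx_map C j f) Q = chain_boundary ?X sg (int j) (degree_part l \<alpha> f) Q"
    if "Q \<in> cells ?X" "cell_dim ?X Q = int j - 1" for \<alpha> j f Q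
    unfolding C_def by (rule degree_part_cx_map[OF finP that])
  have map0: "cx_map C j f Q = 0" if "\<not> (Q \<in> cells ?X \<and> cell_dim ?X Q = int j - 1)" for j f Q
    using that by (auto simp: cx_map_def C_def)
  show "cx_map C (Suc i) ` cx_module V C (Suc (Suc i)) \<subseteq> {f \<in> cx_module V C (Suc i). cx_map C i f = 0}"
  proof
    fix g assume "g \<in> cx_map C (Suc i) ` cx_module V C (Suc (Suc i))"
    then obtain f where f: "f \<in> cx_module V C (Suc (Suc i))" "g = cx_map C (Suc i) f"
      by blast
    have "cx_map C i g Q = 0" for Q
    proof (cases "Q \<in> cells ?X \<and> cell_dim ?X Q = int i - 1")
      case True
      have "degree_part l \<alpha> (cx_map C i g) Q = degree_part l \<alpha> (\<lambda>_. 0) Q" for \<alpha>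
      proof -
        have "degree_part l \<alpha> (cx_map C i g) Q = chain_boundary ?X sg (int i) (degree_part l \<alpha> g) Q"
          using dp True by blast
        also have "\<dots> = chain_boundary ?X sg (int i) (chain_boundary ?X sg (int i + 1) (degree_part l \<alpha> f)) Q"
          unfolding chain_boundary_def[of _ _ "int i"]
          by (rule sum.cong) (use dp[of _ "Suc i" \<alpha> f] f(2) in \<open>auto simp: add.commute\<close>)
        also have "\<dots> = 0"
          using chain_boundary_boundary[OF H sg] True by blast
        finally show ?thesis
          by (simp add: degree_part_def)
      qed
      then show ?thesis
        by (rule degree_part_eqI)
    qed (rule map0)
    moreover have "g \<in> cx_module V C (Suc i)"
      unfolding f(2) by (rule cx_map_in_cx_module[OF graded f(1)])
    ultimately show "g \<in> {f \<in> cx_module V C (Suc i). cx_map C i f = 0}"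
      by (simp add: fun_eq_iff)
  qed
  show "{f \<in> cx_module V C (Suc i). cx_map C i f = 0} \<subseteq> cx_map C (Suc i) ` cx_module V C (Suc (Suc i))"
  proof
    fix f assume "f \<in> {f \<in> cx_module V C (Suc i). cx_map C i f = 0}"
    then have f: "f \<in> cx_module V C (Suc i)" and cyc: "cx_map C i f = 0"
      by simp_all
    have f_supp: "P \<in> cells ?X \<and> cell_dim ?X P = int i" if "f P \<noteq> 0" for P
      using f that by (auto simp: cx_module_def C_def)
    \<comment> \<open>The finitely many multidegrees in which \<open>f\<close> has a nonzero part; outside of them the filling is
      taken to be zero, which keeps the sum defining \<open>g\<close> finite.\<close>
    define A where "A = (\<Union>P\<in>{P \<in> cells ?X. f P \<noteq> 0}. (\<lambda>u. u + ?fl P) ` keys (f P))"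
    have finA: "finite A"
      using finX by (simp add: A_def)
    have A_V: "keys \<alpha> \<subseteq> V" if \<alpha>: "\<alpha> \<in> A" for \<alpha>
    proof -
      obtain P u where P: "P \<in> cells ?X" "u \<in> keys (f P)" "\<alpha> = u + ?fl P"
        using \<alpha> unfolding A_def by blast
      have "keys u \<subseteq> V"
        using f P(2) by (auto simp: cx_module_def polys_def)
      then show ?thesis
        using flV[OF P(1)] by (simp add: P(3) keys_plus_nat)
    qed
    have notA: "degree_part l \<alpha> f P = 0" if "\<alpha> \<notin> A" for \<alpha> P
    proof (rule ccontr)
      assume nz: "degree_part l \<alpha> f P \<noteq> 0"
      then have *: "mono_dvd (?fl P) \<alpha>" "\<alpha> - ?fl P \<in> keys (f P)"
        by (auto simp: degree_part_def in_keys_iff split: if_splits)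
      then have "f P \<noteq> 0"
        by auto
      then have "\<alpha> - ?fl P + ?fl P \<in> A"
        unfolding A_def using f_supp *(2) by blast
      then show False
        using that mono_dvd_diff_add[OF *(1)] by simp
    qed
    have "\<exists>c. (\<forall>P. c P \<noteq> 0 \<longrightarrow> P \<in> cells ?X \<and> cell_dim ?X P = int i + 1 \<and> mono_dvd (?fl P) \<alpha> \<and> \<alpha> \<in> A) \<and>
        (\<forall>Q\<in>cells ?X. cell_dim ?X Q = int i \<longrightarrow>
           chain_boundary ?X sg (int i + 1) c Q = degree_part l \<alpha> f Q)" for \<alpha>
    proof (cases "\<alpha> \<in> A")
      case False
      then show ?thesis
        by (intro exI[of _ "\<lambda>_. 0"]) (simp add: notA chain_boundary_zero)
    next
      case True
      let ?H = "{x \<in> H. mono_dvd (l x) \<alpha>}"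
      have "\<exists>c. (\<forall>P. c P \<noteq> 0 \<longrightarrow> P \<in> cells (box_complex d ?H) \<and> cell_dim ?X P = int i + 1) \<and>
          (\<forall>Q\<in>cells ?X. cell_dim ?X Q = int i \<longrightarrow>
             chain_boundary ?X sg (int i + 1) c Q = degree_part l \<alpha> f Q)"
      proof (rule box_complex_acyclic[OF d H _ sg cone])
        fix P assume nz: "degree_part l \<alpha> f P \<noteq> 0"
        then have dvd: "mono_dvd (?fl P) \<alpha>" and "f P \<noteq> 0"
          by (auto simp: degree_part_def split: if_splits)
        then have P: "P \<in> cells ?X \<and> cell_dim ?X P = int i"
          by (intro f_supp)
        have "\<forall>x\<in>P. mono_dvd (l x) \<alpha>"
          using dvd face_label_dvd_iff[OF finP, of P l \<alpha>] P by simp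
        then have "P \<subseteq> ?H"
          using cell_subset[of P d H] P by auto
        then show "P \<in> cells (box_complex d ?H) \<and> cell_dim ?X P = int i"
          using cell_mono[of P d H ?H] P by simp
      next
        fix R assume R: "R \<in> cells ?X" "cell_dim ?X R = int i - 1"
        have "chain_boundary ?X sg (int i) (degree_part l \<alpha> f) R = degree_part l \<alpha> (cx_map C i f) R"
          using dp[OF R] by simp
        then show "chain_boundary ?X sg (int i) (degree_part l \<alpha> f) R = 0"
          by (simp add: cyc degree_part_def)
      qed auto
      then obtain c where c: "\<forall>P. c P \<noteq> 0 \<longrightarrow> P \<in> cells (box_complex d ?H) \<and> cell_dim ?X P = int i + 1"
        and bd: "\<forall>Q\<in>cells ?X. cell_dim ?X Q = int i \<longrightarrow>
             chain_boundary ?X sg (int i + 1) c Q = degree_part l \<alpha> f Q"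
        by (elim exE conjE)
      have "P \<in> cells ?X \<and> cell_dim ?X P = int i + 1 \<and> mono_dvd (?fl P) \<alpha> \<and> \<alpha> \<in> A" if "c P \<noteq> 0" for P
      proof -
        have P: "P \<in> cells (box_complex d ?H)" "cell_dim ?X P = int i + 1"
          using c that by auto
        have PH: "P \<subseteq> ?H"
          by (rule cell_subset[OF P(1)])
        then have X: "P \<in> cells ?X"
          using cell_mono[OF P(1), of H] by blast
        have "mono_dvd (?fl P) \<alpha>"
          using face_label_dvd_iff[OF finP[OF X], of l \<alpha>] PH by blast
        then show ?thesis
          using X P(2) True by simp
      qed
      then show ?thesis
        using bd by (intro exI[of _ c]) simp
    qed
    then have "\<exists>c. \<forall>\<alpha>. (\<forall>P. c \<alpha> P \<noteq> 0 \<longrightarrow> P \<in> cells ?X \<and> cell_dim ?X P = int i + 1 \<and> mono_dvd (?fl P) \<alpha> \<and> \<alpha> \<in> A) \<and>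
        (\<forall>Q\<in>cells ?X. cell_dim ?X Q = int i \<longrightarrow>
           chain_boundary ?X sg (int i + 1) (c \<alpha>) Q = degree_part l \<alpha> f Q)"
      by (intro choice allI)
    then obtain c where c: "\<forall>\<alpha>. (\<forall>P. c \<alpha> P \<noteq> 0 \<longrightarrow> P \<in> cells ?X \<and> cell_dim ?X P = int i + 1 \<and> mono_dvd (?fl P) \<alpha> \<and> \<alpha> \<in> A) \<and>
        (\<forall>Q\<in>cells ?X. cell_dim ?X Q = int i \<longrightarrow>
           chain_boundary ?X sg (int i + 1) (c \<alpha>) Q = degree_part l \<alpha> f Q)"
      by (rule exE)
    have c_supp: "P \<in> cells ?X" "cell_dim ?X P = int i + 1" "mono_dvd (?fl P) \<alpha>" "\<alpha> \<in> A" if "c \<alpha> P \<noteq> 0" for \<alpha> P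
      using c that by auto
    have c_bd: "chain_boundary ?X sg (int i + 1) (c \<alpha>) Q = degree_part l \<alpha> f Q"
      if "Q \<in> cells ?X" "cell_dim ?X Q = int i" for \<alpha> Q
      using c that by auto
    define g where "g = (\<lambda>P. \<Sum>\<alpha>\<in>A. single (\<alpha> - ?fl P) (c \<alpha> P))"
    have g_mod: "g \<in> cx_module V C (Suc (Suc i))"
      unfolding cx_module_def
    proof (intro CollectI conjI allI impI)
      fix P
      show "g P \<in> polys V"
        unfolding g_def
      proof (intro sum_in_polys single_in_polys)
        fix \<alpha> assume "\<alpha> \<in> A"
        then show "keys (\<alpha> - ?fl P) \<subseteq> V"
          by (intro order_trans[OF keys_diff_mono A_V])
      qed
      assume "P \<notin> cx_basis C (Suc (Suc i))"
      then have "\<not> (P \<in> cells ?X \<and> cell_dim ?X P = int i + 1)"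
        by (simp add: C_def algebra_simps)
      then have "c \<alpha> P = 0" for \<alpha>
        using c_supp(1,2)[of \<alpha> P] by blast
      then show "g P = 0"
        by (simp add: g_def)
    qed
    have dg: "degree_part l \<alpha> g P = c \<alpha> P" for \<alpha> P
    proof (cases "mono_dvd (?fl P) \<alpha>")
      case False
      then have "c \<alpha> P = 0"
        using c_supp(3) by blast
      then show ?thesis
        using False by (simp add: degree_part_def)
    next
      case True
      have "lookup (g P) (\<alpha> - ?fl P) = (\<Sum>\<beta>\<in>A. if \<beta> = \<alpha> then c \<alpha> P else 0)"
        unfolding g_def lookup_sum
      proof (rule sum.cong[OF refl])
        fix \<beta>
        have "\<beta> = \<alpha>" if "c \<beta> P \<noteq> 0" "\<beta> - ?fl P = \<alpha> - ?fl P"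
          using that(2) mono_dvd_diff_add[OF True] mono_dvd_diff_add[OF c_supp(3)[OF that(1)]] by metis
        then show "lookup (single (\<beta> - ?fl P) (c \<beta> P)) (\<alpha> - ?fl P) = (if \<beta> = \<alpha> then c \<alpha> P else 0)"
          by (auto simp: lookup_single when_def)
      qed
      also have "\<dots> = c \<alpha> P"
        using finA c_supp(4)[of \<alpha> P] by auto
      finally show ?thesis
        using True by (simp add: degree_part_def)
    qed
    have "cx_map C (Suc i) g Q = f Q" for Q
    proof (cases "Q \<in> cells ?X \<and> cell_dim ?X Q = int i")
      case True
      have "degree_part l \<alpha> (cx_map C (Suc i) g) Q = degree_part l \<alpha> f Q" for \<alpha>
      proof -
        have "degree_part l \<alpha> (cx_map C (Suc i) g) Q = chain_boundary ?X sg (int i + 1) (degree_part l \<alpha> g) Q"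
          using dp[of Q "Suc i" \<alpha> g] True by (simp add: add.commute)
        also have "degree_part l \<alpha> g = c \<alpha>"
          using dg by (simp add: fun_eq_iff)
        finally show ?thesis
          using c_bd True by simp
      qed
      then show ?thesis
        by (rule degree_part_eqI)
    next
      case False
      then show ?thesis
        using f_supp map0[of Q "Suc i" g] by auto
    qed
    then have "f = cx_map C (Suc i) g"
      by (simp add: fun_eq_iff)
    then show "f \<in> cx_map C (Suc i) ` cx_module V C (Suc (Suc i))"
      using g_mod by (rule image_eqI)
  qed
qed

definition point_support :: "nat \<Rightarrow> 'a list \<Rightarrow> (nat \<times> 'a) set" where
  "point_support d x = (\<lambda>j. (j, x ! j)) ` {..<d}"

lemma transversal_point_support: "transversal d (point_support d x)"
  by (auto simp: transversal_def point_support_def)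

lemma product_box_point_support: "length x = d \<Longrightarrow> product_box d (point_support d x) = {x}"
  by (auto simp: product_box_def point_support_def image_iff intro!: nth_equalityI)

lemma card_point_support: "card (point_support d x) = d"
  by (simp add: point_support_def card_image inj_on_def)

lemma finite_point_support: "finite (point_support d x)"
  by (simp add: point_support_def)

lemma zero_cells:
  assumes d: "d > 0" and H: "finite H" and len: "\<And>x. x \<in> H \<Longrightarrow> length x = d"
  shows "{P \<in> cells (box_complex d H). cell_dim (box_complex d H) P = 0} = (\<lambda>x. {x}) ` H"
proof (rule subset_antisym; rule subsetI)
  let ?X = "box_complex d H"
  fix P assume "P \<in> (\<lambda>x. {x}) ` H"
  then obtain x where x: "x \<in> H" "P = {x}"
    by blast
  have P: "P = product_box d (point_support d x)"
    by (simp only: product_box_point_support[OF len[OF x(1)]] x(2))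
  have "product_box d (point_support d x) \<subseteq> H"
    unfolding product_box_point_support[OF len[OF x(1)]] using x(1) by simp
  then have "P \<in> cells ?X"
    unfolding P by (rule product_box_in_cells[OF transversal_point_support])
  moreover have "cell_dim ?X P = 0"
    unfolding P cell_dim_product_box[OF transversal_point_support finite_point_support]
    by (simp add: card_point_support)
  ultimately show "P \<in> {P \<in> cells ?X. cell_dim ?X P = 0}"
    by simp
next
  let ?X = "box_complex d H"
  fix P assume "P \<in> {P \<in> cells ?X. cell_dim ?X P = 0}"
  then have P: "P \<in> cells ?X" "cell_dim ?X P = 0"
    by simp_all
  then have P0: "P \<noteq> {}"
    by auto
  then obtain x where x: "x \<in> P"
    by blast
  have xH: "x \<in> H"
    using cell_subset[OF P(1)] x by blast
  have "point_support d x \<subseteq> hyperedge_vertices P"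
    using x len[OF xH] by (auto simp: point_support_def hyperedge_vertices_def)
  moreover have "card (hyperedge_vertices P) = d"
    using cell_dim_nonempty[OF H P(1) P0] P(2) by simp
  ultimately have "point_support d x = hyperedge_vertices P"
    using finite_cell_vertices[OF H P(1)] by (intro card_subset_eq) (simp_all add: card_point_support)
  then have "P = {x}"
    using nonempty_cell(2)[OF P(1) P0] product_box_point_support[OF len[OF xH]] by simp
  then show "P \<in> (\<lambda>x. {x}) ` H"
    using xH by blast
qed

text \<open>
  The degree of a label minus the dimension of its face is \<open>d\<close> for all nonempty faces. So the labels of a
  face and of a nonempty facet differ by one variable, and vertex labels have degree \<open>d\<close>, which gives linearity
  and minimality.
\<close>

theorem box_resolution:
  fixes H :: "'a list set" and l :: "'a list \<Rightarrow> 'v mono"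
  assumes d: "d > 0" and H: "finite H" and len: "\<And>x. x \<in> H \<Longrightarrow> length x = d"
    and V: "\<And>x. x \<in> H \<Longrightarrow> keys (l x) \<subseteq> V"
    and cone: "\<And>\<alpha>. {x \<in> H. mono_dvd (l x) \<alpha>} \<noteq> {} \<Longrightarrow> \<exists>a. cone_point d {x \<in> H. mono_dvd (l x) \<alpha>} a"
    and deg: "\<And>P. P \<in> cells (box_complex d H) \<Longrightarrow> P \<noteq> {} \<Longrightarrow>
      mono_deg (face_label l P) = card (hyperedge_vertices P)"
  shows "minimal_linear_cellular_resolution V d (box_complex d H) l
    (monomial_ideal V (l ` H) :: ('v, 'k::field) mpoly set)"
  unfolding minimal_linear_cellular_resolution_def Let_def
proof (intro conjI allI impI)
  let ?X = "box_complex d H" and ?fl = "face_label l"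
  show "\<exists>sg. incidence_function ?X sg"
    by (rule box_complex_orientable[OF H])
  fix sg assume sg: "incidence_function ?X sg"
  define C :: "('a list set, 'v mono, 'v, 'k) free_complex" where "C = cellular_complex ?X l sg"
  have finP: "finite P" if "P \<in> cells ?X" for P
    using cell_subset[OF that] H by (rule finite_subset)
  have flV: "keys (?fl P) \<subseteq> V" if "P \<in> cells ?X" for P
    using keys_face_label[OF finP[OF that], of l] V cell_subset[OF that] by fastforce
  have graded: "graded_complex V id C"
    unfolding C_def by (rule cellular_graded[OF finite_cells[OF H] finP flV])
  have deg': "mono_deg (?fl P) = nat (cell_dim ?X P) + d" if P: "P \<in> cells ?X" "P \<noteq> {}" for P
    using deg[OF P] cell_dim_nonempty[OF H P] cell_dim_eq_minus1_iff(2)[OF H P] by simp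
  have basis0: "cx_basis C 0 = {{}}"
    unfolding C_def using cell_dim_eq_minus1_iff(1)[OF H, of _ d] by auto
  have basis1: "cx_basis C (Suc 0) = (\<lambda>x. {x}) ` H"
    using zero_cells[OF d H len] by (simp add: C_def)
  have entry: "mono_deg (?fl P - ?fl Q) = mono_deg (?fl P) - mono_deg (?fl Q)"
    if "P \<in> cells ?X" "Q \<in> cells ?X" "Q \<subset> P" for P Q
  proof -
    have "?fl P - ?fl Q + ?fl Q = ?fl P"
      using face_label_mono[OF finP[OF that(1)], of Q l] that(3) by (intro mono_dvd_diff_add) auto
    then have "mono_deg (?fl P) = mono_deg (?fl P - ?fl Q) + mono_deg (?fl Q)"
      by (metis mono_deg_add)
    then show ?thesis
      by simp
  qed
  have entry_pos: "?fl P - ?fl Q \<noteq> 0" if PQ: "P \<in> cells ?X" "cell_dim ?X P = int i"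
      "Q \<in> cells ?X" "cell_dim ?X Q = int i - 1" "Q \<subset> P" for P Q i
  proof -
    have P0: "P \<noteq> {}"
      using PQ(5) by auto
    have "mono_deg (?fl Q) < mono_deg (?fl P)"
    proof (cases "Q = {}")
      case True
      then show ?thesis
        using deg'[OF PQ(1) P0] d by simp
    next
      case False
      then show ?thesis
        using deg'[OF PQ(1) P0] deg'[OF PQ(3) False] cell_dim_eq_minus1_iff(2)[OF H PQ(3) False] PQ(2,4) by simp
    qed
    then have "mono_deg (?fl P - ?fl Q) \<noteq> 0"
      using entry[OF PQ(1,3,5)] by simp
    then show ?thesis
      by auto
  qed
  have image: "(\<lambda>f. cx_map C 0 f {}) ` cx_module V C 1 = monomial_ideal V (l ` H)"
  proof -
    have map: "cx_map C 0 f {} = (\<Sum>x\<in>H. f {x} * single (l x) 1)" for f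
    proof -
      have "cx_map C 0 f {} = (\<Sum>P\<in>(\<lambda>x. {x}) ` H. f P * cx_diff C 0 P {})"
        using basis0 basis1 by (simp add: cx_map_def)
      also have "\<dots> = (\<Sum>x\<in>H. f {x} * cx_diff C 0 {x} {})"
        by (simp add: sum.reindex)
      also have "\<dots> = (\<Sum>x\<in>H. f {x} * single (l x) 1)"
      proof (rule sum.cong[OF refl])
        fix x assume "x \<in> H"
        then have x: "{x} \<in> cells ?X" "cell_dim ?X {x} = 0"
          using zero_cells[OF d H len] by auto
        then have "sg {x} {} = 1"
          using sg unfolding incidence_function_def by blast
        then show "f {x} * cx_diff C 0 {x} {} = f {x} * single (l x) 1"
          using x(1) by (simp add: C_def psubset_eq)
      qed
      finally show ?thesis .
    qed
    have "(\<lambda>f. \<Sum>x\<in>H. f {x} * single (l x) (1 :: 'k)) ` cx_module V C 1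
        = {\<Sum>x\<in>H. h x * single (l x) (1 :: 'k) | h. \<forall>x\<in>H. h x \<in> polys V}"
    proof (rule subset_antisym; rule subsetI)
      fix p assume "p \<in> (\<lambda>f. \<Sum>x\<in>H. f {x} * single (l x) (1 :: 'k)) ` cx_module V C 1"
      then obtain f where f: "f \<in> cx_module V C 1" "p = (\<Sum>x\<in>H. f {x} * single (l x) 1)"
        by (rule imageE)
      then show "p \<in> {\<Sum>x\<in>H. h x * single (l x) (1 :: 'k) | h. \<forall>x\<in>H. h x \<in> polys V}"
        by (intro CollectI exI[of _ "\<lambda>x. f {x}"]) (simp add: cx_module_polys)
    next
      fix p assume "p \<in> {\<Sum>x\<in>H. h x * single (l x) (1::'k) | h. \<forall>x\<in>H. h x \<in> polys V}"
      then have "\<exists>h. p = (\<Sum>x\<in>H. h x * single (l x) 1) \<and> (\<forall>x\<in>H. h x \<in> polys V)"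
        by simp
      then obtain h where h: "p = (\<Sum>x\<in>H. h x * single (l x) 1)" "\<forall>x\<in>H. h x \<in> polys V"
        by (elim exE conjE)
      let ?f = "\<lambda>P. if P \<in> (\<lambda>x. {x}) ` H then h (the_elem P) else 0"
      have "?f \<in> cx_module V C 1"
        using h(2) basis1 by (auto simp: cx_module_def)
      moreover have "p = (\<Sum>x\<in>H. ?f {x} * single (l x) 1)"
        unfolding h(1) by (rule sum.cong) auto
      ultimately show "p \<in> (\<lambda>f. \<Sum>x\<in>H. f {x} * single (l x) 1) ` cx_module V C 1"
        by (intro image_eqI)
    qed
    also have "\<dots> = monomial_ideal V (l ` H)"
      by (rule monomial_ideal_combinations[OF H, symmetric]) (rule V)
    finally show ?thesis
      unfolding map .
  qed
  have exact: "exact_at V C (Suc i)" for i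
    unfolding C_def by (rule cellular_exact[OF d H sg V cone])
  show "resolves_quotient V (monomial_ideal V (l ` H)) (cellular_complex ?X l sg :: ('a list set, 'v mono, 'v, 'k) free_complex)"
    unfolding resolves_quotient_def C_def[symmetric]
  proof (intro conjI exI[of _ "{}"] allI impI)
    show "cx_deg C 0 {} = 0"
      by (simp add: C_def)
    show "exact_at V C i" if "i \<ge> 1" for i
      using exact[of "i - 1"] that by simp
  qed (fact graded basis0 image)+
  show "minimal_complex (cellular_complex ?X l sg :: ('a list set, 'v mono, 'v, 'k) free_complex)"
    unfolding minimal_complex_def
    using entry_pos by (auto simp: lookup_single when_def)
  show "linear_complex d (cellular_complex ?X l sg :: ('a list set, 'v mono, 'v, 'k) free_complex)"
    unfolding linear_complex_def
  proof (intro conjI allI ballI impI)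
    fix i P assume "P \<in> cx_basis (cellular_complex ?X l sg :: ('a list set, 'v mono, 'v, 'k) free_complex) (Suc i)"
    then have P: "P \<in> cells ?X" "cell_dim ?X P = int i"
      by simp_all
    moreover have "P \<noteq> {}"
      using P(2) by auto
    ultimately show "mono_deg (cx_deg (cellular_complex ?X l sg :: ('a list set, 'v mono, 'v, 'k) free_complex) (Suc i) P) = i + d"
      using deg' by simp
  next
    fix i :: nat and P Q m assume i: "i \<ge> 1"
      and "P \<in> cx_basis (cellular_complex ?X l sg :: ('a list set, 'v mono, 'v, 'k) free_complex) (Suc i)"
      and "Q \<in> cx_basis (cellular_complex ?X l sg :: ('a list set, 'v mono, 'v, 'k) free_complex) i"
      and m: "m \<in> keys (cx_diff (cellular_complex ?X l sg :: ('a list set, 'v mono, 'v, 'k) free_complex) i P Q)"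
    then have P: "P \<in> cells ?X" "cell_dim ?X P = int i" and Q: "Q \<in> cells ?X" "cell_dim ?X Q = int i - 1"
      by simp_all
    have QP: "Q \<subset> P" and m': "m = ?fl P - ?fl Q"
      using m by (auto split: if_splits)
    have "P \<noteq> {}" "Q \<noteq> {}"
      using i P(2) Q(2) by auto
    then show "mono_deg m = 1"
      unfolding m' entry[OF P(1) Q(1) QP] using deg'[OF P(1)] deg'[OF Q(1)] P(2) Q(2) i by simp
  qed
qed

lemma betti_of_cellular_resolution:
  fixes I :: "('v, 'k::field) mpoly set" and X :: "'b cell_complex"
  assumes "minimal_linear_cellular_resolution V d X l I"
  shows "fine_betti V I i \<alpha> = card {P \<in> cells X. cell_dim X P = int i \<and> face_label l P = \<alpha>}"
    and "Z_betti V I i j = (if j = i + d then card {P \<in> cells X. cell_dim X P = int i} else 0)"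
proof -
  obtain sg where "incidence_function X sg"
    using assms unfolding minimal_linear_cellular_resolution_def by blast
  then have C: "resolves_quotient V I (cellular_complex X l sg :: ('b set, 'v mono, 'v, 'k) free_complex)"
      "minimal_complex (cellular_complex X l sg :: ('b set, 'v mono, 'v, 'k) free_complex)"
      "linear_complex d (cellular_complex X l sg :: ('b set, 'v mono, 'v, 'k) free_complex)"
    using assms unfolding minimal_linear_cellular_resolution_def Let_def by simp_all
  show "fine_betti V I i \<alpha> = card {P \<in> cells X. cell_dim X P = int i \<and> face_label l P = \<alpha>}"
    unfolding fine_betti_minimal[OF C(1,2)] by (rule arg_cong[of _ _ card]) auto
  have "mono_deg (face_label l P) = i + d" if "P \<in> cells X" "cell_dim X P = int i" for P
    using C(3) that unfolding linear_complex_def by fastforce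
  then have "{P \<in> cx_basis (cellular_complex X l sg :: ('b set, 'v mono, 'v, 'k) free_complex) (Suc i).
      mono_deg (cx_deg (cellular_complex X l sg :: ('b set, 'v mono, 'v, 'k) free_complex) (Suc i) P) = j}
    = (if j = i + d then {P \<in> cells X. cell_dim X P = int i} else {})"
    by auto
  then show "Z_betti V I i j = (if j = i + d then card {P \<in> cells X. cell_dim X P = int i} else 0)"
    unfolding Z_betti_minimal[OF C(1,2)] by simp
qed

section \<open>Hypergraphs closed under exchange\<close>

text \<open>
  The numbers \<open>key j v\<close> order the vertices of part \<open>j\<close>; for \<open>F(K)\<close> and \<open>F(M)\<close> they are the vertices
  themselves, for a Ferrers hypergraph they are ranks.
\<close>

definition exchange_closed :: "(nat \<Rightarrow> 'a \<Rightarrow> nat) \<Rightarrow> nat \<Rightarrow> 'a list set \<Rightarrow> bool" where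
  "exchange_closed key d H \<longleftrightarrow> (\<forall>x\<in>H. \<forall>y\<in>H. \<forall>j<d.
     (\<forall>i<j. x ! i = y ! i) \<longrightarrow> key j (y ! j) \<le> key j (x ! j) \<longrightarrow> x[j := y ! j] \<in> H)"

text \<open>
  The cone point is chosen greedily. With the coordinates before \<open>t\<close> fixed, the next one is taken with
  least key. This does not disturb the earlier conditions, which involve only earlier coordinates of \<open>a\<close>.
\<close>

lemma exchange_closed_cone_point:
  assumes H: "H \<noteq> {}" and len: "\<And>x. x \<in> H \<Longrightarrow> length x = d" and ex: "exchange_closed key d H"
  shows "\<exists>a. cone_point d H a"
proof -
  have "\<exists>a\<in>H. \<forall>x\<in>H. \<forall>j<t. (\<forall>i<j. x ! i = a ! i) \<longrightarrow> x[j := a ! j] \<in> H" if "t \<le> d" for t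
    using that
  proof (induction t)
    case 0
    then show ?case
      using H by auto
  next
    case (Suc t)
    then have "\<exists>a\<in>H. \<forall>x\<in>H. \<forall>j<t. (\<forall>i<j. x ! i = a ! i) \<longrightarrow> x[j := a ! j] \<in> H"
      by simp
    then obtain a where a: "a \<in> H" "\<forall>x\<in>H. \<forall>j<t. (\<forall>i<j. x ! i = a ! i) \<longrightarrow> x[j := a ! j] \<in> H"
      by (elim bexE)
    let ?P = "\<lambda>y. y \<in> H \<and> (\<forall>i<t. y ! i = a ! i)"
    define b where "b = arg_min (\<lambda>y. key t (y ! t)) ?P"
    have "?P a"
      using a(1) by simp
    then have b: "?P b" and least: "\<And>y. ?P y \<Longrightarrow> key t (b ! t) \<le> key t (y ! t)"
      using arg_min_nat_lemma[of ?P a "\<lambda>y. key t (y ! t)"] unfolding b_def by blast+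
    have "x[j := b ! j] \<in> H" if x: "x \<in> H" "j < Suc t" "\<forall>i<j. x ! i = b ! i" for x j
    proof (cases "j = t")
      case True
      then have "?P x"
        using x b by simp
      then have "key t (b ! t) \<le> key t (x ! t)"
        by (rule least)
      then show ?thesis
        using ex x b Suc.prems True unfolding exchange_closed_def by auto
    next
      case False
      then have "j < t"
        using x(2) by simp
      then show ?thesis
        using a(2) x b by simp
    qed
    then show ?case
      using b by blast
  qed
  from this[OF order_refl] obtain a where "a \<in> H"
    "\<forall>x\<in>H. \<forall>j<d. (\<forall>i<j. x ! i = a ! i) \<longrightarrow> x[j := a ! j] \<in> H"
    by (elim bexE)
  then show ?thesis
    using len unfolding cone_point_def by blast
qed

text \<open>
  Divisibility of the label by the variables of part \<open>p\<close> depends on the coordinate \<open>p\<close> alone, and each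
  coordinate of the new edge is a coordinate of \<open>x\<close> or of \<open>y\<close>.
\<close>

lemma edge_label_exchange_closed:
  assumes len: "\<And>x. x \<in> H \<Longrightarrow> length x = d" and ex: "exchange_closed key d H"
  shows "exchange_closed key d {x \<in> H. mono_dvd (vertex_label Pair x) \<alpha>}"
  unfolding exchange_closed_def
proof (intro ballI allI impI)
  let ?H = "{x \<in> H. mono_dvd (vertex_label Pair x) \<alpha>}"
  fix x y j assume x: "x \<in> ?H" and y: "y \<in> ?H" and j: "j < d"
    and eq: "\<forall>i<j. x ! i = y ! i" and key: "key j (y ! j) \<le> key j (x ! j)"
  have lens: "length x = d" "length y = d"
    using x y len by auto
  have "lookup (vertex_label Pair (x[j := y ! j])) v \<le> lookup \<alpha> v" for v
  proof (cases "fst v = j")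
    case True
    then have "{i. i < length (x[j := y ! j]) \<and> (i, x[j := y ! j] ! i) = v} = {i. i < length y \<and> (i, y ! i) = v}"
      using lens j by (auto simp: nth_list_update)
    then have "lookup (vertex_label Pair (x[j := y ! j])) v = lookup (vertex_label Pair y) v"
      by (simp only: lookup_vertex_label)
    then show ?thesis
      using y by (simp add: mono_dvd_def del: split_paired_All)
  next
    case False
    then have "{i. i < length (x[j := y ! j]) \<and> (i, x[j := y ! j] ! i) = v} = {i. i < length x \<and> (i, x ! i) = v}"
      by (auto simp: nth_list_update)
    then have "lookup (vertex_label Pair (x[j := y ! j])) v = lookup (vertex_label Pair x) v"
      by (simp only: lookup_vertex_label)
    then show ?thesis
      using x by (simp add: mono_dvd_def del: split_paired_All)
  qed
  moreover have "x[j := y ! j] \<in> H"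
    using ex x y j eq key unfolding exchange_closed_def by blast
  ultimately show "x[j := y ! j] \<in> ?H"
    by (simp add: mono_dvd_def)
qed

text \<open>
  The multiplicity of the new value \<open>y\<^sub>j < x\<^sub>j\<close> is at most that in \<open>y\<close>: since \<open>x\<close> is sorted, the value does not
  occur after position \<open>j\<close>, and up to position \<open>j\<close> the new edge coincides with \<open>y\<close>. No other multiplicity grows.
\<close>

lemma sp_label_exchange_closed:
  fixes H :: "nat list set"
  assumes len: "\<And>x. x \<in> H \<Longrightarrow> length x = d" and sorted: "\<And>x. x \<in> H \<Longrightarrow> sorted x"
    and ex: "exchange_closed (\<lambda>_ v. v) d H"
  shows "exchange_closed (\<lambda>_ v. v) d {x \<in> H. mono_dvd (vertex_label (\<lambda>_ v. v) x) \<alpha>}"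
  unfolding exchange_closed_def
proof (intro ballI allI impI)
  let ?H = "{x \<in> H. mono_dvd (vertex_label (\<lambda>_ v. v) x) \<alpha>}"
  fix x y j assume x: "x \<in> ?H" and y: "y \<in> ?H" and j: "j < d"
    and eq: "\<forall>i<j. x ! i = y ! i" and le: "y ! j \<le> x ! j"
  have lens: "length x = d" "length y = d"
    using x y len by auto
  let ?x = "x[j := y ! j]"
  have "lookup (vertex_label (\<lambda>_ v. v) ?x) v \<le> lookup \<alpha> v" for v
  proof (cases "v = y ! j \<and> y ! j < x ! j")
    case True
    have "i \<le> j" if "i < d" "?x ! i = v" for i
    proof (rule ccontr)
      assume "\<not> i \<le> j"
      then have "x ! j \<le> x ! i" "x ! i = v"
        using sorted x that lens by (auto simp: sorted_iff_nth_mono)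
      then show False
        using True by simp
    qed
    then have "{i. i < length ?x \<and> ?x ! i = v} \<subseteq> {i. i < length y \<and> y ! i = v}"
      using lens eq j by (auto simp: nth_list_update split: if_splits) (metis le_neq_implies_less nth_list_update_neq)
    then have "lookup (vertex_label (\<lambda>_ v. v) ?x) v \<le> lookup (vertex_label (\<lambda>_ v. v) y) v"
      unfolding lookup_vertex_label by (intro card_mono) auto
    then show ?thesis
      using y unfolding mono_dvd_def by (auto intro: order_trans)
  next
    case False
    then have "{i. i < length ?x \<and> ?x ! i = v} \<subseteq> {i. i < length x \<and> x ! i = v}"
      using le lens j by (auto simp: nth_list_update split: if_splits)
    then have "lookup (vertex_label (\<lambda>_ v. v) ?x) v \<le> lookup (vertex_label (\<lambda>_ v. v) x) v"
      unfolding lookup_vertex_label by (intro card_mono) auto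
    then show ?thesis
      using x unfolding mono_dvd_def by (auto intro: order_trans)
  qed
  moreover have "?x \<in> H"
    using ex x y j eq le unfolding exchange_closed_def by blast
  ultimately show "?x \<in> ?H"
    by (simp add: mono_dvd_def)
qed

lemma keys_vertex_label: "keys (vertex_label t x) = {t j (x ! j) | j. j < length x}"
  by (auto simp: in_keys_iff lookup_vertex_label card_eq_0_iff)

theorem edge_resolution:
  fixes H :: "'a list set"
  assumes d: "d > 0" and H: "finite H" and len: "\<And>x. x \<in> H \<Longrightarrow> length x = d"
    and V: "hyperedge_vertices H \<subseteq> V" and ex: "exchange_closed key d H"
  shows "minimal_linear_cellular_resolution V d (box_complex d H) edge_monomial
    (monomial_ideal V (edge_monomial ` H) :: (nat \<times> 'a, 'k::field) mpoly set)"
  unfolding edge_monomial_eq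
proof (rule box_resolution[OF d H len])
  show "keys (vertex_label Pair x) \<subseteq> V" if "x \<in> H" for x
    using V that by (auto simp: keys_vertex_label hyperedge_vertices_def)
  show "\<exists>a. cone_point d {x \<in> H. mono_dvd (vertex_label Pair x) \<alpha>} a"
    if "{x \<in> H. mono_dvd (vertex_label Pair x) \<alpha>} \<noteq> {}" for \<alpha>
    using len by (intro exchange_closed_cone_point[OF that _ edge_label_exchange_closed[OF len ex]]) auto
  show "mono_deg (face_label (vertex_label Pair) P) = card (hyperedge_vertices P)"
    if "P \<in> cells (box_complex d H)" "P \<noteq> {}" for P
    by (rule mono_deg_face_label_cell[OF H that]) (simp add: inj_on_def)
qed

theorem sp_resolution:
  fixes H :: "nat list set"
  assumes d: "d > 0" and H: "finite H" and len: "\<And>x. x \<in> H \<Longrightarrow> length x = d"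
    and sorted: "\<And>x. x \<in> H \<Longrightarrow> sorted x"
    and V: "\<And>x. x \<in> H \<Longrightarrow> set x \<subseteq> V" and ex: "exchange_closed (\<lambda>_ v. v) d H"
  shows "minimal_linear_cellular_resolution V d (box_complex d H) sp_edge_monomial
    (monomial_ideal V (sp_edge_monomial ` H) :: (nat, 'k::field) mpoly set)"
  unfolding sp_edge_monomial_eq
proof (rule box_resolution[OF d H len])
  show "keys (vertex_label (\<lambda>_ v. v) x) \<subseteq> V" if "x \<in> H" for x
    using V[OF that] by (auto simp: keys_vertex_label)
  show "\<exists>a. cone_point d {x \<in> H. mono_dvd (vertex_label (\<lambda>_ v. v) x) \<alpha>} a"
    if "{x \<in> H. mono_dvd (vertex_label (\<lambda>_ v. v) x) \<alpha>} \<noteq> {}" for \<alpha>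
    using len by (intro exchange_closed_cone_point[OF that _ sp_label_exchange_closed[OF len sorted ex]]) auto
  show "mono_deg (face_label (vertex_label (\<lambda>_ v. v)) P) = card (hyperedge_vertices P)"
    if "P \<in> cells (box_complex d H)" "P \<noteq> {}" for P
    by (rule mono_deg_face_label_cell[OF H that]) simp
qed

section \<open>Multigraded Betti numbers of box resolutions\<close>

lemma box_degree_eq:
  assumes "finite (box_support Xs)"
  shows "box_degree Xs = (\<Sum>u\<in>box_support Xs. single u 1)"
    and "(\<Sum>Y\<leftarrow>Xs. card Y) = card (box_support Xs)"
proof -
  have Sig: "box_support Xs = Sigma {..<length Xs} (\<lambda>j. Xs ! j)"
    by (auto simp: box_support_def)
  have fin: "finite (Xs ! j)" if "j < length Xs" for j
  proof (rule finite_subset)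
    show "Xs ! j \<subseteq> snd ` box_support Xs"
      using that by (force simp: box_support_def)
  qed (use assms in simp)
  have "(\<Sum>u\<in>Sigma {..<length Xs} (\<lambda>j. Xs ! j). single u (1::nat)) = box_degree Xs"
    unfolding box_degree_def using fin by (subst sum.Sigma) (auto intro: sum.cong)
  then show "box_degree Xs = (\<Sum>u\<in>box_support Xs. single u 1)"
    by (simp add: Sig)
  have "(\<Sum>Y\<leftarrow>Xs. card Y) = (\<Sum>j<length Xs. card (Xs ! j))"
    by (simp add: sum_list_sum_nth atLeast0LessThan)
  also have "\<dots> = card (box_support Xs)"
    unfolding Sig using fin by (subst card_SigmaI) auto
  finally show "(\<Sum>Y\<leftarrow>Xs. card Y) = card (box_support Xs)" .
qed

lemma sum_single_inj:
  assumes "finite A" "finite B" "(\<Sum>a\<in>A. single a (1::nat)) = (\<Sum>b\<in>B. single b 1)"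
  shows "A = B"
proof -
  have "lookup (\<Sum>a\<in>A. single a (1::nat)) v = (if v \<in> A then 1 else 0)" if "finite A" for A :: "'a set" and v
    unfolding lookup_sum using that by (simp add: lookup_single when_def)
  then have "(if v \<in> A then 1 else 0 :: nat) = (if v \<in> B then 1 else 0)" for v
    using assms by metis
  then show ?thesis
    by (auto split: if_splits) (metis zero_neq_one)+
qed

text \<open>
  A box is determined by the indicator vector of its support, so each multidegree is carried by at most
  one face.
\<close>

theorem fine_betti_boxes:
  fixes H :: "'a list set" and I :: "(nat \<times> 'a, 'k::field) mpoly set"
  assumes H: "finite H" and res: "minimal_linear_cellular_resolution V d (box_complex d H) edge_monomial I"
  shows "\<forall>Xs\<in>boxes d H. fine_betti V I ((\<Sum>Y\<leftarrow>Xs. card Y) - d) (box_degree Xs) = 1"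
    and "\<forall>i \<alpha>. (\<nexists>Xs. Xs \<in> boxes d H \<and> i = (\<Sum>Y\<leftarrow>Xs. card Y) - d \<and> \<alpha> = box_degree Xs) \<longrightarrow>
      fine_betti V I i \<alpha> = 0"
proof -
  let ?X = "box_complex d H"
  have box: "transversal d (box_support Xs)" "product_box d (box_support Xs) \<subseteq> H" "finite (box_support Xs)"
    if "Xs \<in> boxes d H" for Xs
  proof -
    have "box_support Xs \<in> {U. transversal d U \<and> product_box d U \<subseteq> H}"
      using bij_betwE[OF bij_betw_box_support] that by blast
    then show tr: "transversal d (box_support Xs)" and sub: "product_box d (box_support Xs) \<subseteq> H"
      by simp_all
    show "finite (box_support Xs)"
      using finite_cell_vertices[OF H product_box_in_cells[OF tr sub]] tr by simp
  qed
  have label: "face_label edge_monomial (product_box d U) = (\<Sum>u\<in>U. single u 1)"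
    if "transversal d U" "finite U" for U :: "(nat \<times> 'a) set"
    unfolding edge_monomial_eq using face_label_product_box[OF that, of Pair] by (simp add: inj_on_def)
  have faces: "{P \<in> cells ?X. cell_dim ?X P = int i \<and> face_label edge_monomial P = \<alpha>}
      = (\<lambda>Xs. product_box d (box_support Xs)) ` {Xs \<in> boxes d H. i = (\<Sum>Y\<leftarrow>Xs. card Y) - d \<and> \<alpha> = box_degree Xs}" for i \<alpha>
  proof (rule subset_antisym; rule subsetI)
    fix P assume "P \<in> (\<lambda>Xs. product_box d (box_support Xs)) ` {Xs \<in> boxes d H. i = (\<Sum>Y\<leftarrow>Xs. card Y) - d \<and> \<alpha> = box_degree Xs}"
    then obtain Xs where Xs: "Xs \<in> boxes d H" "i = (\<Sum>Y\<leftarrow>Xs. card Y) - d" "\<alpha> = box_degree Xs"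
      and P: "P = product_box d (box_support Xs)"
      by blast
    note b = box[OF Xs(1)]
    show "P \<in> {P \<in> cells ?X. cell_dim ?X P = int i \<and> face_label edge_monomial P = \<alpha>}"
      unfolding P Xs(2,3) using product_box_in_cells[OF b(1,2)] label[OF b(1,3)] card_transversal_ge[OF b(1,3)]
      by (simp add: cell_dim_product_box[OF b(1,3)] box_degree_eq[OF b(3)])
  next
    fix P assume "P \<in> {P \<in> cells ?X. cell_dim ?X P = int i \<and> face_label edge_monomial P = \<alpha>}"
    then have P: "P \<in> cells ?X" "cell_dim ?X P = int i" "face_label edge_monomial P = \<alpha>"
      by simp_all
    then have P0: "P \<noteq> {}"
      by auto
    have "hyperedge_vertices P \<in> {U. transversal d U \<and> product_box d U \<subseteq> H}"
      using nonempty_cell[OF P(1) P0] by simp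
    then have "hyperedge_vertices P \<in> box_support ` boxes d H"
      using bij_betw_imp_surj_on[OF bij_betw_box_support, of d H] by simp
    then obtain Xs where Xs: "hyperedge_vertices P = box_support Xs" "Xs \<in> boxes d H"
      by (rule imageE)
    note b = box[OF Xs(2)]
    have PX: "P = product_box d (box_support Xs)"
      using nonempty_cell(2)[OF P(1) P0] Xs(1) by simp
    have "int i = int (card (box_support Xs)) - int d"
      using P(2) cell_dim_nonempty[OF H P(1) P0] Xs(1) by simp
    then have "i = (\<Sum>Y\<leftarrow>Xs. card Y) - d"
      by (simp add: box_degree_eq(2)[OF b(3)])
    moreover have "\<alpha> = box_degree Xs"
      using P(3) label[OF b(1,3)] by (simp add: PX box_degree_eq(1)[OF b(3)])
    ultimately show "P \<in> (\<lambda>Xs. product_box d (box_support Xs)) ` {Xs \<in> boxes d H. i = (\<Sum>Y\<leftarrow>Xs. card Y) - d \<and> \<alpha> = box_degree Xs}"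
      using Xs(2) PX by (intro image_eqI[of _ _ Xs]) simp_all
  qed
  show "\<forall>Xs\<in>boxes d H. fine_betti V I ((\<Sum>Y\<leftarrow>Xs. card Y) - d) (box_degree Xs) = 1"
  proof
    fix Xs assume Xs: "Xs \<in> boxes d H"
    have "Ys = Xs" if Ys: "Ys \<in> boxes d H" "box_degree Xs = box_degree Ys" for Ys
    proof -
      have "box_support Ys = box_support Xs"
        using Ys(2) unfolding box_degree_eq(1)[OF box(3)[OF Xs]] box_degree_eq(1)[OF box(3)[OF Ys(1)]]
        by (intro sum_single_inj[OF box(3)[OF Ys(1)] box(3)[OF Xs]]) simp
      then show ?thesis
        using inj_onD[OF bij_betw_imp_inj_on[OF bij_betw_box_support]] Ys(1) Xs by blast
    qed
    then have "{Ys \<in> boxes d H. (\<Sum>Y\<leftarrow>Xs. card Y) - d = (\<Sum>Y\<leftarrow>Ys. card Y) - d \<and> box_degree Xs = box_degree Ys} = {Xs}"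
      using Xs by blast
    then show "fine_betti V I ((\<Sum>Y\<leftarrow>Xs. card Y) - d) (box_degree Xs) = 1"
      unfolding betti_of_cellular_resolution(1)[OF res] faces by simp
  qed
  show "\<forall>i \<alpha>. (\<nexists>Xs. Xs \<in> boxes d H \<and> i = (\<Sum>Y\<leftarrow>Xs. card Y) - d \<and> \<alpha> = box_degree Xs) \<longrightarrow>
      fine_betti V I i \<alpha> = 0"
  proof (intro allI impI)
    fix i \<alpha> assume "\<nexists>Xs. Xs \<in> boxes d H \<and> i = (\<Sum>Y\<leftarrow>Xs. card Y) - d \<and> \<alpha> = box_degree Xs"
    then have "{Xs \<in> boxes d H. i = (\<Sum>Y\<leftarrow>Xs. card Y) - d \<and> \<alpha> = box_degree Xs} = {}"
      by blast
    then show "fine_betti V I i \<alpha> = 0"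
      unfolding betti_of_cellular_resolution(1)[OF res] faces by (simp only: image_empty card.empty)
  qed
qed

section \<open>Specialization\<close>

lemma sp_mono_add: "sp_mono (m + n) = sp_mono m + sp_mono n"
  unfolding sp_mono_def by (rule setsum_keys_plus_distrib) (simp_all add: single_add)

lemma sp_mono_zero [simp]: "sp_mono 0 = 0"
  by (simp add: sp_mono_def)

lemma sp_mono_single: "sp_mono (single u n) = single (snd u) n"
  by (cases "n = 0") (simp_all add: sp_mono_def)

lemma sp_mono_sum: "finite A \<Longrightarrow> sp_mono (sum f A) = (\<Sum>a\<in>A. sp_mono (f a))"
  by (induction A rule: finite_induct) (simp_all add: sp_mono_add)

lemma sp_mono_face_label:
  assumes H: "finite H" and P: "P \<in> cells (box_complex d H)"
  shows "sp_mono (face_label edge_monomial P) = face_label sp_edge_monomial P"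
proof (cases "P = {}")
  case False
  show ?thesis
    unfolding edge_monomial_eq sp_edge_monomial_eq
    using face_label_cell[OF H P False, of Pair] face_label_cell[OF H P False, of "\<lambda>_ v. v"]
      sp_mono_sum[OF finite_cell_vertices[OF H P], of "\<lambda>u. single u 1"]
    by (simp add: inj_on_def sp_mono_single)
qed simp

lemma sp_single: "sp (single m c) = single (sp_mono m) c"
  by (cases "c = 0") (simp_all add: sp_def)

theorem sp_cellular_complex:
  assumes H: "finite H"
  shows "sp_complex (cellular_complex (box_complex d H) edge_monomial sg
      :: (nat list set, (nat \<times> nat) mono, nat \<times> nat, 'k::field) free_complex)
    = cellular_complex (box_complex d H) sp_edge_monomial sg"
proof -
  let ?X = "box_complex d H"
  have label: "sp_mono (face_label edge_monomial P) = face_label sp_edge_monomial P" if "P \<in> cells ?X" for P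
    by (rule sp_mono_face_label[OF H that])
  have quotient: "sp_mono (face_label edge_monomial P - face_label edge_monomial Q)
      = face_label sp_edge_monomial P - face_label sp_edge_monomial Q"
    if "P \<in> cells ?X" "Q \<in> cells ?X" "Q \<subset> P" for P Q
  proof -
    have "finite P"
      using cell_subset[OF that(1)] H by (rule finite_subset)
    then have "face_label edge_monomial P - face_label edge_monomial Q + face_label edge_monomial Q
        = face_label edge_monomial P"
      using that(3) by (intro mono_dvd_diff_add face_label_mono) auto
    then have "sp_mono (face_label edge_monomial P - face_label edge_monomial Q) + face_label sp_edge_monomial Q
        = face_label sp_edge_monomial P"
      using label[OF that(1)] label[OF that(2)] by (metis sp_mono_add)
    then show ?thesis
      by (metis add_diff_cancel_right')
  qed
  have "sp 0 = (0 :: (nat, 'k) mpoly)"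
    by (simp add: sp_def)
  then show ?thesis
    unfolding sp_complex_def cellular_complex_def
    by (auto simp: fun_eq_iff label quotient sp_single)
qed

section \<open>Strongly stable collections and Ferrers hypergraphs\<close>

lemma F_set_nth:
  assumes K: "K \<subseteq> dsubsets d" and x: "x \<in> F_set K"
  shows "length x = d" "sorted_wrt (<) x" "set x \<in> K" "set x \<subseteq> {1..}"
proof -
  obtain A where A: "A \<in> K" "x = sorted_list_of_set A"
    using x unfolding F_set_def by blast
  then have "finite A" "card A = d" "A \<subseteq> {1..}"
    using K unfolding dsubsets_def by auto
  then show "length x = d" "sorted_wrt (<) x" "set x \<in> K" "set x \<subseteq> {1..}"
    using A by simp_all
qed

lemma sorted_list_of_set_set: "sorted_wrt (<) (x :: nat list) \<Longrightarrow> sorted_list_of_set (set x) = x"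
  by (simp add: strict_sorted_iff sorted_list_of_set.idem_if_sorted_distinct)

text \<open>
  The new sequence stays strictly increasing: it agrees with \<open>y\<close> up to position \<open>j\<close>, and afterwards with \<open>x\<close>,
  whose entries exceed \<open>x\<^sub>j \<ge> y\<^sub>j\<close>. It is below \<open>x\<close> in the Gale order.
\<close>

lemma F_set_exchange_closed:
  assumes K: "squarefree_strongly_stable d K"
  shows "exchange_closed (\<lambda>_ v. v) d (F_set K)"
  unfolding exchange_closed_def
proof (intro ballI allI impI)
  have Kd: "K \<subseteq> dsubsets d" and stable: "\<And>A B. A \<in> K \<Longrightarrow> B \<in> dsubsets d \<Longrightarrow>
      gale_le (sorted_list_of_set B) (sorted_list_of_set A) \<Longrightarrow> B \<in> K"
    using K unfolding squarefree_strongly_stable_def by blast+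
  fix x y j assume xy: "x \<in> F_set K" "y \<in> F_set K" and j: "j < d"
    and eq: "\<forall>i<j. x ! i = y ! i" and le: "y ! j \<le> x ! j"
  note x = F_set_nth[OF Kd xy(1)] and y = F_set_nth[OF Kd xy(2)]
  let ?x = "x[j := y ! j]"
  have "?x ! p < ?x ! q" if pq: "p < q" "q < d" for p q
  proof -
    have "x ! p < x ! q" "y ! p < y ! q"
      using x(1,2) y(1,2) pq by (simp_all add: sorted_wrt_nth_less)
    then show ?thesis
      using pq j x(1) eq le by (cases "q = j"; cases "p = j") (auto simp: nth_list_update)
  qed
  then have sorted: "sorted_wrt (<) ?x"
    using x(1) by (simp add: sorted_wrt_iff_nth_less)
  have "set ?x \<subseteq> insert (y ! j) (set x)"
    by (rule set_update_subset_insert)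
  moreover have "y ! j \<in> {1..}"
    using y(1,4) j nth_mem[of j y] by blast
  ultimately have "set ?x \<subseteq> {1..}"
    using x(4) by blast
  moreover have "card (set ?x) = d"
    using sorted x(1) by (simp add: strict_sorted_iff distinct_card)
  ultimately have "set ?x \<in> dsubsets d"
    by (simp add: dsubsets_def)
  moreover have "gale_le ?x x"
    using le j x(1) by (auto simp: list_all2_conv_all_nth nth_list_update)
  ultimately have "set ?x \<in> K"
    using stable[OF x(3)] by (simp add: sorted_list_of_set_set[OF sorted] sorted_list_of_set_set[OF x(2)])
  then show "?x \<in> F_set K"
    unfolding F_set_def using sorted_list_of_set_set[OF sorted] by (metis image_eqI)
qed

lemma F_mset_nth:
  assumes M: "M \<subseteq> dmultisets d" and x: "x \<in> F_mset M"
  shows "length x = d" "sorted x" "mset x \<in> M" "set x \<subseteq> {1..}"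
proof -
  obtain A where A: "A \<in> M" "x = sorted_list_of_multiset A"
    using x unfolding F_mset_def by blast
  then have "size A = d" "set_mset A \<subseteq> {1..}"
    using M unfolding dmultisets_def by auto
  moreover have "mset x = A"
    using A by simp
  ultimately show "length x = d" "sorted x" "mset x \<in> M" "set x \<subseteq> {1..}"
    using A by (auto simp flip: size_mset set_mset_mset)
qed

lemma sorted_list_of_multiset_mset_sorted: "sorted x \<Longrightarrow> sorted_list_of_multiset (mset x) = x"
  by (simp add: sorted_list_of_multiset_mset sorted_sort_id)

lemma F_mset_exchange_closed:
  assumes M: "strongly_stable d M"
  shows "exchange_closed (\<lambda>_ v. v) d (F_mset M)"
  unfolding exchange_closed_def
proof (intro ballI allI impI)
  have Md: "M \<subseteq> dmultisets d" and stable: "\<And>A B. A \<in> M \<Longrightarrow> B \<in> dmultisets d \<Longrightarrow>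
      gale_le (sorted_list_of_multiset B) (sorted_list_of_multiset A) \<Longrightarrow> B \<in> M"
    using M unfolding strongly_stable_def by blast+
  fix x y j assume xy: "x \<in> F_mset M" "y \<in> F_mset M" and j: "j < d"
    and eq: "\<forall>i<j. x ! i = y ! i" and le: "y ! j \<le> x ! j"
  note x = F_mset_nth[OF Md xy(1)] and y = F_mset_nth[OF Md xy(2)]
  let ?x = "x[j := y ! j]"
  have "?x ! p \<le> ?x ! q" if pq: "p < q" "q < d" for p q
  proof -
    have "x ! p \<le> x ! q" "y ! p \<le> y ! q"
      using x(1,2) y(1,2) pq by (simp_all add: sorted_nth_mono)
    then show ?thesis
      using pq j x(1) eq le by (cases "q = j"; cases "p = j") (auto simp: nth_list_update)
  qed
  then have sorted: "sorted ?x"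
    using x(1) by (simp add: sorted_wrt_iff_nth_less)
  have "set ?x \<subseteq> insert (y ! j) (set x)"
    by (rule set_update_subset_insert)
  moreover have "y ! j \<in> {1..}"
    using y(1,4) j nth_mem[of j y] by blast
  ultimately have "set ?x \<subseteq> {1..}"
    using x(4) by blast
  then have "mset ?x \<in> dmultisets d"
    using x(1) by (simp add: dmultisets_def del: mset_update)
  moreover have "gale_le ?x x"
    using le j x(1) by (auto simp: list_all2_conv_all_nth nth_list_update)
  ultimately have "mset ?x \<in> M"
    using stable[OF x(3)] by (simp only: sorted_list_of_multiset_mset_sorted[OF sorted] sorted_list_of_multiset_mset_sorted[OF x(2)])
  then show "?x \<in> F_mset M"
    unfolding F_mset_def using sorted_list_of_multiset_mset_sorted[OF sorted] by (metis image_eqI)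
qed

lemma ferrers_length:
  assumes "ferrers d X F" "x \<in> F"
  shows "length x = d" "\<And>j. j < d \<Longrightarrow> x ! j \<in> X j"
proof -
  have "x \<in> listset (map X [0..<d])"
    using assms by (auto simp: ferrers_def)
  then show "length x = d" "\<And>j. j < d \<Longrightarrow> x ! j \<in> X j"
    by (auto simp: mem_listset)
qed

text \<open>
  The rank of a vertex \<open>v\<close> of part \<open>j\<close> is the number of \<open>j\<close>-th coordinates of edges that are at most \<open>v\<close>. It is
  finite even if the part is infinite, and among coordinates of edges it reflects the given order.
\<close>

lemma ferrers_exchange_closed:
  assumes F: "finite F" "ferrers d X F"
  obtains key where "exchange_closed key d F"
proof -
  obtain R where R: "\<forall>j<d. linear_order_on (X j) (R j)"
    and ideal: "\<forall>x\<in>F. \<forall>y\<in>listset (map X [0..<d]). (\<forall>j<d. (y ! j, x ! j) \<in> R j) \<longrightarrow> y \<in> F"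
    using F(2) unfolding ferrers_def by blast
  define below where "below = (\<lambda>j v. {w \<in> (\<lambda>x. x ! j) ` F. (w, v) \<in> R j})"
  have fin: "finite (below j v)" for j v
    using F(1) by (simp add: below_def)
  have "exchange_closed (\<lambda>j v. card (below j v)) d F"
    unfolding exchange_closed_def
  proof (intro ballI allI impI)
    fix x y j assume x: "x \<in> F" and y: "y \<in> F" and j: "j < d"
      and le: "card (below j (y ! j)) \<le> card (below j (x ! j))"
    note lx = ferrers_length[OF F(2) x] and ly = ferrers_length[OF F(2) y]
    have lin: "linear_order_on (X j) (R j)"
      using R j by blast
    then have rfl: "\<And>v. v \<in> X j \<Longrightarrow> (v, v) \<in> R j" and trans: "trans (R j)"
      and antisym: "antisym (R j)" and total: "total_on (X j) (R j)"
      unfolding linear_order_on_def partial_order_on_def preorder_on_def refl_on_def by blast+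
    have "(y ! j, x ! j) \<in> R j"
    proof (rule ccontr)
      assume n: "(y ! j, x ! j) \<notin> R j"
      then have xy: "(x ! j, y ! j) \<in> R j"
        using total rfl lx(2)[OF j] ly(2)[OF j] unfolding total_on_def by metis
      have "below j (x ! j) \<subseteq> below j (y ! j)"
        using transD[OF trans _ xy] unfolding below_def by blast
      moreover have "y ! j \<in> below j (y ! j)" "y ! j \<notin> below j (x ! j)"
        using y rfl[OF ly(2)[OF j]] n unfolding below_def by auto
      ultimately have "below j (x ! j) \<subset> below j (y ! j)"
        by blast
      then have "card (below j (x ! j)) < card (below j (y ! j))"
        by (rule psubset_card_mono[OF fin])
      then show False
        using le by simp
    qed
    moreover have "(x ! i, x ! i) \<in> R i" if "i < d" for i
      using R lx(2)[OF that] that unfolding linear_order_on_def partial_order_on_def preorder_on_def refl_on_def by blast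
    ultimately have "\<forall>i<d. (x[j := y ! j] ! i, x ! i) \<in> R i"
      using lx(1) j by (auto simp: nth_list_update)
    moreover have "x[j := y ! j] \<in> listset (map X [0..<d])"
      using lx ly j by (auto simp: mem_listset nth_list_update)
    ultimately show "x[j := y ! j] \<in> F"
      using ideal x by blast
  qed
  then show thesis
    by (rule that)
qed

lemma sp_edge_monomial_sum_list: "sp_edge_monomial x = sum_list (map (\<lambda>i. single i 1) x)"
  by (simp add: sp_edge_monomial_def sum_list_sum_nth atLeast0LessThan)

lemma set_monomial_F_set:
  assumes "K \<subseteq> dsubsets d"
  shows "set_monomial ` K = sp_edge_monomial ` F_set K"
proof -
  have "set_monomial A = sp_edge_monomial (sorted_list_of_set A)" if "A \<in> K" for A
  proof -
    have "finite A"
      using that assms by (auto simp: dsubsets_def)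
    then show ?thesis
      by (simp add: sp_edge_monomial_sum_list set_monomial_def sum_list_distinct_conv_sum_set)
  qed
  then show ?thesis
    by (simp add: F_set_def image_image)
qed

lemma mset_monomial_F_mset: "mset_monomial ` M = sp_edge_monomial ` F_mset M"
proof -
  have "mset_monomial A = sp_edge_monomial (sorted_list_of_multiset A)" for A
  proof -
    have "mset_monomial A = sum_mset (image_mset (\<lambda>i. single i 1) (mset (sorted_list_of_multiset A)))"
      by (simp add: mset_monomial_def)
    also have "\<dots> = sp_edge_monomial (sorted_list_of_multiset A)"
      unfolding sp_edge_monomial_sum_list mset_map[symmetric] sum_mset_sum_list ..
    finally show ?thesis .
  qed
  then show ?thesis
    by (simp add: F_mset_def image_image)
qed

section \<open>Coordinatewise isomorphisms and depolarization\<close>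

text \<open>
  A map acting on each coordinate separately carries boxes to boxes. Injectivity in each coordinate makes
  the preimage of a box inside the image of \<open>H\<close> again a box inside \<open>H\<close>, and preserves the sizes of factors.
\<close>

theorem coordinatewise_isomorphism:
  fixes H :: "'a list set" and \<phi> :: "'a list \<Rightarrow> 'b list" and s :: "nat \<Rightarrow> 'a \<Rightarrow> 'b"
  assumes d: "d > 0" and H: "finite H" and len: "\<And>x. x \<in> H \<Longrightarrow> length x = d"
    and \<phi>: "\<And>x. x \<in> H \<Longrightarrow> \<phi> x = map (\<lambda>j. s j (x ! j)) [0..<d]"
    and s: "inj_on (\<lambda>(j, v). (j, s j v)) (hyperedge_vertices H)"
  shows "cellular_isomorphism (box_complex d H) (box_complex d (\<phi> ` H)) \<phi>"
    and "\<And>P. P \<in> cells (box_complex d H) \<Longrightarrow>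
      card (hyperedge_vertices (\<phi> ` P)) = card (hyperedge_vertices P)"
proof -
  let ?X = "box_complex d H" and ?Y = "box_complex d (\<phi> ` H)" and ?S = "\<lambda>(j, v). (j, s j v)"
  have vertices: "vertices (box_complex d G) = G" if "\<And>x. x \<in> G \<Longrightarrow> length x = d" for G :: "'c list set"
  proof
    show "vertices (box_complex d G) \<subseteq> G"
      using cell_subset[of _ d G] unfolding vertices_def by blast
    show "G \<subseteq> vertices (box_complex d G)"
    proof
      fix x assume x: "x \<in> G"
      have "product_box d (point_support d x) \<subseteq> G"
        unfolding product_box_point_support[OF that[OF x]] using x by simp
      then have "product_box d (point_support d x) \<in> cells (box_complex d G)"
        by (rule product_box_in_cells[OF transversal_point_support])
      then show "x \<in> vertices (box_complex d G)"
        unfolding product_box_point_support[OF that[OF x]] vertices_def by blast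
    qed
  qed
  have hv: "(j, x ! j) \<in> hyperedge_vertices H" if "x \<in> H" "j < d" for x j
    using that len by (auto simp: hyperedge_vertices_def)
  have s_eq: "v = w" if "(j, v) \<in> hyperedge_vertices H" "(j, w) \<in> hyperedge_vertices H" "s j v = s j w" for j v w
    using inj_onD[OF s _ that(1,2)] that(3) by simp
  have inj: "inj_on \<phi> H"
  proof (rule inj_onI)
    fix x y assume xy: "x \<in> H" "y \<in> H" "\<phi> x = \<phi> y"
    show "x = y"
    proof (rule nth_equalityI)
      show "length x = length y"
        using len xy by simp
      fix j assume "j < length x"
      then have j: "j < d"
        using len xy(1) by simp
      have "\<phi> x ! j = \<phi> y ! j"
        using xy(3) by simp
      then have "s j (x ! j) = s j (y ! j)"
        using j xy(1,2) by (simp add: \<phi>)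
      then show "x ! j = y ! j"
        by (rule s_eq[OF hv[OF xy(1) j] hv[OF xy(2) j]])
    qed
  qed
  have tr_image: "transversal d (?S ` U)" if tU: "transversal d U" for U
    unfolding transversal_def
  proof (intro conjI allI impI)
    show "?S ` U \<subseteq> {..<d} \<times> UNIV"
      using tU by (auto simp: transversal_def)
    fix j assume "j < d"
    then obtain v where "(j, v) \<in> U"
      using tU by (auto simp: transversal_def)
    then show "\<exists>w. (j, w) \<in> ?S ` U"
      by (intro exI[of _ "s j v"] image_eqI[of _ _ "(j, v)"]) simp_all
  qed
  have box_image: "\<phi> ` product_box d U = product_box d (?S ` U)" if "product_box d U \<subseteq> H" for U
  proof
    show "\<phi> ` product_box d U \<subseteq> product_box d (?S ` U)"
    proof
      fix y assume "y \<in> \<phi> ` product_box d U"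
      then obtain x where x: "x \<in> product_box d U" "y = \<phi> x"
        by (rule imageE)
      then have "x \<in> H"
        using that by blast
      then show "y \<in> product_box d (?S ` U)"
        using x by (auto simp: product_box_def \<phi> image_iff) force
    qed
    show "product_box d (?S ` U) \<subseteq> \<phi> ` product_box d U"
    proof
      fix y assume y: "y \<in> product_box d (?S ` U)"
      have "\<forall>j\<in>{..<d}. \<exists>v. (j, v) \<in> U \<and> s j v = y ! j"
        using y by (force simp: product_box_def)
      then have "\<exists>g. \<forall>j\<in>{..<d}. (j, g j) \<in> U \<and> s j (g j) = y ! j"
        by (rule bchoice)
      then obtain g where g: "\<forall>j\<in>{..<d}. (j, g j) \<in> U \<and> s j (g j) = y ! j"
        by (rule exE)
      let ?x = "map g [0..<d]"
      have x: "?x \<in> product_box d U"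
        using g by (simp add: product_box_def)
      then have "\<phi> ?x = map (\<lambda>j. s j (?x ! j)) [0..<d]"
        using that by (intro \<phi>) blast
      also have "\<dots> = y"
        using y g by (intro nth_equalityI) (simp_all add: product_box_def)
      finally show "y \<in> \<phi> ` product_box d U"
        using x by (intro image_eqI[of _ _ ?x]) simp_all
    qed
  qed
  have cell_image: "\<phi> ` P = product_box d (?S ` hyperedge_vertices P)"
    if "P \<in> cells ?X" "P \<noteq> {}" for P
    using box_image[of "hyperedge_vertices P"] nonempty_cell(2,3)[OF that] by simp
  have tr_cell: "transversal d (?S ` hyperedge_vertices P)" if "P \<in> cells ?X" "P \<noteq> {}" for P
    by (rule tr_image[OF nonempty_cell(1)[OF that]])
  have V_image: "hyperedge_vertices (\<phi> ` P) = ?S ` hyperedge_vertices P"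
    if "P \<in> cells ?X" "P \<noteq> {}" for P
    unfolding cell_image[OF that] by (rule hyperedge_vertices_product_box[OF tr_cell[OF that]])
  show card: "card (hyperedge_vertices (\<phi> ` P)) = card (hyperedge_vertices P)" if "P \<in> cells ?X" for P
  proof (cases "P = {}")
    case False
    have "inj_on ?S (hyperedge_vertices P)"
      by (rule inj_on_subset[OF s hyperedge_vertices_mono[OF cell_subset[OF that]]])
    then show ?thesis
      unfolding V_image[OF that False] by (rule card_image)
  qed (simp add: hyperedge_vertices_def)
  have into: "\<phi> ` P \<in> cells ?Y" if "P \<in> cells ?X" for P
  proof (cases "P = {}")
    case False
    have "product_box d (?S ` hyperedge_vertices P) \<subseteq> \<phi> ` H"
      unfolding cell_image[OF that False, symmetric] using cell_subset[OF that] by (rule image_mono)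
    then show ?thesis
      unfolding cell_image[OF that False] by (rule product_box_in_cells[OF tr_cell[OF that False]])
  qed simp
  have onto: "\<exists>P\<in>cells ?X. Q = \<phi> ` P" if Q: "Q \<in> cells ?Y" for Q
  proof (cases "Q = {}")
    case True
    then show ?thesis
      by (intro bexI[of _ "{}"]) simp_all
  next
    case False
    note Q' = nonempty_cell[OF Q False]
    define U where "U = {u \<in> hyperedge_vertices H. ?S u \<in> hyperedge_vertices Q}"
    have pre: "\<exists>v. (j, v) \<in> U \<and> s j v = w" if w: "(j, w) \<in> hyperedge_vertices Q" for j w
    proof -
      have j: "j < d"
        using w Q'(1) by (auto simp: transversal_def)
      obtain y where y: "y \<in> product_box d (hyperedge_vertices Q)" "y ! j = w"
        by (rule transversal_point[OF Q'(1) w])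
      then have "y \<in> \<phi> ` H"
        using Q'(2,3) by auto
      then obtain x where x: "y = \<phi> x" "x \<in> H"
        by (rule imageE)
      have "s j (x ! j) = w"
        using y(2) j x by (simp add: \<phi>)
      then show ?thesis
        using w hv[OF x(2) j] by (intro exI[of _ "x ! j"]) (simp add: U_def)
    qed
    have SU: "?S ` U = hyperedge_vertices Q"
    proof
      show "?S ` U \<subseteq> hyperedge_vertices Q"
        by (auto simp: U_def)
      show "hyperedge_vertices Q \<subseteq> ?S ` U"
      proof clarify
        fix j w assume "(j, w) \<in> hyperedge_vertices Q"
        then obtain v where "(j, v) \<in> U" "s j v = w"
          using pre by blast
        then show "(j, w) \<in> ?S ` U"
          by (intro image_eqI[of _ _ "(j, v)"]) simp_all
      qed
    qed
    have tU: "transversal d U"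
      unfolding transversal_def
    proof (intro conjI allI impI)
      show "U \<subseteq> {..<d} \<times> UNIV"
        using len by (auto simp: U_def hyperedge_vertices_def)
      fix j assume "j < d"
      then obtain w where "(j, w) \<in> hyperedge_vertices Q"
        using Q'(1) by (auto simp: transversal_def)
      then show "\<exists>v. (j, v) \<in> U"
        using pre by blast
    qed
    have sub: "product_box d U \<subseteq> H"
    proof
      fix x assume x: "x \<in> product_box d U"
      let ?y = "map (\<lambda>j. s j (x ! j)) [0..<d]"
      have "?y \<in> product_box d (hyperedge_vertices Q)"
        using x by (auto simp: product_box_def U_def)
      then have "?y \<in> \<phi> ` H"
        using Q'(2,3) by auto
      then obtain z where z: "?y = \<phi> z" "z \<in> H"
        by (rule imageE)
      have "x = z"
      proof (rule nth_equalityI)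
        show "length x = length z"
          using x len[OF z(2)] by (simp add: product_box_def)
        fix j assume "j < length x"
        then have j: "j < d"
          using x by (simp add: product_box_def)
        have "?y ! j = \<phi> z ! j"
          using z(1) by simp
        then have "s j (x ! j) = s j (z ! j)"
          using j z(2) by (simp add: \<phi>)
        moreover have "(j, x ! j) \<in> hyperedge_vertices H"
          using x j by (auto simp: product_box_def U_def)
        ultimately show "x ! j = z ! j"
          using s_eq hv[OF z(2) j] by blast
      qed
      then show "x \<in> H"
        using z(2) by simp
    qed
    have "Q = \<phi> ` product_box d U"
      unfolding box_image[OF sub] SU by (rule Q'(2)[symmetric])
    then show ?thesis
      using product_box_in_cells[OF tU sub] by (intro bexI)
  qed
  have finY: "finite (\<phi> ` H)"
    using H by simp
  show "cellular_isomorphism ?X ?Y \<phi>"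
    unfolding cellular_isomorphism_def
  proof (intro conjI ballI)
    have "length (\<phi> x) = d" if "x \<in> H" for x
      using that by (simp add: \<phi>)
    then have "vertices ?Y = \<phi> ` H"
      by (intro vertices) auto
    then show "bij_betw \<phi> (vertices ?X) (vertices ?Y)"
      using inj vertices[OF len] by (simp add: bij_betw_def)
    show "bij_betw ((`) \<phi>) (cells ?X) (cells ?Y)"
      unfolding bij_betw_def
    proof
      show "inj_on ((`) \<phi>) (cells ?X)"
      proof (rule inj_onI)
        fix P Q assume "P \<in> cells ?X" "Q \<in> cells ?X" "\<phi> ` P = \<phi> ` Q"
        then show "P = Q"
          using inj_on_image_eq_iff[OF inj cell_subset cell_subset] by simp
      qed
      show "(`) \<phi> ` cells ?X = cells ?Y"
      proof (rule subset_antisym; rule subsetI)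
        fix Q assume "Q \<in> (`) \<phi> ` cells ?X"
        then show "Q \<in> cells ?Y"
          by (elim imageE) (simp add: into)
      next
        fix Q assume "Q \<in> cells ?Y"
        from onto[OF this] obtain P where "P \<in> cells ?X" "Q = \<phi> ` P"
          by (elim bexE)
        then show "Q \<in> (`) \<phi> ` cells ?X"
          by (intro image_eqI)
      qed
    qed
    fix P assume P: "P \<in> cells ?X"
    show "cell_dim ?Y (\<phi> ` P) = cell_dim ?X P"
    proof (cases "P = {}")
      case False
      then have "\<phi> ` P \<noteq> {}"
        by simp
      then have "cell_dim ?Y (\<phi> ` P) = int (card (hyperedge_vertices (\<phi> ` P))) - int d"
        by (rule cell_dim_nonempty[OF finY into[OF P]])
      then show ?thesis
        by (simp only: cell_dim_nonempty[OF H P False] card[OF P])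
    qed simp
  qed
qed

lemma cellular_isomorphism_card:
  assumes "cellular_isomorphism X Y \<phi>"
  shows "card {P \<in> cells X. cell_dim X P = i} = card {Q \<in> cells Y. cell_dim Y Q = i}"
proof (rule bij_betw_same_card)
  have bij: "bij_betw ((`) \<phi>) (cells X) (cells Y)" and dim: "\<forall>P\<in>cells X. cell_dim Y (\<phi> ` P) = cell_dim X P"
    using assms by (simp_all add: cellular_isomorphism_def)
  have "(`) \<phi> ` {P \<in> cells X. cell_dim X P = i} = {Q \<in> cells Y. cell_dim Y Q = i}"
  proof (rule subset_antisym; rule subsetI)
    fix Q assume "Q \<in> {Q \<in> cells Y. cell_dim Y Q = i}"
    then have Q: "Q \<in> (`) \<phi> ` cells X" "cell_dim Y Q = i"
      using bij_betw_imp_surj_on[OF bij] by simp_all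
    then obtain P where "Q = \<phi> ` P" "P \<in> cells X"
      by (elim imageE)
    then show "Q \<in> (`) \<phi> ` {P \<in> cells X. cell_dim X P = i}"
      using Q(2) dim by simp
  qed (use bij_betw_imp_surj_on[OF bij] dim in auto)
  then show "bij_betw ((`) \<phi>) {P \<in> cells X. cell_dim X P = i} {Q \<in> cells Y. cell_dim Y Q = i}"
    using bij by (intro bij_betw_subset[OF bij]) auto
qed

text \<open>
  Depolarization on increasing sequences. Positions are counted from \<open>0\<close>, so the entry in position \<open>j\<close> is
  decreased by \<open>j\<close>.
\<close>

definition compress :: "nat list \<Rightarrow> nat list" where
  "compress x = map2 (-) x [0..<length x]"

definition stretch :: "nat list \<Rightarrow> nat list" where
  "stretch y = map2 (+) y [0..<length y]"

lemma length_compress [simp]: "length (compress x) = length x"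
  by (simp add: compress_def)

lemma length_stretch [simp]: "length (stretch x) = length x"
  by (simp add: stretch_def)

lemma nth_compress: "j < length x \<Longrightarrow> compress x ! j = x ! j - j"
  by (simp add: compress_def)

lemma nth_stretch: "j < length x \<Longrightarrow> stretch x ! j = x ! j + j"
  by (simp add: stretch_def)

lemma strict_sorted_nth_ge:
  assumes x: "sorted_wrt (<) x" "set x \<subseteq> {1..}" and j: "j < length x"
  shows "x ! j \<ge> j + 1"
  using j
proof (induction j)
  case 0
  then show ?case
    using x(2) nth_mem[of 0 x] by force
next
  case (Suc j)
  then show ?case
    using sorted_wrt_nth_less[OF x(1), of j "Suc j"] by simp
qed

lemma sorted_compress:
  assumes "sorted_wrt (<) x"
  shows "sorted (compress x)"
  unfolding sorted_iff_nth_Suc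
proof (intro allI impI)
  fix j assume j: "Suc j < length (compress x)"
  then have "x ! j < x ! Suc j"
    using sorted_wrt_nth_less[OF assms, of j "Suc j"] by simp
  then show "compress x ! j \<le> compress x ! Suc j"
    using j by (simp add: nth_compress)
qed

lemma strict_sorted_stretch:
  assumes "sorted y"
  shows "sorted_wrt (<) (stretch y)"
  unfolding sorted_wrt_iff_nth_less
proof (intro allI impI)
  fix p q assume pq: "p < q" "q < length (stretch y)"
  then have "y ! p \<le> y ! q"
    using sorted_nth_mono[OF assms, of p q] by simp
  then show "stretch y ! p < stretch y ! q"
    using pq by (simp add: nth_stretch)
qed

lemma compress_stretch: "compress (stretch y) = y"
  by (rule nth_equalityI) (simp_all add: nth_compress nth_stretch)

lemma stretch_compress: "sorted_wrt (<) x \<Longrightarrow> set x \<subseteq> {1..} \<Longrightarrow> stretch (compress x) = x"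
proof (rule nth_equalityI)
  assume x: "sorted_wrt (<) x" "set x \<subseteq> {1..}"
  fix j assume "j < length (stretch (compress x))"
  then show "stretch (compress x) ! j = x ! j"
    using strict_sorted_nth_ge[OF x, of j] by (simp add: nth_compress nth_stretch)
qed simp

lemma depol_compress: "finite A \<Longrightarrow> depol A = mset (compress (sorted_list_of_set A))"
  by (simp add: depol_def compress_def)

lemma depol_bij_betw: "bij_betw depol (dsubsets d) (dmultisets d)"
proof (rule bij_betwI[where g = "\<lambda>B. set (stretch (sorted_list_of_multiset B))"])
  have list: "sorted_wrt (<) (sorted_list_of_set A)" "set (sorted_list_of_set A) \<subseteq> {1..}"
      "length (sorted_list_of_set A) = d" "finite A" if "A \<in> dsubsets d" for A
    using that by (auto simp: dsubsets_def)
  have mlist: "sorted (sorted_list_of_multiset B)" "set (sorted_list_of_multiset B) \<subseteq> {1..}"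
      "length (sorted_list_of_multiset B) = d" if "B \<in> dmultisets d" for B
  proof -
    have "mset (sorted_list_of_multiset B) = B"
      by simp
    then show "set (sorted_list_of_multiset B) \<subseteq> {1..}" "length (sorted_list_of_multiset B) = d"
      using that unfolding dmultisets_def by (auto simp flip: size_mset set_mset_mset)
  qed simp
  show "depol \<in> dsubsets d \<rightarrow> dmultisets d"
  proof
    fix A assume A: "A \<in> dsubsets d"
    have "v \<ge> 1" if v: "v \<in> set (compress (sorted_list_of_set A))" for v
    proof -
      obtain j where j: "j < length (sorted_list_of_set A)" "v = compress (sorted_list_of_set A) ! j"
        using v by (auto simp: in_set_conv_nth)
      then show ?thesis
        using strict_sorted_nth_ge[OF list(1,2)[OF A] j(1)] by (simp add: nth_compress)
    qed
    then show "depol A \<in> dmultisets d"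
      using list(3)[OF A] by (auto simp: dmultisets_def depol_compress[OF list(4)[OF A]])
  qed
  show "(\<lambda>B. set (stretch (sorted_list_of_multiset B))) \<in> dmultisets d \<rightarrow> dsubsets d"
  proof
    fix B assume B: "B \<in> dmultisets d"
    have "v \<ge> 1" if v: "v \<in> set (stretch (sorted_list_of_multiset B))" for v
    proof -
      obtain j where j: "j < length (sorted_list_of_multiset B)" "v = stretch (sorted_list_of_multiset B) ! j"
        using v by (auto simp: in_set_conv_nth)
      have "sorted_list_of_multiset B ! j \<in> {1..}"
        using mlist(2)[OF B] nth_mem[OF j(1)] by blast
      then show ?thesis
        using j by (simp add: nth_stretch)
    qed
    moreover have "distinct (stretch (sorted_list_of_multiset B))"
      using strict_sorted_stretch[OF mlist(1)[OF B]] by (simp add: strict_sorted_iff)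
    then have "card (set (stretch (sorted_list_of_multiset B))) = d"
      using mlist(3)[OF B] by (simp add: distinct_card)
    ultimately show "set (stretch (sorted_list_of_multiset B)) \<in> dsubsets d"
      by (auto simp: dsubsets_def)
  qed
  show "set (stretch (sorted_list_of_multiset (depol A))) = A" if "A \<in> dsubsets d" for A
    using list[OF that] by (simp add: depol_compress sorted_sort_id sorted_compress stretch_compress)
  show "depol (set (stretch (sorted_list_of_multiset B))) = B" if "B \<in> dmultisets d" for B
    using sorted_list_of_set_set[OF strict_sorted_stretch[OF mlist(1)[OF that]]]
    by (simp add: depol_compress compress_stretch)
qed

lemma depol_vertex_compress: "sorted_wrt (<) x \<Longrightarrow> depol_vertex x = compress x"
  by (simp add: depol_vertex_def depol_compress sorted_list_of_set_set sorted_sort_id sorted_compress)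

lemma F_mset_depol:
  assumes "K \<subseteq> dsubsets d"
  shows "F_mset (depol ` K) = depol_vertex ` F_set K"
proof -
  have "sorted_list_of_multiset (depol A) = depol_vertex (sorted_list_of_set A)" if "A \<in> K" for A
    using that assms by (auto simp: depol_vertex_def dsubsets_def)
  then show ?thesis
    by (simp add: F_mset_def F_set_def image_image)
qed

text \<open>
  Truncated subtraction of \<open>j\<close> is injective on the \<open>j\<close>-th entries because these are greater than \<open>j\<close> in a
  strictly increasing sequence of positive numbers.
\<close>

theorem depol_vertex_isomorphism:
  assumes K: "K \<subseteq> dsubsets d" and d: "d > 0" and fin: "finite (F_set K)"
  shows "cellular_isomorphism (box_complex d (F_set K)) (box_complex d (depol_vertex ` F_set K)) depol_vertex"
    and "\<forall>P\<in>cells (box_complex d (F_set K)).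
      mono_deg (face_label edge_monomial (depol_vertex ` P)) = mono_deg (face_label edge_monomial P)"
proof -
  let ?H = "F_set K"
  note x = F_set_nth[OF K]
  have vertex: "depol_vertex y = map (\<lambda>j. y ! j - j) [0..<d]" if "y \<in> ?H" for y
    unfolding depol_vertex_compress[OF x(2)[OF that]]
    by (rule nth_equalityI) (simp_all add: x(1)[OF that] nth_compress)
  have ge: "v \<ge> j" if "(j, v) \<in> hyperedge_vertices ?H" for j v
  proof -
    have "\<exists>y\<in>?H. j < length y \<and> v = y ! j"
      using that by (auto simp: hyperedge_vertices_def)
    then obtain y where y: "y \<in> ?H" "j < length y" "v = y ! j"
      by blast
    then show ?thesis
      using strict_sorted_nth_ge[OF x(2)[OF y(1)] x(4)[OF y(1)] y(2)] by simp
  qed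
  have inj: "inj_on (\<lambda>(j, v). (j, v - j)) (hyperedge_vertices ?H)"
  proof (rule inj_onI)
    fix u u' assume u: "u \<in> hyperedge_vertices ?H" "u' \<in> hyperedge_vertices ?H"
      and eq: "(case u of (j, v) \<Rightarrow> (j, v - j)) = (case u' of (j, v) \<Rightarrow> (j, v - j))"
    obtain j v j' v' where *: "u = (j, v)" "u' = (j', v')"
      by (cases u; cases u') auto
    then show "u = u'"
      using ge[of j v] ge[of j' v'] u eq by auto
  qed
  have iso: "cellular_isomorphism (box_complex d ?H) (box_complex d (depol_vertex ` ?H)) depol_vertex"
    and card: "\<And>P. P \<in> cells (box_complex d ?H) \<Longrightarrow>
      card (hyperedge_vertices (depol_vertex ` P)) = card (hyperedge_vertices P)"
    using coordinatewise_isomorphism[OF d fin x(1) vertex inj] by simp_all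
  show "cellular_isomorphism (box_complex d ?H) (box_complex d (depol_vertex ` ?H)) depol_vertex"
    by (fact iso)
  show "\<forall>P\<in>cells (box_complex d ?H).
      mono_deg (face_label edge_monomial (depol_vertex ` P)) = mono_deg (face_label edge_monomial P)"
  proof
    fix P assume P: "P \<in> cells (box_complex d ?H)"
    show "mono_deg (face_label edge_monomial (depol_vertex ` P)) = mono_deg (face_label edge_monomial P)"
    proof (cases "P = {}")
      case False
      have image: "depol_vertex ` P \<in> cells (box_complex d (depol_vertex ` ?H))" "depol_vertex ` P \<noteq> {}"
        using iso P False unfolding cellular_isomorphism_def bij_betw_def by auto
      show ?thesis
        unfolding edge_monomial_eq
        using mono_deg_face_label_cell[OF fin P False, of Pair]
          mono_deg_face_label_cell[OF finite_imageI[OF fin] image, of Pair] card[OF P]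
        by (simp add: inj_on_def)
    qed simp
  qed
qed

theorem theorem3p12:
  fixes d N :: nat
    and K :: "nat set set" and M :: "nat multiset set"
    and X :: "nat \<Rightarrow> 'a set" and F :: "'a list set"
    and V\<^sub>K V\<^sub>M :: "(nat \<times> nat) set" and V\<^sub>F :: "(nat \<times> 'a) set"
    and I\<^sub>F\<^sub>K I\<^sub>F\<^sub>M :: "(nat \<times> nat, 'k::field) mpoly set"
    and I\<^sub>F :: "(nat \<times> 'a, 'k) mpoly set"
    and I\<^sub>K I\<^sub>M :: "(nat, 'k) mpoly set"
  assumes d: "d \<ge> 2"
    and K: "finite K" "squarefree_strongly_stable d K"
    and M: "finite M" "strongly_stable d M"
    and F: "finite F" "ferrers d X F"
    \<comment> \<open>the finite sets of variables\<close>
    and V\<^sub>K: "hyperedge_vertices (F_set K) \<subseteq> V\<^sub>K" "V\<^sub>K \<subseteq> {..<d} \<times> {1..N}"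
    and V\<^sub>M: "hyperedge_vertices (F_mset M) \<subseteq> V\<^sub>M" "V\<^sub>M \<subseteq> {..<d} \<times> {1..N}"
    and V\<^sub>F: "finite V\<^sub>F" "hyperedge_vertices F \<subseteq> V\<^sub>F" "V\<^sub>F \<subseteq> (SIGMA j:{..<d}. X j)"
    \<comment> \<open>the ideals\<close>
    and I\<^sub>F\<^sub>K: "I\<^sub>F\<^sub>K = monomial_ideal V\<^sub>K (edge_monomial ` F_set K)"
    and I\<^sub>F\<^sub>M: "I\<^sub>F\<^sub>M = monomial_ideal V\<^sub>M (edge_monomial ` F_mset M)"
    and I\<^sub>F: "I\<^sub>F = monomial_ideal V\<^sub>F (edge_monomial ` F)"
    and I\<^sub>K: "I\<^sub>K = monomial_ideal {1..N} (set_monomial ` K)"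
    and I\<^sub>M: "I\<^sub>M = monomial_ideal {1..N} (mset_monomial ` M)"
  shows
    "\<comment> \<open>(i)\<close>
     minimal_linear_cellular_resolution V\<^sub>K d (box_complex d (F_set K)) edge_monomial I\<^sub>F\<^sub>K \<and>
     minimal_linear_cellular_resolution V\<^sub>M d (box_complex d (F_mset M)) edge_monomial I\<^sub>F\<^sub>M \<and>
     minimal_linear_cellular_resolution V\<^sub>F d (box_complex d F) edge_monomial I\<^sub>F \<and>
     (\<forall>Xs\<in>boxes d (F_set K). fine_betti V\<^sub>K I\<^sub>F\<^sub>K ((\<Sum>Y\<leftarrow>Xs. card Y) - d) (box_degree Xs) = 1) \<and>
     (\<forall>i \<alpha>. (\<nexists>Xs. Xs \<in> boxes d (F_set K) \<and> i = (\<Sum>Y\<leftarrow>Xs. card Y) - d \<and> \<alpha> = box_degree Xs) \<longrightarrow>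
        fine_betti V\<^sub>K I\<^sub>F\<^sub>K i \<alpha> = 0) \<and>
     (\<forall>Xs\<in>boxes d (F_mset M). fine_betti V\<^sub>M I\<^sub>F\<^sub>M ((\<Sum>Y\<leftarrow>Xs. card Y) - d) (box_degree Xs) = 1) \<and>
     (\<forall>i \<alpha>. (\<nexists>Xs. Xs \<in> boxes d (F_mset M) \<and> i = (\<Sum>Y\<leftarrow>Xs. card Y) - d \<and> \<alpha> = box_degree Xs) \<longrightarrow>
        fine_betti V\<^sub>M I\<^sub>F\<^sub>M i \<alpha> = 0) \<and>
     (\<forall>Xs\<in>boxes d F. fine_betti V\<^sub>F I\<^sub>F ((\<Sum>Y\<leftarrow>Xs. card Y) - d) (box_degree Xs) = 1) \<and>
     (\<forall>i \<alpha>. (\<nexists>Xs. Xs \<in> boxes d F \<and> i = (\<Sum>Y\<leftarrow>Xs. card Y) - d \<and> \<alpha> = box_degree Xs) \<longrightarrow>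
        fine_betti V\<^sub>F I\<^sub>F i \<alpha> = 0) \<and>
     \<comment> \<open>(ii)\<close>
     (\<forall>sg. incidence_function (box_complex d (F_set K)) sg \<longrightarrow>
        sp_complex (cellular_complex (box_complex d (F_set K)) edge_monomial sg
          :: (nat list set, (nat \<times> nat) mono, nat \<times> nat, 'k) free_complex)
        = cellular_complex (box_complex d (F_set K)) sp_edge_monomial sg) \<and>
     (\<forall>sg. incidence_function (box_complex d (F_mset M)) sg \<longrightarrow>
        sp_complex (cellular_complex (box_complex d (F_mset M)) edge_monomial sg
          :: (nat list set, (nat \<times> nat) mono, nat \<times> nat, 'k) free_complex)
        = cellular_complex (box_complex d (F_mset M)) sp_edge_monomial sg) \<and>
     minimal_linear_cellular_resolution {1..N} d (box_complex d (F_set K)) sp_edge_monomial I\<^sub>K \<and>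
     minimal_linear_cellular_resolution {1..N} d (box_complex d (F_mset M)) sp_edge_monomial I\<^sub>M \<and>
     (\<forall>i j. Z_betti V\<^sub>K I\<^sub>F\<^sub>K i j = Z_betti {1..N} I\<^sub>K i j) \<and>
     (\<forall>i j. Z_betti V\<^sub>M I\<^sub>F\<^sub>M i j = Z_betti {1..N} I\<^sub>M i j) \<and>
     \<comment> \<open>(iii)\<close>
     bij_betw depol (dsubsets d) (dmultisets d) \<and>
     (M = depol ` K \<longrightarrow>
        cellular_isomorphism (box_complex d (F_set K)) (box_complex d (F_mset M)) depol_vertex \<and>
        (\<forall>P\<in>cells (box_complex d (F_set K)).
           mono_deg (face_label edge_monomial (depol_vertex ` P)) = mono_deg (face_label edge_monomial P)) \<and>
        (\<forall>i j. Z_betti {1..N} I\<^sub>K i j = Z_betti {1..N} I\<^sub>M i j \<and>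
               Z_betti {1..N} I\<^sub>K i j = Z_betti V\<^sub>K I\<^sub>F\<^sub>K i j \<and>
               Z_betti {1..N} I\<^sub>K i j = Z_betti V\<^sub>M I\<^sub>F\<^sub>M i j))"
proof -
  have d0: "d > 0"
    using d by simp
  have Kd: "K \<subseteq> dsubsets d" and Md: "M \<subseteq> dmultisets d"
    using K(2) M(2) by (simp_all add: squarefree_strongly_stable_def strongly_stable_def)
  have finK: "finite (F_set K)" and finM: "finite (F_mset M)"
    using K(1) M(1) by (simp_all add: F_set_def F_mset_def)
  note nthK = F_set_nth[OF Kd] and nthM = F_mset_nth[OF Md]
  note lenF = ferrers_length(1)[OF F(2)]
  note exK = F_set_exchange_closed[OF K(2)] and exM = F_mset_exchange_closed[OF M(2)]
  obtain key where exF: "exchange_closed key d F"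
    by (rule ferrers_exchange_closed[OF F])
  have resFK: "minimal_linear_cellular_resolution V\<^sub>K d (box_complex d (F_set K)) edge_monomial I\<^sub>F\<^sub>K"
    unfolding I\<^sub>F\<^sub>K by (rule edge_resolution[OF d0 finK nthK(1) V\<^sub>K(1) exK])
  have resFM: "minimal_linear_cellular_resolution V\<^sub>M d (box_complex d (F_mset M)) edge_monomial I\<^sub>F\<^sub>M"
    unfolding I\<^sub>F\<^sub>M by (rule edge_resolution[OF d0 finM nthM(1) V\<^sub>M(1) exM])
  have resF: "minimal_linear_cellular_resolution V\<^sub>F d (box_complex d F) edge_monomial I\<^sub>F"
    unfolding I\<^sub>F by (rule edge_resolution[OF d0 F(1) lenF V\<^sub>F(2) exF])
  have entries: "set x \<subseteq> {1..N}"
    if "x \<in> H" "hyperedge_vertices H \<subseteq> V" "V \<subseteq> {..<d} \<times> {1..N}" for x and H :: "nat list set" and V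
  proof
    fix v assume "v \<in> set x"
    then obtain j where "j < length x" "v = x ! j"
      by (auto simp: in_set_conv_nth)
    then have "(j, v) \<in> hyperedge_vertices H"
      using that(1) by (auto simp: hyperedge_vertices_def)
    then show "v \<in> {1..N}"
      using that(2,3) by blast
  qed
  have sortedK: "sorted x" if "x \<in> F_set K" for x
    using nthK(2)[OF that] by (simp add: strict_sorted_iff)
  have resK: "minimal_linear_cellular_resolution {1..N} d (box_complex d (F_set K)) sp_edge_monomial I\<^sub>K"
    unfolding I\<^sub>K set_monomial_F_set[OF Kd]
    by (rule sp_resolution[OF d0 finK nthK(1) sortedK entries[OF _ V\<^sub>K] exK])
  have resM: "minimal_linear_cellular_resolution {1..N} d (box_complex d (F_mset M)) sp_edge_monomial I\<^sub>M"
    unfolding I\<^sub>M mset_monomial_F_mset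
    by (rule sp_resolution[OF d0 finM nthM(1) nthM(2) entries[OF _ V\<^sub>M] exM])
  note Z_betti = betti_of_cellular_resolution(2)[OF resFK] betti_of_cellular_resolution(2)[OF resFM]
    betti_of_cellular_resolution(2)[OF resK] betti_of_cellular_resolution(2)[OF resM]
  have iso: "cellular_isomorphism (box_complex d (F_set K)) (box_complex d (F_mset M)) depol_vertex"
    and iso_deg: "\<forall>P\<in>cells (box_complex d (F_set K)).
      mono_deg (face_label edge_monomial (depol_vertex ` P)) = mono_deg (face_label edge_monomial P)"
    if "M = depol ` K"
    using depol_vertex_isomorphism[OF Kd d0 finK] that by (simp_all add: F_mset_depol[OF Kd])
  have cellsKM: "card {P \<in> cells (box_complex d (F_set K)). cell_dim (box_complex d (F_set K)) P = i}
      = card {P \<in> cells (box_complex d (F_mset M)). cell_dim (box_complex d (F_mset M)) P = i}"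
    if "M = depol ` K" for i
    by (rule cellular_isomorphism_card[OF iso[OF that]])
  show ?thesis
  proof (intro conjI allI impI)
    show "Z_betti V\<^sub>K I\<^sub>F\<^sub>K i j = Z_betti {1..N} I\<^sub>K i j" for i j
      by (simp only: Z_betti)
    show "Z_betti V\<^sub>M I\<^sub>F\<^sub>M i j = Z_betti {1..N} I\<^sub>M i j" for i j
      by (simp only: Z_betti)
    show "Z_betti {1..N} I\<^sub>K i j = Z_betti {1..N} I\<^sub>M i j" "Z_betti {1..N} I\<^sub>K i j = Z_betti V\<^sub>K I\<^sub>F\<^sub>K i j"
      "Z_betti {1..N} I\<^sub>K i j = Z_betti V\<^sub>M I\<^sub>F\<^sub>M i j" if "M = depol ` K" for i j
      by (simp_all only: Z_betti cellsKM[OF that])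
    show "sp_complex (cellular_complex (box_complex d (F_set K)) edge_monomial sg
          :: (nat list set, (nat \<times> nat) mono, nat \<times> nat, 'k) free_complex)
        = cellular_complex (box_complex d (F_set K)) sp_edge_monomial sg" for sg
      by (rule sp_cellular_complex[OF finK])
    show "sp_complex (cellular_complex (box_complex d (F_mset M)) edge_monomial sg
          :: (nat list set, (nat \<times> nat) mono, nat \<times> nat, 'k) free_complex)
        = cellular_complex (box_complex d (F_mset M)) sp_edge_monomial sg" for sg
      by (rule sp_cellular_complex[OF finM])
  qed (fact resFK resFM resF resK resM iso iso_deg depol_bij_betw
      fine_betti_boxes[OF finK resFK, rule_format] fine_betti_boxes[OF finM resFM, rule_format]
      fine_betti_boxes[OF F(1) resF, rule_format] fine_betti_boxes[OF finK resFK] fine_betti_boxes[OF finM resFM]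
      fine_betti_boxes[OF F(1) resF])+
qed

end
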